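(* Let $X$ be a compact connected Riemann surface of genus at least $2$, and let $x\in X$ be a point. Let $F\to X$ be a holomorphic vector bundle of rank $r=2n+1$ equipped with a symmetric bilinear form $\psi:F\otimes F\to M$, with $M$ a holomorphic line bundle, which induces a short exact sequence $$0\to F\to F^\vee\otimes M\to\mathbb{C}_x\to 0,$$ where $\mathbb{C}_x$ is the skyscraper sheaf of length one supported at $x$. (In other words, $\psi$ is nondegenerate everywhere except at $x$, and in an étale neighborhood of $x$ it has, in suitable trivializations, the matrix $$\begin{pmatrix}0&&\mathbf{1}_n\\&t&\\\mathbf{1}_n&&0\end{pmatrix},$$ where $t$ is a local parameter at $x$.) Let $$0\to l_x\to F_x\to F_x^\vee\otimes M_x\to\mathbb{C}_x\to 0$$ be the exact sequence obtained by restricting the short exact sequence $0\to F\to F^\vee\otimes M\to\mathbb{C}_x\to 0$ to $x$. Let $S_x$ be an isotropic subspace of dimension $n$ of $F_x/l_x$. Define $Q_x:=(F_x/l_x)/S_x$ and consider the short exact sequence $$0\to E\to F\to Q_x\to 0,$$ where $F\to F_x\to F_x/l_x\to Q_x$ is the natural projection. Then $\psi$ induces an orthogonal structure on $E$ $$\varphi:E\otimes E\to L:=M(-x);$$ that is, the composition $E\otimes E\to F\otimes F\xrightarrow{\psi}M$ factors through $M(-x)\subset M$, and the resulting homomorphism $\varphi$ is symmetric and nondegenerate on every fiber.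
   Context: Here $M(-x)=M\otimes_{\mathcal{O}_X}\mathcal{O}_X(-x)$. The line $l_x\subset F_x$ is the annihilator (radical) of the bilinear form $\psi_x$ on $F_x$, so $\psi_x$ induces a nondegenerate symmetric bilinear form with values in $M_x$ on the $2n$-dimensional space $F_x/l_x$; "isotropic" refers to this form (it vanishes identically on the subspace). An orthogonal structure on a vector bundle $E$ with values in a line bundle $L$ is a symmetric homomorphism $E\otimes E\to L$ which is nondegenerate on every fiber. $\mathbf{1}_n$ denotes the $n\times n$ identity matrix. *)

theory Defs
  imports
    "HOL-Complex_Analysis.Complex_Analysis"
    "HOL-Algebra.AbelCoset"
    "Jordan_Normal_Form.VS_Connect"
begin

section \<open>Riemann surfaces\<close>

type_synonym 'a chart = "'a set \<times> ('a \<Rightarrow> complex)"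

definition complex_chart :: "('a::topological_space) chart \<Rightarrow> bool" where
  "complex_chart c \<longleftrightarrow> open (fst c) \<and> open (snd c ` fst c) \<and>
     (\<exists>g. homeomorphism (fst c) (snd c ` fst c) (snd c) g)"

definition chart_inv :: "'a chart \<Rightarrow> complex \<Rightarrow> 'a" where
  "chart_inv c = the_inv_into (fst c) (snd c)"

text \<open>The surface is the whole type \<^typ>\<open>'a\<close>, its complex structure the atlas \<^term>\<open>A\<close>.\<close>

definition riemann_surface :: "('a::t2_space) chart set \<Rightarrow> bool" where
  "riemann_surface A \<longleftrightarrow> (\<forall>c\<in>A. complex_chart c) \<and> (\<Union>c\<in>A. fst c) = UNIV \<and>
     (\<forall>c\<in>A. \<forall>d\<in>A. (snd d \<circ> chart_inv c) holomorphic_on (snd c ` (fst c \<inter> fst d)))"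

definition compact_connected_riemann_surface :: "('a::t2_space) chart set \<Rightarrow> bool" where
  "compact_connected_riemann_surface A \<longleftrightarrow>
     riemann_surface A \<and> compact (UNIV :: 'a set) \<and> connected (UNIV :: 'a set)"

definition holomorphic_fun :: "('a::t2_space) chart set \<Rightarrow> 'a set \<Rightarrow> ('a \<Rightarrow> complex) \<Rightarrow> bool" where
  "holomorphic_fun A U f \<longleftrightarrow>
     (\<forall>c\<in>A. (f \<circ> chart_inv c) holomorphic_on (snd c ` (U \<inter> fst c)))"

text \<open>The ring \<open>\<O>\<^sub>X(U)\<close>; its elements are \<^const>\<open>undefined\<close> outside \<^term>\<open>U\<close>, so that functions
  which agree on \<^term>\<open>U\<close> are equal.\<close>

definition structure_sheaf :: "('a::t2_space) chart set \<Rightarrow> 'a set \<Rightarrow> ('a \<Rightarrow> complex) ring" where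
  "structure_sheaf A U =
     \<lparr>carrier = {f \<in> extensional U. holomorphic_fun A U f},
      mult = (\<lambda>f g. \<lambda>y\<in>U. f y * g y), one = (\<lambda>y\<in>U. 1),
      zero = (\<lambda>y\<in>U. 0), add = (\<lambda>f g. \<lambda>y\<in>U. f y + g y)\<rparr>"

text \<open>A holomorphic 1-form is written \<open>\<omega> c dz\<close> in the chart \<open>c = (U, z)\<close>, with \<open>\<omega> c\<close> a function
  on \<^term>\<open>U\<close>.  The field components \<^const>\<open>mult\<close> and \<^const>\<open>one\<close> of the library's record type for
  modules have no meaning for a module and are left \<^const>\<open>undefined\<close>, here and below.\<close>

definition holomorphic_forms ::
    "('a::t2_space) chart set \<Rightarrow> (complex, 'a chart \<Rightarrow> 'a \<Rightarrow> complex) module" where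
  "holomorphic_forms A =
     \<lparr>carrier = {\<omega> \<in> extensional A.
        (\<forall>c\<in>A. \<omega> c \<in> extensional (fst c) \<and>
               (\<omega> c \<circ> chart_inv c) holomorphic_on (snd c ` fst c)) \<and>
        (\<forall>c\<in>A. \<forall>d\<in>A. \<forall>p\<in>fst c \<inter> fst d.
           \<omega> c p = \<omega> d p * deriv (snd d \<circ> chart_inv c) (snd c p))},
      mult = undefined, one = undefined,
      zero = (\<lambda>c\<in>A. \<lambda>p\<in>fst c. 0),
      add = (\<lambda>\<omega> \<eta>. \<lambda>c\<in>A. \<lambda>p\<in>fst c. \<omega> c p + \<eta> c p),
      smult = (\<lambda>a \<omega>. \<lambda>c\<in>A. \<lambda>p\<in>fst c. a * \<omega> c p)\<rparr>"

definition genus :: "('a::t2_space) chart set \<Rightarrow> nat" where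
  "genus A = vectorspace.dim class_ring (holomorphic_forms A)"


section \<open>Linear algebra over the complex numbers\<close>

definition complex_line :: "(complex, complex) module" where
  "complex_line = \<lparr>carrier = UNIV, mult = undefined, one = undefined, zero = 0, add = (+), smult = (*)\<rparr>"

definition quotient_space :: "(complex, 'v) module \<Rightarrow> 'v set \<Rightarrow> (complex, 'v set) module" where
  "quotient_space V W =
     \<lparr>carrier = a_rcosets\<^bsub>V\<^esub> W, mult = undefined, one = undefined, zero = W, add = set_add V,
      smult = (\<lambda>a C. \<Union>v\<in>C. W +>\<^bsub>V\<^esub> (a \<odot>\<^bsub>V\<^esub> v))\<rparr>"

definition form_radical ::
    "(complex, 'v) module \<Rightarrow> (complex, 'z) module \<Rightarrow> ('v \<Rightarrow> 'v \<Rightarrow> 'z) \<Rightarrow> 'v set" where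
  "form_radical V Z b = {v \<in> carrier V. \<forall>w\<in>carrier V. b v w = \<zero>\<^bsub>Z\<^esub>}"

definition nondegenerate ::
    "(complex, 'v) module \<Rightarrow> (complex, 'z) module \<Rightarrow> ('v \<Rightarrow> 'v \<Rightarrow> 'z) \<Rightarrow> bool" where
  "nondegenerate V Z b \<longleftrightarrow> form_radical V Z b = {\<zero>\<^bsub>V\<^esub>}"

definition isotropic :: "(complex, 'z) module \<Rightarrow> ('v \<Rightarrow> 'v \<Rightarrow> 'z) \<Rightarrow> 'v set \<Rightarrow> bool" where
  "isotropic Z b S \<longleftrightarrow> (\<forall>v\<in>S. \<forall>w\<in>S. b v w = \<zero>\<^bsub>Z\<^esub>)"

text \<open>The form on the quotient by the radical induced by \<^term>\<open>b\<close>: the common value of \<^term>\<open>b\<close> on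
  representatives.\<close>

definition quotient_form :: "('v \<Rightarrow> 'v \<Rightarrow> 'z) \<Rightarrow> 'v set \<Rightarrow> 'v set \<Rightarrow> 'z" where
  "quotient_form b C D = the_elem ((\<lambda>(v, w). b v w) ` (C \<times> D))"


section \<open>Sheaves of modules over the structure sheaf\<close>

text \<open>\<^term>\<open>restr F U V\<close> is the restriction map from \<^term>\<open>U\<close> to \<^term>\<open>V\<close>.  Only the values on open
  sets \<open>V \<subseteq> U\<close> matter.\<close>

record ('a, 's) module_sheaf =
  sections :: "'a set \<Rightarrow> ('a \<Rightarrow> complex, 's) module"
  restr :: "'a set \<Rightarrow> 'a set \<Rightarrow> 's \<Rightarrow> 's"

abbreviation sec :: "('a, 's) module_sheaf \<Rightarrow> 'a set \<Rightarrow> 's set" where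
  "sec F U \<equiv> carrier (sections F U)"

locale sheaf_of_modules =
  fixes A :: "('a::t2_space) chart set" and F :: "('a, 's) module_sheaf"
  assumes sections_module: "open U \<Longrightarrow> module (structure_sheaf A U) (sections F U)"
    and restr_closed: "\<lbrakk>open U; open V; V \<subseteq> U; s \<in> sec F U\<rbrakk> \<Longrightarrow> restr F U V s \<in> sec F V"
    and restr_add: "\<lbrakk>open U; open V; V \<subseteq> U; s \<in> sec F U; t \<in> sec F U\<rbrakk> \<Longrightarrow>
        restr F U V (s \<oplus>\<^bsub>sections F U\<^esub> t) = restr F U V s \<oplus>\<^bsub>sections F V\<^esub> restr F U V t"
    and restr_smult: "\<lbrakk>open U; open V; V \<subseteq> U; f \<in> carrier (structure_sheaf A U); s \<in> sec F U\<rbrakk> \<Longrightarrow>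
        restr F U V (f \<odot>\<^bsub>sections F U\<^esub> s) = restrict f V \<odot>\<^bsub>sections F V\<^esub> restr F U V s"
    and restr_id: "\<lbrakk>open U; s \<in> sec F U\<rbrakk> \<Longrightarrow> restr F U U s = s"
    and restr_restr: "\<lbrakk>open U; open V; open W; W \<subseteq> V; V \<subseteq> U; s \<in> sec F U\<rbrakk> \<Longrightarrow>
        restr F V W (restr F U V s) = restr F U W s"
    and locality: "\<lbrakk>\<And>U. U \<in> \<C> \<Longrightarrow> open U; s \<in> sec F (\<Union>\<C>); t \<in> sec F (\<Union>\<C>);
        \<And>U. U \<in> \<C> \<Longrightarrow> restr F (\<Union>\<C>) U s = restr F (\<Union>\<C>) U t\<rbrakk> \<Longrightarrow> s = t"
    and gluing: "\<lbrakk>\<And>U. U \<in> \<C> \<Longrightarrow> open U; \<And>U. U \<in> \<C> \<Longrightarrow> \<sigma> U \<in> sec F U;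
        \<And>U V. \<lbrakk>U \<in> \<C>; V \<in> \<C>\<rbrakk> \<Longrightarrow> restr F U (U \<inter> V) (\<sigma> U) = restr F V (U \<inter> V) (\<sigma> V)\<rbrakk> \<Longrightarrow>
        \<exists>s\<in>sec F (\<Union>\<C>). \<forall>U\<in>\<C>. restr F (\<Union>\<C>) U s = \<sigma> U"

definition local_frame ::
    "('a::t2_space) chart set \<Rightarrow> ('a, 's) module_sheaf \<Rightarrow> nat \<Rightarrow> 'a set \<Rightarrow> (nat \<Rightarrow> 's) \<Rightarrow> bool" where
  "local_frame A F r U b \<longleftrightarrow> (\<forall>i<r. b i \<in> sec F U) \<and>
     (\<forall>V s. open V \<and> V \<subseteq> U \<and> s \<in> sec F V \<longrightarrow>
        (\<exists>!a. a \<in> {..<r} \<rightarrow>\<^sub>E carrier (structure_sheaf A V) \<and>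
              s = (\<Oplus>\<^bsub>sections F V\<^esub>i\<in>{..<r}. a i \<odot>\<^bsub>sections F V\<^esub> restr F U V (b i))))"

text \<open>A holomorphic vector bundle is represented by its sheaf of holomorphic sections, a locally free
  sheaf of finite rank; a line bundle is a bundle of rank 1.\<close>

definition vector_bundle ::
    "('a::t2_space) chart set \<Rightarrow> nat \<Rightarrow> ('a, 's) module_sheaf \<Rightarrow> bool" where
  "vector_bundle A r F \<longleftrightarrow> sheaf_of_modules A F \<and>
     (\<forall>y. \<exists>U b. open U \<and> y \<in> U \<and> local_frame A F r U b)"

definition sheaf_hom ::
    "('a::t2_space) chart set \<Rightarrow> ('a, 's) module_sheaf \<Rightarrow> ('a, 't) module_sheaf \<Rightarrow>
     ('a set \<Rightarrow> 's \<Rightarrow> 't) \<Rightarrow> bool" where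
  "sheaf_hom A F G h \<longleftrightarrow>
     (\<forall>U. open U \<longrightarrow> h U \<in> module_hom (structure_sheaf A U) (sections F U) (sections G U)) \<and>
     (\<forall>U V. open U \<and> open V \<and> V \<subseteq> U \<longrightarrow>
        (\<forall>s\<in>sec F U. h V (restr F U V s) = restr G U V (h U s)))"

text \<open>Exactness of \<open>0 \<rightarrow> E \<rightarrow> F \<rightarrow> G \<rightarrow> 0\<close> as a sequence of sheaves: images are taken locally.\<close>

definition short_exact ::
    "('a::t2_space) chart set \<Rightarrow> ('a, 's) module_sheaf \<Rightarrow> ('a, 't) module_sheaf \<Rightarrow>
     ('a, 'u) module_sheaf \<Rightarrow> ('a set \<Rightarrow> 's \<Rightarrow> 't) \<Rightarrow> ('a set \<Rightarrow> 't \<Rightarrow> 'u) \<Rightarrow> bool" where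
  "short_exact A E F G \<alpha> \<beta> \<longleftrightarrow> sheaf_hom A E F \<alpha> \<and> sheaf_hom A F G \<beta> \<and>
     (\<forall>U. open U \<longrightarrow> inj_on (\<alpha> U) (sec E U)) \<and>
     (\<forall>U. open U \<longrightarrow> (\<forall>s\<in>sec F U. \<beta> U s = \<zero>\<^bsub>sections G U\<^esub> \<longleftrightarrow>
        (\<forall>y\<in>U. \<exists>W. open W \<and> y \<in> W \<and> W \<subseteq> U \<and> restr F U W s \<in> \<alpha> W ` sec E W))) \<and>
     (\<forall>U. open U \<longrightarrow> (\<forall>t\<in>sec G U.
        \<forall>y\<in>U. \<exists>W. open W \<and> y \<in> W \<and> W \<subseteq> U \<and> restr G U W t \<in> \<beta> W ` sec F W))"

definition skyscraper :: "'a \<Rightarrow> (complex, 'v) module \<Rightarrow> ('a, 'v) module_sheaf" where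
  "skyscraper x V =
     \<lparr>sections = (\<lambda>U. \<lparr>carrier = (if x \<in> U then carrier V else {\<zero>\<^bsub>V\<^esub>}),
        mult = undefined, one = undefined, zero = \<zero>\<^bsub>V\<^esub>, add = add V,
        smult = (\<lambda>f v. if x \<in> U then f x \<odot>\<^bsub>V\<^esub> v else \<zero>\<^bsub>V\<^esub>)\<rparr>),
      restr = (\<lambda>U W v. if x \<in> W then v else \<zero>\<^bsub>V\<^esub>)\<rparr>"

definition opens_in :: "('a::topological_space) set \<Rightarrow> 'a set set" where
  "opens_in U = {V. open V \<and> V \<subseteq> U}"

text \<open>The sheaf of homomorphisms from \<open>F\<close> to \<open>M\<close>, which for a vector bundle \<open>F\<close> is \<open>F\<^sup>\<or> \<otimes> M\<close>: a
  section over \<open>U\<close> is a homomorphism \<open>F|U \<rightarrow> M|U\<close>, that is, a family of maps indexed by the open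
  subsets of \<open>U\<close>.\<close>

definition hom_sheaf ::
    "('a::t2_space) chart set \<Rightarrow> ('a, 's) module_sheaf \<Rightarrow> ('a, 'm) module_sheaf \<Rightarrow>
     ('a, 'a set \<Rightarrow> 's \<Rightarrow> 'm) module_sheaf" where
  "hom_sheaf A F M =
     \<lparr>sections = (\<lambda>U.
        \<lparr>carrier = {h \<in> (\<Pi>\<^sub>E V\<in>opens_in U.
              module_hom (structure_sheaf A V) (sections F V) (sections M V) \<inter> extensional (sec F V)).
            \<forall>V\<in>opens_in U. \<forall>W\<in>opens_in V. \<forall>s\<in>sec F V.
              h W (restr F V W s) = restr M V W (h V s)},
         mult = undefined, one = undefined,
         zero = (\<lambda>V\<in>opens_in U. \<lambda>s\<in>sec F V. \<zero>\<^bsub>sections M V\<^esub>),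
         add = (\<lambda>h k. \<lambda>V\<in>opens_in U. \<lambda>s\<in>sec F V. h V s \<oplus>\<^bsub>sections M V\<^esub> k V s),
         smult = (\<lambda>f h. \<lambda>V\<in>opens_in U. \<lambda>s\<in>sec F V. restrict f V \<odot>\<^bsub>sections M V\<^esub> h V s)\<rparr>),
      restr = (\<lambda>U V h. restrict h (opens_in V))\<rparr>"


section \<open>Fibres and twists\<close>

text \<open>\<open>\<O>\<^sub>X(-x)\<close> as an ideal sheaf.\<close>

definition vanishing_ideal :: "('a::t2_space) chart set \<Rightarrow> 'a \<Rightarrow> 'a set \<Rightarrow> ('a \<Rightarrow> complex) set" where
  "vanishing_ideal A x U = {f \<in> carrier (structure_sheaf A U). x \<in> U \<longrightarrow> f x = 0}"

definition ideal_multiples ::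
    "('a::t2_space) chart set \<Rightarrow> 'a \<Rightarrow> ('a, 's) module_sheaf \<Rightarrow> 'a set \<Rightarrow> 's set" where
  "ideal_multiples A x F U = module.span (structure_sheaf A U) (sections F U)
     {f \<odot>\<^bsub>sections F U\<^esub> s | f s. f \<in> vanishing_ideal A x U \<and> s \<in> sec F U}"

text \<open>\<open>M(-x) = M \<otimes> \<O>\<^sub>X(-x)\<close>, as the subsheaf of \<open>M\<close> that is the image of \<open>M \<otimes> \<O>\<^sub>X(-x)\<close>: its sections are
  locally finite sums of products.\<close>

definition twist ::
    "('a::t2_space) chart set \<Rightarrow> ('a, 's) module_sheaf \<Rightarrow> 'a \<Rightarrow> ('a, 's) module_sheaf" where
  "twist A M x =
     \<lparr>sections = (\<lambda>U. (sections M U)\<lparr>carrier := {s \<in> sec M U. \<forall>y\<in>U. \<exists>W. open W \<and> y \<in> W \<and> W \<subseteq> U \<and>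
         restr M U W s \<in> ideal_multiples A x M W}\<rparr>),
      restr = restr M\<rparr>"

text \<open>The fibre at \<open>y\<close> is the stalk modulo the maximal ideal of \<open>\<O>\<^sub>X\<^sub>,\<^sub>y\<close>.  Its elements are classes
  of pairs \<open>(U, s)\<close>, with \<open>s\<close> a section over a neighbourhood \<open>U\<close> of \<open>y\<close>.\<close>

definition local_sections :: "('a::t2_space, 's) module_sheaf \<Rightarrow> 'a \<Rightarrow> ('a set \<times> 's) set" where
  "local_sections F y = {(U, s). open U \<and> y \<in> U \<and> s \<in> sec F U}"

definition fibre_rel ::
    "('a::t2_space) chart set \<Rightarrow> ('a, 's) module_sheaf \<Rightarrow> 'a \<Rightarrow> ('a set \<times> 's) rel" where
  "fibre_rel A F y = {((U, s), (V, t)). (U, s) \<in> local_sections F y \<and> (V, t) \<in> local_sections F y \<and>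
     (\<exists>W. open W \<and> y \<in> W \<and> W \<subseteq> U \<inter> V \<and>
        restr F U W s \<ominus>\<^bsub>sections F W\<^esub> restr F V W t \<in> ideal_multiples A y F W)}"

definition section_value ::
    "('a::t2_space) chart set \<Rightarrow> ('a, 's) module_sheaf \<Rightarrow> 'a \<Rightarrow> 'a set \<Rightarrow> 's \<Rightarrow> ('a set \<times> 's) set" where
  "section_value A F y U s = fibre_rel A F y `` {(U, s)}"

text \<open>The operations are computed on representatives; the result does not depend on their choice, so
  the unions are unions of constant families.\<close>

definition fibre ::
    "('a::t2_space) chart set \<Rightarrow> ('a, 's) module_sheaf \<Rightarrow> 'a \<Rightarrow> (complex, ('a set \<times> 's) set) module" where
  "fibre A F y =
     \<lparr>carrier = local_sections F y // fibre_rel A F y, mult = undefined, one = undefined,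
      zero = section_value A F y UNIV \<zero>\<^bsub>sections F UNIV\<^esub>,
      add = (\<lambda>P Q. \<Union>(U, s)\<in>P. \<Union>(V, t)\<in>Q. section_value A F y (U \<inter> V)
               (restr F U (U \<inter> V) s \<oplus>\<^bsub>sections F (U \<inter> V)\<^esub> restr F V (U \<inter> V) t)),
      smult = (\<lambda>a P. \<Union>(U, s)\<in>P. section_value A F y U ((\<lambda>z\<in>U. a) \<odot>\<^bsub>sections F U\<^esub> s))\<rparr>"


section \<open>Bilinear forms\<close>

text \<open>A homomorphism \<open>F \<otimes> F \<rightarrow> M\<close>, given as an \<open>\<O>\<^sub>X\<close>-bilinear map.\<close>

definition bilinear_form ::
    "('a::t2_space) chart set \<Rightarrow> ('a, 's) module_sheaf \<Rightarrow> ('a, 'm) module_sheaf \<Rightarrow>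
     ('a set \<Rightarrow> 's \<Rightarrow> 's \<Rightarrow> 'm) \<Rightarrow> bool" where
  "bilinear_form A F M \<psi> \<longleftrightarrow>
     (\<forall>U. open U \<longrightarrow> (\<forall>t\<in>sec F U.
        (\<lambda>s. \<psi> U s t) \<in> module_hom (structure_sheaf A U) (sections F U) (sections M U) \<and>
        (\<lambda>s. \<psi> U t s) \<in> module_hom (structure_sheaf A U) (sections F U) (sections M U))) \<and>
     (\<forall>U V. open U \<and> open V \<and> V \<subseteq> U \<longrightarrow> (\<forall>s\<in>sec F U. \<forall>t\<in>sec F U.
        \<psi> V (restr F U V s) (restr F U V t) = restr M U V (\<psi> U s t)))"

definition symmetric_form ::
    "('a::t2_space, 's) module_sheaf \<Rightarrow> ('a set \<Rightarrow> 's \<Rightarrow> 's \<Rightarrow> 'm) \<Rightarrow> bool" where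
  "symmetric_form F \<psi> \<longleftrightarrow> (\<forall>U. open U \<longrightarrow> (\<forall>s\<in>sec F U. \<forall>t\<in>sec F U. \<psi> U s t = \<psi> U t s))"

text \<open>The map \<open>F \<rightarrow> F\<^sup>\<or> \<otimes> M\<close>, \<open>s \<mapsto> \<psi>(s, -)\<close>.\<close>

definition adjoint_map ::
    "('a::t2_space, 's) module_sheaf \<Rightarrow> ('a set \<Rightarrow> 's \<Rightarrow> 's \<Rightarrow> 'm) \<Rightarrow>
     'a set \<Rightarrow> 's \<Rightarrow> 'a set \<Rightarrow> 's \<Rightarrow> 'm" where
  "adjoint_map F \<psi> U s = (\<lambda>V\<in>opens_in U. \<lambda>t\<in>sec F V. \<psi> V (restr F U V s) t)"

definition fibre_form ::
    "('a::t2_space) chart set \<Rightarrow> ('a, 's) module_sheaf \<Rightarrow> ('a, 'm) module_sheaf \<Rightarrow>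
     ('a set \<Rightarrow> 's \<Rightarrow> 's \<Rightarrow> 'm) \<Rightarrow> 'a \<Rightarrow> ('a set \<times> 's) set \<Rightarrow> ('a set \<times> 's) set \<Rightarrow> ('a set \<times> 'm) set" where
  "fibre_form A F M \<psi> y P Q = (\<Union>(U, s)\<in>P. \<Union>(V, t)\<in>Q. section_value A M y (U \<inter> V)
     (\<psi> (U \<inter> V) (restr F U (U \<inter> V) s) (restr F V (U \<inter> V) t)))"

definition orthogonal_structure ::
    "('a::t2_space) chart set \<Rightarrow> nat \<Rightarrow> ('a, 's) module_sheaf \<Rightarrow> ('a, 'm) module_sheaf \<Rightarrow>
     ('a set \<Rightarrow> 's \<Rightarrow> 's \<Rightarrow> 'm) \<Rightarrow> bool" where
  "orthogonal_structure A r E L \<phi> \<longleftrightarrow> vector_bundle A r E \<and> vector_bundle A 1 L \<and>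
     bilinear_form A E L \<phi> \<and> symmetric_form E \<phi> \<and>
     (\<forall>y. nondegenerate (fibre A E y) (fibre A L y) (fibre_form A E L \<phi> y))"

text \<open>The map \<open>F \<rightarrow> F\<^sub>x \<rightarrow> F\<^sub>x / l \<rightarrow> (F\<^sub>x / l) / S\<close> to the skyscraper sheaf at \<open>x\<close>.\<close>

definition fibre_projection ::
    "('a::t2_space) chart set \<Rightarrow> ('a, 's) module_sheaf \<Rightarrow> 'a \<Rightarrow> ('a set \<times> 's) set set \<Rightarrow>
     ('a set \<times> 's) set set set \<Rightarrow> 'a set \<Rightarrow> 's \<Rightarrow> ('a set \<times> 's) set set set" where
  "fibre_projection A F x l S U s =
     (if x \<in> U then S +>\<^bsub>quotient_space (fibre A F x) l\<^esub> (l +>\<^bsub>fibre A F x\<^esub> section_value A F x U s)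
      else \<zero>\<^bsub>quotient_space (quotient_space (fibre A F x) l) S\<^esub>)"

end

theory Submission
  imports Defs "HOL-Library.Function_Algebras"
begin

text \<open>Let \<open>\<zeta>\<close> be a local parameter at \<open>x\<close> and \<open>B\<close> the Gram matrix of \<open>\<psi>\<close> in a frame of \<open>F\<close> near \<open>x\<close>.
  With \<open>\<lambda>\<^sub>j\<close> the image of the \<open>j\<close>-th dual frame vector in \<open>\<complex>\<^sub>x\<close>, a section \<open>h\<close> of \<open>F\<^sup>\<or> \<otimes> M\<close> comes from \<open>F\<close> if and
  only if \<open>\<Sum>\<^sub>j \<lambda>\<^sub>j h\<^sub>j(x) = 0\<close>.  Together with the injectivity of \<open>F \<rightarrow> F\<^sup>\<or> \<otimes> M\<close> this implies that \<open>\<lambda>\<close> spans the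
  kernel of \<open>B(x)\<close> and that \<open>\<lambda>\<^sup>T B \<lambda>\<close> vanishes at \<open>x\<close> to first order exactly.  Choose a frame
  \<open>b\<^sub>0, \<dots>, b\<^bsub>2n\<^esub>\<close> such that \<open>b\<^sub>0(x)\<close> spans \<open>l\<^sub>x\<close> and \<open>b\<^sub>0(x), \<dots>, b\<^sub>n(x)\<close> span the preimage of \<open>S\<^sub>x\<close>.  Then
  \<open>b\<^sub>0, \<dots>, b\<^sub>n, \<zeta> b\<^bsub>n+1\<^esub>, \<dots>, \<zeta> b\<^bsub>2n\<^esub>\<close> is a frame of \<open>E\<close>.  As \<open>S\<^sub>x\<close> is isotropic, its Gram matrix is
  divisible by \<open>\<zeta>\<close>, and the quotient is nondegenerate at \<open>x\<close>: it has the entry \<open>b\<^sub>0\<^sup>T B b\<^sub>0 / \<zeta>\<close>, which is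
  nonzero at \<open>x\<close>, an invertible \<open>n \<times> n\<close> block coming from the pairing of \<open>S\<^sub>x\<close> with its quotient, and a zero
  block.  Away from \<open>x\<close> nothing changes.\<close>

section \<open>Holomorphic functions and local parameters\<close>

text \<open>The behaviour of the form at x is read off the exact sequence itself. If c^T B vanishes
  at x for a constant vector c, then c^T B = \<zeta> a with a holomorphic. The number \<Sum> a_j(x)
  \<lambda>_j is the only obstruction to writing a = g^T B near x; if it is 0, injectivity forces c
  = \<zeta> g and hence c = 0. Symmetry puts \<lambda> into the kernel of B(x). Its obstruction is
  the leading coefficient of \<lambda>^T B \<lambda>, nonzero because \<lambda> is, and subtracting
  a multiple of \<lambda> removes the obstruction of any other c.

  The formal obstacle is that \<open>hom_sheaf\<close>, \<open>E\<close> and \<open>twist\<close>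
  come without frames, and that fibres consist of classes of germs over arbitrary neighbourhoods.
  All these sheaves are therefore treated through abstract coordinate functions
  (\<open>local_coords\<close>), and fibres through coordinate vectors at a point. The Gram matrix
  of the induced form is never computed as a quotient: only its product with \<zeta> is known, and
  its values at x come from cancelling \<zeta> in identities between holomorphic functions before
  evaluating.\<close>

lemma open_chart_image:
  assumes "complex_chart c" "open V"
  shows "open (snd c ` (V \<inter> fst c))"
proof -
  obtain g where g: "homeomorphism (fst c) (snd c ` fst c) (snd c) g" and o: "open (fst c)" "open (snd c ` fst c)"
    using assms by (auto simp: complex_chart_def)
  have "openin (top_of_set (snd c ` fst c)) (snd c ` (V \<inter> fst c))"
    using homeomorphism_imp_open_map[OF g openin_open_Int[OF assms(2)]] by (simp add: Int_commute)
  with o show ?thesis by (simp add: openin_open_eq)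
qed

lemma chart_inv_chart:
  assumes "complex_chart c" "p \<in> fst c"
  shows "chart_inv c (snd c p) = p"
proof -
  have "inj_on (snd c) (fst c)"
    using assms by (auto simp: complex_chart_def homeomorphism_def intro: inj_on_inverseI)
  then show ?thesis
    unfolding chart_inv_def by (rule the_inv_into_f_f) fact
qed

lemma holomorphic_fun_cong:
  assumes "riemann_surface A" "\<And>p. p \<in> U \<Longrightarrow> f p = g p"
  shows "holomorphic_fun A U f = holomorphic_fun A U g"
proof -
  have "(f \<circ> chart_inv c) holomorphic_on (snd c ` (U \<inter> fst c)) \<longleftrightarrow>
        (g \<circ> chart_inv c) holomorphic_on (snd c ` (U \<inter> fst c))" if "c \<in> A" for c
    using that assms by (intro holomorphic_cong) (auto simp: riemann_surface_def chart_inv_chart)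
  then show ?thesis
    by (simp add: holomorphic_fun_def)
qed

lemma holomorphic_fun_const: "holomorphic_fun A U (\<lambda>p. k)"
  by (simp add: holomorphic_fun_def o_def)

lemma holomorphic_fun_add:
  "holomorphic_fun A U f \<Longrightarrow> holomorphic_fun A U g \<Longrightarrow> holomorphic_fun A U (\<lambda>p. f p + g p)"
  by (auto simp: holomorphic_fun_def o_def intro: holomorphic_on_add)

lemma holomorphic_fun_diff:
  "holomorphic_fun A U f \<Longrightarrow> holomorphic_fun A U g \<Longrightarrow> holomorphic_fun A U (\<lambda>p. f p - g p)"
  by (auto simp: holomorphic_fun_def o_def intro: holomorphic_on_diff)

lemma holomorphic_fun_mult:
  "holomorphic_fun A U f \<Longrightarrow> holomorphic_fun A U g \<Longrightarrow> holomorphic_fun A U (\<lambda>p. f p * g p)"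
  by (auto simp: holomorphic_fun_def o_def intro: holomorphic_on_mult)

lemma holomorphic_fun_sum:
  "(\<And>i. i \<in> I \<Longrightarrow> holomorphic_fun A U (f i)) \<Longrightarrow> holomorphic_fun A U (\<lambda>p. \<Sum>i\<in>I. f i p)"
  unfolding holomorphic_fun_def o_def by (intro ballI holomorphic_on_sum) blast

lemma holomorphic_fun_subset:
  "holomorphic_fun A U f \<Longrightarrow> V \<subseteq> U \<Longrightarrow> holomorphic_fun A V f"
  unfolding holomorphic_fun_def by (meson holomorphic_on_subset image_mono Int_mono order_refl)

lemmas holomorphic_fun_intros =
  holomorphic_fun_const holomorphic_fun_add holomorphic_fun_diff holomorphic_fun_mult holomorphic_fun_sum

lemma structure_sheaf_iff:
  "f \<in> carrier (structure_sheaf A U) \<longleftrightarrow> f \<in> extensional U \<and> holomorphic_fun A U f"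
  by (simp add: structure_sheaf_def)

lemma restrict_in_structure_sheaf:
  assumes "riemann_surface A" "holomorphic_fun A V f" "U \<subseteq> V"
  shows "restrict f U \<in> carrier (structure_sheaf A U)"
proof -
  have "holomorphic_fun A U (restrict f U) = holomorphic_fun A U f"
    by (rule holomorphic_fun_cong[OF assms(1)]) simp
  then show ?thesis
    using assms holomorphic_fun_subset[of A V f U] by (auto simp: structure_sheaf_iff)
qed

text \<open>Holomorphy is tested in every chart of the atlas. Composing with the holomorphic
  transition maps reduces the test to the one chart \<open>c\<close> whose domain contains
  \<open>V\<close>.\<close>

lemma holomorphic_fun_chart:
  assumes A: "riemann_surface A" and c: "c \<in> A" and V: "V \<subseteq> fst c" and G: "G holomorphic_on snd c ` V"
  shows "holomorphic_fun A V (G \<circ> snd c)"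
  unfolding holomorphic_fun_def
proof
  fix d assume d: "d \<in> A"
  have "(snd c \<circ> chart_inv d) holomorphic_on (snd d ` (fst d \<inter> fst c))"
    using A c d by (auto simp: riemann_surface_def)
  then have 1: "(snd c \<circ> chart_inv d) holomorphic_on (snd d ` (V \<inter> fst d))"
    using V by (rule_tac holomorphic_on_subset) auto
  have "(snd c \<circ> chart_inv d) ` (snd d ` (V \<inter> fst d)) \<subseteq> snd c ` V"
    using A d by (auto simp: riemann_surface_def chart_inv_chart)
  with G have "G holomorphic_on ((snd c \<circ> chart_inv d) ` (snd d ` (V \<inter> fst d)))"
    by (rule holomorphic_on_subset)
  from holomorphic_on_compose[OF 1 this]
  show "(G \<circ> snd c \<circ> chart_inv d) holomorphic_on snd d ` (V \<inter> fst d)"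
    by (simp add: o_assoc)
qed

text \<open>When \<^term>\<open>x\<close> does not lie in \<^term>\<open>U\<close>, the constant 1 is allowed; this treats points
  away from \<^term>\<open>x\<close> on the same footing as \<^term>\<open>x\<close>.\<close>

definition local_parameter :: "('a::t2_space) chart set \<Rightarrow> 'a \<Rightarrow> 'a set \<Rightarrow> ('a \<Rightarrow> complex) \<Rightarrow> bool" where
  "local_parameter A x U \<zeta> \<longleftrightarrow> open U \<and> holomorphic_fun A U \<zeta> \<and> (\<forall>p\<in>U. \<zeta> p = 0 \<longleftrightarrow> p = x) \<and>
     (\<forall>V f. open V \<and> V \<subseteq> U \<and> holomorphic_fun A V f \<and> (x \<in> V \<longrightarrow> f x = 0) \<longrightarrow>
        (\<exists>g. holomorphic_fun A V g \<and> (\<forall>p\<in>V. f p = \<zeta> p * g p))) \<and>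
     (\<forall>V g. open V \<and> V \<subseteq> U \<and> holomorphic_fun A V g \<and> (\<forall>p\<in>V. \<zeta> p * g p = 0) \<longrightarrow> (\<forall>p\<in>V. g p = 0))"

lemma local_parameter_one: "open U \<Longrightarrow> x \<notin> U \<Longrightarrow> local_parameter A x U (\<lambda>p. 1)"
  by (auto simp: local_parameter_def holomorphic_fun_const)

lemma local_parameter_subset: "local_parameter A x U \<zeta> \<Longrightarrow> open V \<Longrightarrow> V \<subseteq> U \<Longrightarrow> local_parameter A x V \<zeta>"
  unfolding local_parameter_def
  apply (elim conjE, intro conjI)
      apply assumption
     apply (erule holomorphic_fun_subset, assumption)
    apply blast
   apply (meson order_trans)
  apply (meson order_trans)
  done

text \<open>The parameter is a chart coordinate minus its value at \<open>x\<close>. Divisibility is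
  the removable singularity of a difference quotient; cancellation is clear off \<open>x\<close> and
  extends to \<open>x\<close> by continuity.\<close>

lemma exists_local_parameter:
  assumes A: "riemann_surface A"
  shows "\<exists>U \<zeta>. x \<in> U \<and> local_parameter A x U \<zeta>"
proof -
  have "x \<in> (\<Union>c\<in>A. fst c)"
    using A by (simp add: riemann_surface_def)
  then obtain c where c: "c \<in> A" "x \<in> fst c"
    by blast
  have cc: "complex_chart c" and oc: "open (fst c)"
    using A c by (auto simp: riemann_surface_def complex_chart_def)
  have inj: "snd c p = snd c q \<longleftrightarrow> p = q" if "p \<in> fst c" "q \<in> fst c" for p q
    using chart_inv_chart[OF cc] that by metis
  define z0 where "z0 = snd c x"
  define \<zeta> where "\<zeta> = (\<lambda>z. z - z0) \<circ> snd c"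
  have div: "\<exists>g. holomorphic_fun A V g \<and> (\<forall>p\<in>V. f p = \<zeta> p * g p)"
    if V: "open V" "V \<subseteq> fst c" and f: "holomorphic_fun A V f" "x \<in> V \<longrightarrow> f x = 0" for V f
  proof -
    \<comment> \<open>The difference quotient of \<open>f\<close> in the chart. If \<open>x\<close>
      lies outside \<open>V\<close>, the value \<open>f x\<close> is arbitrary and must not be
      subtracted; inside \<open>V\<close> it is 0, and subtracting it gives the shape of the pole
      lemmas.\<close>
    define G where "G = (\<lambda>z. if z = z0 then deriv (f \<circ> chart_inv c) z0
                   else ((f \<circ> chart_inv c) z - (if x \<in> V then f x else 0)) / (z - z0))"
    have VV: "V \<inter> fst c = V" using V by auto
    have o: "open (snd c ` V)"
      using open_chart_image[OF cc V(1)] VV by simp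
    have h: "(f \<circ> chart_inv c) holomorphic_on (snd c ` V)"
      using f(1) c(1) VV unfolding holomorphic_fun_def by fastforce
    have G: "G holomorphic_on (snd c ` V)"
    proof (cases "x \<in> V")
      case True
      have "(f \<circ> chart_inv c) z0 = f x" by (simp add: z0_def chart_inv_chart cc c)
      then have "G = (\<lambda>z. if z = z0 then deriv (f \<circ> chart_inv c) z0
                   else ((f \<circ> chart_inv c) z - (f \<circ> chart_inv c) z0) / (z - z0))"
        using True by (auto simp: G_def)
      then show ?thesis using pole_theorem_open_0[OF h o] pole_lemma_open[OF h o] by simp
    next
      case False
      then have "z \<noteq> z0" if "z \<in> snd c ` V" for z
        using that V inj c by (auto simp: z0_def)
      then have "G holomorphic_on (snd c ` V) \<longleftrightarrow> (\<lambda>z. (f \<circ> chart_inv c) z / (z - z0)) holomorphic_on (snd c ` V)"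
        using False by (intro holomorphic_cong) (auto simp: G_def)
      moreover have "(\<lambda>z. (f \<circ> chart_inv c) z / (z - z0)) holomorphic_on (snd c ` V)"
        using \<open>\<And>z. z \<in> snd c ` V \<Longrightarrow> z \<noteq> z0\<close>
        by (intro holomorphic_on_divide[OF h] holomorphic_intros) auto
      ultimately show ?thesis by simp
    qed
    have "f p = \<zeta> p * (G \<circ> snd c) p" if "p \<in> V" for p
    proof (cases "p = x")
      case True then show ?thesis using f that by (simp add: \<zeta>_def z0_def)
    next
      case False
      then have "snd c p \<noteq> z0" using that V inj c by (auto simp: z0_def)
      moreover have "(f \<circ> chart_inv c) (snd c p) = f p" using that V by (auto simp: chart_inv_chart cc)
      ultimately show ?thesis using f(2) by (simp add: \<zeta>_def G_def)
    qed
    with holomorphic_fun_chart[OF A c(1) V(2) G] show ?thesis by blast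
  qed
  have canc: "g p = 0"
    if V: "open V" "V \<subseteq> fst c" and g: "holomorphic_fun A V g" "\<forall>p\<in>V. \<zeta> p * g p = 0" and p: "p \<in> V" for V g p
  proof (cases "p = x")
    case False
    then have "\<zeta> p \<noteq> 0" using p V inj c by (auto simp: \<zeta>_def z0_def)
    with g p show ?thesis by auto
  next
    case True
    have VV: "V \<inter> fst c = V" using V by auto
    have o: "open (snd c ` V)" and z: "z0 \<in> snd c ` V"
      using open_chart_image[OF cc V(1)] VV p True by (auto simp: z0_def)
    have h: "(g \<circ> chart_inv c) holomorphic_on (snd c ` V)"
      using g(1) c(1) VV unfolding holomorphic_fun_def by fastforce
    then have "isCont (g \<circ> chart_inv c) z0"
      using continuous_on_eq_continuous_at[OF o] holomorphic_on_imp_continuous_on z by blast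
    then have l1: "((g \<circ> chart_inv c) \<longlongrightarrow> (g \<circ> chart_inv c) z0) (at z0)"
      by (simp add: isCont_def)
    have "eventually (\<lambda>z. z \<in> snd c ` V \<and> z \<noteq> z0) (at z0)"
      using o z by (auto simp: eventually_at_topological)
    then have "eventually (\<lambda>z. (g \<circ> chart_inv c) z = 0) (at z0)"
    proof (rule eventually_mono)
      fix z assume "z \<in> snd c ` V \<and> z \<noteq> z0"
      then obtain p' where "p' \<in> V" "z = snd c p'" "z \<noteq> z0" by auto
      then show "(g \<circ> chart_inv c) z = 0"
        using g(2) V by (auto simp: \<zeta>_def chart_inv_chart cc subset_iff)
    qed
    then have "((g \<circ> chart_inv c) \<longlongrightarrow> 0) (at z0)"
      by (rule tendsto_eventually)
    with l1 have "(g \<circ> chart_inv c) z0 = 0"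
      using tendsto_unique[OF _ l1] by simp
    then show ?thesis by (simp add: True z0_def chart_inv_chart cc c)
  qed
  have "local_parameter A x (fst c) \<zeta>"
    unfolding local_parameter_def
  proof (intro conjI allI impI ballI)
    show "holomorphic_fun A (fst c) \<zeta>"
      unfolding \<zeta>_def by (intro holomorphic_fun_chart[OF A c(1)] holomorphic_intros) auto
    show "\<zeta> p = 0 \<longleftrightarrow> p = x" if "p \<in> fst c" for p
      using that c inj by (auto simp: \<zeta>_def z0_def)
  qed (use oc div canc in auto)
  with c show ?thesis by blast
qed

lemma local_parameterD:
  assumes "local_parameter A x U \<zeta>"
  shows local_parameter_open: "open U"
    and local_parameter_holomorphic: "holomorphic_fun A U \<zeta>"
    and local_parameter_zero_iff: "p \<in> U \<Longrightarrow> \<zeta> p = 0 \<longleftrightarrow> p = x"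
    and local_parameter_divide: "open V \<Longrightarrow> V \<subseteq> U \<Longrightarrow> holomorphic_fun A V f \<Longrightarrow> (x \<in> V \<Longrightarrow> f x = 0) \<Longrightarrow>
      \<exists>g. holomorphic_fun A V g \<and> (\<forall>p\<in>V. f p = \<zeta> p * g p)"
    and local_parameter_cancel: "open V \<Longrightarrow> V \<subseteq> U \<Longrightarrow> holomorphic_fun A V g \<Longrightarrow>
      (\<And>p. p \<in> V \<Longrightarrow> \<zeta> p * g p = 0) \<Longrightarrow> p \<in> V \<Longrightarrow> g p = 0"
proof -
  have *: "\<forall>V f. open V \<and> V \<subseteq> U \<and> holomorphic_fun A V f \<and> (x \<in> V \<longrightarrow> f x = 0) \<longrightarrow>
        (\<exists>g. holomorphic_fun A V g \<and> (\<forall>p\<in>V. f p = \<zeta> p * g p))"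
    "\<forall>V g. open V \<and> V \<subseteq> U \<and> holomorphic_fun A V g \<and> (\<forall>p\<in>V. \<zeta> p * g p = 0) \<longrightarrow> (\<forall>p\<in>V. g p = 0)"
    using assms unfolding local_parameter_def by - (elim conjE, assumption)+
  show "open V \<Longrightarrow> V \<subseteq> U \<Longrightarrow> holomorphic_fun A V f \<Longrightarrow> (x \<in> V \<Longrightarrow> f x = 0) \<Longrightarrow>
      \<exists>g. holomorphic_fun A V g \<and> (\<forall>p\<in>V. f p = \<zeta> p * g p)"
    by (rule *(1)[rule_format]) blast
  show "open V \<Longrightarrow> V \<subseteq> U \<Longrightarrow> holomorphic_fun A V g \<Longrightarrow>
      (\<And>p. p \<in> V \<Longrightarrow> \<zeta> p * g p = 0) \<Longrightarrow> p \<in> V \<Longrightarrow> g p = 0"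
    by (rule *(2)[rule_format, of V]) blast
  show "open U" "holomorphic_fun A U \<zeta>"
    using assms unfolding local_parameter_def by - (elim conjE, assumption)+
  have "\<forall>p\<in>U. \<zeta> p = 0 \<longleftrightarrow> p = x"
    using assms unfolding local_parameter_def by (elim conjE)
  then show "p \<in> U \<Longrightarrow> \<zeta> p = 0 \<longleftrightarrow> p = x"
    by (rule bspec)
qed

section \<open>Sheaves of modules and local coordinates\<close>

lemma sheaf_hom_module_hom:
  "sheaf_hom A F G h \<Longrightarrow> open U \<Longrightarrow> h U \<in> module_hom (structure_sheaf A U) (sections F U) (sections G U)"
  by (simp add: sheaf_hom_def)

lemma sheaf_hom_restr:
  "sheaf_hom A F G h \<Longrightarrow> open U \<Longrightarrow> open V \<Longrightarrow> V \<subseteq> U \<Longrightarrow> s \<in> sec F U \<Longrightarrow>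
    h V (restr F U V s) = restr G U V (h U s)"
  by (simp add: sheaf_hom_def)

lemma short_exactD:
  assumes "short_exact A E F G \<alpha> \<beta>"
  shows short_exact_hom: "sheaf_hom A E F \<alpha>" "sheaf_hom A F G \<beta>"
    and short_exact_inj: "open U \<Longrightarrow> inj_on (\<alpha> U) (sec E U)"
    and short_exact_kernel: "open U \<Longrightarrow> s \<in> sec F U \<Longrightarrow> \<beta> U s = \<zero>\<^bsub>sections G U\<^esub> \<longleftrightarrow>
        (\<forall>y\<in>U. \<exists>W. open W \<and> y \<in> W \<and> W \<subseteq> U \<and> restr F U W s \<in> \<alpha> W ` sec E W)"
    and short_exact_surj: "open U \<Longrightarrow> t \<in> sec G U \<Longrightarrow> y \<in> U \<Longrightarrow>
        \<exists>W. open W \<and> y \<in> W \<and> W \<subseteq> U \<and> restr G U W t \<in> \<beta> W ` sec F W"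
  using assms by (simp_all add: short_exact_def)

text \<open>A frame seen from its coordinate functions, for all open \<open>V\<close> inside
  \<open>U\<close> at once. This form is chosen because coordinates are easy to write down for
  \<open>hom_sheaf\<close>, for \<open>E\<close> and for the twist, and because it asks only for
  closure properties, not for the sheaf or module axioms. The value of a coordinate function outside
  \<open>V\<close> carries no meaning, so every identity is restricted to points of
  \<open>V\<close>.\<close>

locale local_coords =
  fixes A :: "('a::t2_space) chart set" and F :: "('a, 's) module_sheaf" and r :: nat
    and U :: "'a set" and \<kappa> :: "'a set \<Rightarrow> 's \<Rightarrow> nat \<Rightarrow> 'a \<Rightarrow> complex"
  assumes surface: "riemann_surface A" and open_domain: "open U"
    and add_closed: "\<lbrakk>open V; V \<subseteq> U; s \<in> sec F V; t \<in> sec F V\<rbrakk> \<Longrightarrow> s \<oplus>\<^bsub>sections F V\<^esub> t \<in> sec F V"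
    and smult_closed: "\<lbrakk>open V; V \<subseteq> U; f \<in> carrier (structure_sheaf A V); s \<in> sec F V\<rbrakk> \<Longrightarrow>
      f \<odot>\<^bsub>sections F V\<^esub> s \<in> sec F V"
    and restr_in: "\<lbrakk>open V; V \<subseteq> U; open W; W \<subseteq> V; s \<in> sec F V\<rbrakk> \<Longrightarrow> restr F V W s \<in> sec F W"
    and coord_holomorphic: "\<lbrakk>open V; V \<subseteq> U; s \<in> sec F V; i < r\<rbrakk> \<Longrightarrow> holomorphic_fun A V (\<kappa> V s i)"
    and coord_add: "\<lbrakk>open V; V \<subseteq> U; s \<in> sec F V; t \<in> sec F V; i < r; p \<in> V\<rbrakk> \<Longrightarrow>
      \<kappa> V (s \<oplus>\<^bsub>sections F V\<^esub> t) i p = \<kappa> V s i p + \<kappa> V t i p"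
    and coord_smult: "\<lbrakk>open V; V \<subseteq> U; f \<in> carrier (structure_sheaf A V); s \<in> sec F V; i < r; p \<in> V\<rbrakk> \<Longrightarrow>
      \<kappa> V (f \<odot>\<^bsub>sections F V\<^esub> s) i p = f p * \<kappa> V s i p"
    and coord_restr: "\<lbrakk>open V; V \<subseteq> U; open W; W \<subseteq> V; s \<in> sec F V; i < r; p \<in> W\<rbrakk> \<Longrightarrow>
      \<kappa> W (restr F V W s) i p = \<kappa> V s i p"
    and coord_inj: "\<lbrakk>open V; V \<subseteq> U; s \<in> sec F V; t \<in> sec F V;
      \<And>i p. i < r \<Longrightarrow> p \<in> V \<Longrightarrow> \<kappa> V s i p = \<kappa> V t i p\<rbrakk> \<Longrightarrow> s = t"
    and coord_surj: "\<lbrakk>open V; V \<subseteq> U; \<And>i. i < r \<Longrightarrow> holomorphic_fun A V (a i)\<rbrakk> \<Longrightarrow>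
      \<exists>s\<in>sec F V. \<forall>i<r. \<forall>p\<in>V. \<kappa> V s i p = a i p"
begin

definition of_coords :: "'a set \<Rightarrow> (nat \<Rightarrow> 'a \<Rightarrow> complex) \<Rightarrow> 's" where
  "of_coords V a = (SOME s. s \<in> sec F V \<and> (\<forall>i<r. \<forall>p\<in>V. \<kappa> V s i p = a i p))"

definition unit_section :: "'a set \<Rightarrow> nat \<Rightarrow> 's" where
  "unit_section V i = of_coords V (\<lambda>j p. if j = i then 1 else 0)"

lemma of_coords:
  assumes "open V" "V \<subseteq> U" "\<And>i. i < r \<Longrightarrow> holomorphic_fun A V (a i)"
  shows of_coords_in: "of_coords V a \<in> sec F V"
    and coord_of_coords: "i < r \<Longrightarrow> p \<in> V \<Longrightarrow> \<kappa> V (of_coords V a) i p = a i p"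
proof -
  have "\<exists>s. s \<in> sec F V \<and> (\<forall>i<r. \<forall>p\<in>V. \<kappa> V s i p = a i p)"
    using coord_surj[OF assms(1,2), of a] assms(3) by blast
  from someI_ex[OF this] show "of_coords V a \<in> sec F V"
    and "i < r \<Longrightarrow> p \<in> V \<Longrightarrow> \<kappa> V (of_coords V a) i p = a i p"
    unfolding of_coords_def by blast+
qed

lemma unit_section:
  assumes "open V" "V \<subseteq> U"
  shows unit_section_in: "unit_section V i \<in> sec F V"
    and coord_unit_section: "j < r \<Longrightarrow> p \<in> V \<Longrightarrow> \<kappa> V (unit_section V i) j p = (if j = i then 1 else 0)"
  unfolding unit_section_def
  by (intro of_coords_in assms, simp add: holomorphic_fun_const)
     (subst coord_of_coords, auto simp: assms holomorphic_fun_const)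

lemma restr_unit_section:
  assumes "open V" "V \<subseteq> U" "open W" "W \<subseteq> V"
  shows "restr F V W (unit_section V i) = unit_section W i"
proof (rule coord_inj)
  show "W \<subseteq> U" using assms by blast
  then show "restr F V W (unit_section V i) \<in> sec F W" "unit_section W i \<in> sec F W"
    using assms by (auto intro!: restr_in unit_section)
  show "\<kappa> W (restr F V W (unit_section V i)) j p = \<kappa> W (unit_section W i) j p" if "j < r" "p \<in> W" for j p
    using assms that \<open>W \<subseteq> U\<close> by (simp add: coord_restr unit_section subset_iff)
qed fact

text \<open>Replaces the expansion of \<open>s\<close> as a sum of coordinates times unit sections.
  The locale provides no zero section and no finite sums, hence the form of an induction rule whose
  base case speaks of any section with vanishing coordinates.\<close>

lemma coord_induct:
  assumes V: "open V" "V \<subseteq> U" and s: "s \<in> sec F V"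
    and zero: "\<And>t. t \<in> sec F V \<Longrightarrow> (\<And>i p. i < r \<Longrightarrow> p \<in> V \<Longrightarrow> \<kappa> V t i p = 0) \<Longrightarrow> P t"
    and add: "\<And>t u. t \<in> sec F V \<Longrightarrow> u \<in> sec F V \<Longrightarrow> P t \<Longrightarrow> P u \<Longrightarrow> P (t \<oplus>\<^bsub>sections F V\<^esub> u)"
    and gen: "\<And>i. i < r \<Longrightarrow> P (restrict (\<kappa> V s i) V \<odot>\<^bsub>sections F V\<^esub> unit_section V i)"
  shows "P s"
proof -
  \<comment> \<open>Here \<open>t\<close> is the truncation of \<open>s\<close> to its first
    \<open>k\<close> coordinates; the truncation at \<open>Suc k\<close> adds the single term with
    index \<open>k\<close>.\<close>
  have *: "P t" if "k \<le> r" "t \<in> sec F V"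
    "\<And>i p. i < r \<Longrightarrow> p \<in> V \<Longrightarrow> \<kappa> V t i p = (if i < k then \<kappa> V s i p else 0)" for k t
    using that
  proof (induction k arbitrary: t)
    case 0
    then show ?case by (intro zero) auto
  next
    case (Suc k)
    define a where "a i = (if i < k then \<kappa> V s i else (\<lambda>p. 0))" for i
    have a: "holomorphic_fun A V (a i)" if "i < r" for i
      using that V s by (auto simp: a_def holomorphic_fun_const intro: coord_holomorphic)
    note oc = of_coords[OF V(1,2), of a, OF a]
    define f where "f = restrict (\<kappa> V s k) V"
    have f: "f \<in> carrier (structure_sheaf A V)"
      unfolding f_def using V Suc.prems s
      by (intro restrict_in_structure_sheaf[OF surface coord_holomorphic]) auto
    have in1: "of_coords V a \<in> sec F V" and in2: "f \<odot>\<^bsub>sections F V\<^esub> unit_section V k \<in> sec F V"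
      using oc(1) f V by (auto intro!: smult_closed unit_section)
    have eq: "t = of_coords V a \<oplus>\<^bsub>sections F V\<^esub> (f \<odot>\<^bsub>sections F V\<^esub> unit_section V k)"
    proof (rule coord_inj[OF V(1,2)])
      fix i p assume ip: "i < r" "p \<in> V"
      show "\<kappa> V t i p = \<kappa> V (of_coords V a \<oplus>\<^bsub>sections F V\<^esub> (f \<odot>\<^bsub>sections F V\<^esub> unit_section V k)) i p"
        using ip V f in1 in2 Suc.prems
        by (auto simp: coord_add coord_smult oc unit_section f_def a_def less_Suc_eq)
    qed (use in1 in2 Suc.prems V in \<open>auto intro: add_closed\<close>)
    have "P (of_coords V a)"
      using Suc.prems by (intro Suc.IH in1) (auto simp: oc a_def)
    moreover have "P (f \<odot>\<^bsub>sections F V\<^esub> unit_section V k)"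
      using gen[of k] Suc.prems by (simp add: f_def)
    ultimately show ?case
      by (subst eq) (intro add in1 in2)
  qed
  show ?thesis
    by (rule *[of r]) (use s in auto)
qed

text \<open>A functional over which functions act through their value at \<open>p\<close> sees only
  the coordinates at \<open>p\<close>. It is applied to coordinates of values of homomorphisms and
  forms, and to the map onto the skyscraper sheaf.\<close>

lemma coord_expansion:
  fixes T :: "'s \<Rightarrow> complex"
  assumes V: "open V" "V \<subseteq> U" "p \<in> V" and s: "s \<in> sec F V"
    and add: "\<And>s t. s \<in> sec F V \<Longrightarrow> t \<in> sec F V \<Longrightarrow> T (s \<oplus>\<^bsub>sections F V\<^esub> t) = T s + T t"
    and smult: "\<And>f s. f \<in> carrier (structure_sheaf A V) \<Longrightarrow> s \<in> sec F V \<Longrightarrow>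
      T (f \<odot>\<^bsub>sections F V\<^esub> s) = f p * T s"
  shows "T s = (\<Sum>i<r. \<kappa> V s i p * T (unit_section V i))"
proof (rule coord_induct[OF V(1,2) s])
  fix t assume t: "t \<in> sec F V" "\<And>i p. i < r \<Longrightarrow> p \<in> V \<Longrightarrow> \<kappa> V t i p = 0"
  \<comment> \<open>Without a zero section at hand, the vanishing of \<open>T t\<close> is read off
    from t + t = t.\<close>
  have "t \<oplus>\<^bsub>sections F V\<^esub> t = t"
    using t V by (intro coord_inj[of V]) (auto simp: coord_add intro: add_closed)
  then have "T t + T t = T t"
    using add[of t t] t by simp
  then show "T t = (\<Sum>i<r. \<kappa> V t i p * T (unit_section V i))"
    using t V by simp
next
  fix t u assume "t \<in> sec F V" "u \<in> sec F V"
    "T t = (\<Sum>i<r. \<kappa> V t i p * T (unit_section V i))" "T u = (\<Sum>i<r. \<kappa> V u i p * T (unit_section V i))"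
  then show "T (t \<oplus>\<^bsub>sections F V\<^esub> u) = (\<Sum>i<r. \<kappa> V (t \<oplus>\<^bsub>sections F V\<^esub> u) i p * T (unit_section V i))"
    using V by (simp add: add coord_add ring_distribs sum.distrib)
next
  fix i assume i: "i < r"
  have f: "restrict (\<kappa> V s i) V \<in> carrier (structure_sheaf A V)"
    using V s i by (intro restrict_in_structure_sheaf[OF surface coord_holomorphic]) auto
  have "(\<Sum>j<r. \<kappa> V (restrict (\<kappa> V s i) V \<odot>\<^bsub>sections F V\<^esub> unit_section V i) j p * T (unit_section V j)) =
    (\<Sum>j<r. if j = i then \<kappa> V s i p * T (unit_section V i) else 0)"
    using V f by (intro sum.cong) (auto simp: coord_smult unit_section)
  then show "T (restrict (\<kappa> V s i) V \<odot>\<^bsub>sections F V\<^esub> unit_section V i) =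
      (\<Sum>j<r. \<kappa> V (restrict (\<kappa> V s i) V \<odot>\<^bsub>sections F V\<^esub> unit_section V i) j p * T (unit_section V j))"
    using V f i by (simp add: smult unit_section)
qed

end

lemma local_coords_subset:
  assumes "local_coords A F r U \<kappa>" "open V" "V \<subseteq> U"
  shows "local_coords A F r V \<kappa>"
proof -
  interpret local_coords A F r U \<kappa> by fact
  show ?thesis
  proof (rule local_coords.intro)
    show "s = t" if "open W" "W \<subseteq> V" "s \<in> sec F W" "t \<in> sec F W"
      "\<And>i p. i < r \<Longrightarrow> p \<in> W \<Longrightarrow> \<kappa> W s i p = \<kappa> W t i p" for W s t
      by (rule coord_inj[of W]) (use that assms(3) in auto)
  qed (auto intro: surface assms(2) add_closed smult_closed restr_in coord_holomorphic coord_add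
          coord_smult coord_restr coord_surj dest: order_trans[OF _ assms(3)])
qed

section \<open>Zero, sums and locality in a sheaf of modules\<close>

context sheaf_of_modules
begin

lemma zero_in: "open V \<Longrightarrow> \<zero>\<^bsub>sections F V\<^esub> \<in> sec F V"
  using sections_module[of V] by (simp add: module_def abelian_group_def abelian_monoid.zero_closed)

lemma add_in: "open V \<Longrightarrow> s \<in> sec F V \<Longrightarrow> t \<in> sec F V \<Longrightarrow> s \<oplus>\<^bsub>sections F V\<^esub> t \<in> sec F V"
  using sections_module[of V] by (simp add: module_def abelian_group_def abelian_monoid.a_closed)

lemma smult_in: "open V \<Longrightarrow> f \<in> carrier (structure_sheaf A V) \<Longrightarrow> s \<in> sec F V \<Longrightarrow> f \<odot>\<^bsub>sections F V\<^esub> s \<in> sec F V"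
  using sections_module[of V] by (simp add: module.smult_closed)

lemma restr_zero:
  assumes "open U" "open V" "V \<subseteq> U"
  shows "restr F U V \<zero>\<^bsub>sections F U\<^esub> = \<zero>\<^bsub>sections F V\<^esub>"
proof -
  interpret mU: module "structure_sheaf A U" "sections F U" by (rule sections_module) fact
  interpret mV: module "structure_sheaf A V" "sections F V" by (rule sections_module) fact
  have "restr F U V \<zero>\<^bsub>sections F U\<^esub> \<oplus>\<^bsub>sections F V\<^esub> restr F U V \<zero>\<^bsub>sections F U\<^esub> = restr F U V \<zero>\<^bsub>sections F U\<^esub>"
    using restr_add[OF assms, of "\<zero>\<^bsub>sections F U\<^esub>" "\<zero>\<^bsub>sections F U\<^esub>"] by simp
  then show ?thesis
    using restr_closed[OF assms, of "\<zero>\<^bsub>sections F U\<^esub>"] by simp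
qed

lemma restr_finsum:
  assumes "open U" "open V" "V \<subseteq> U" "finite I" "\<And>i. i \<in> I \<Longrightarrow> g i \<in> sec F U"
  shows "restr F U V (finsum (sections F U) g I) = finsum (sections F V) (\<lambda>i. restr F U V (g i)) I"
proof -
  interpret mU: module "structure_sheaf A U" "sections F U" by (rule sections_module) fact
  interpret mV: module "structure_sheaf A V" "sections F V" by (rule sections_module) fact
  show ?thesis
    using assms(4,5)
  proof (induction I rule: finite_induct)
    case empty
    show ?case by (simp add: restr_zero assms)
  next
    case (insert i I)
    have "g \<in> I \<rightarrow> sec F U" "(\<lambda>i. restr F U V (g i)) \<in> I \<rightarrow> sec F V" "g i \<in> sec F U" "restr F U V (g i) \<in> sec F V"
      using insert.prems restr_closed[OF assms(1-3)] by auto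
    with insert show ?case
      by (simp add: mU.finsum_insert mV.finsum_insert restr_add[OF assms(1-3)] mU.finsum_closed)
  qed
qed

lemma sections_eqI:
  assumes "open U" "s \<in> sec F U" "t \<in> sec F U"
    and loc: "\<And>y. y \<in> U \<Longrightarrow> \<exists>W. open W \<and> y \<in> W \<and> W \<subseteq> U \<and> restr F U W s = restr F U W t"
  shows "s = t"
proof -
  define \<C> where "\<C> = {W. open W \<and> W \<subseteq> U \<and> restr F U W s = restr F U W t}"
  have U: "U = \<Union>\<C>"
    using loc by (auto simp: \<C>_def)
  show ?thesis
  proof (rule locality[of \<C>])
    show "s \<in> sec F (\<Union>\<C>)" "t \<in> sec F (\<Union>\<C>)"
      using assms(2,3) U by simp_all
    show "restr F (\<Union>\<C>) W s = restr F (\<Union>\<C>) W t" if "W \<in> \<C>" for W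
      using that unfolding U[symmetric] by (simp add: \<C>_def)
  qed (auto simp: \<C>_def)
qed

end

text \<open>The coordinates are the unique coefficients in the frame. Each rule for them follows by
  checking that the expected family of coefficients gives the right section and then appealing to
  uniqueness.\<close>

lemma local_frame_coords:
  assumes A: "riemann_surface A" and sheaf: "sheaf_of_modules A F" and U: "open U"
    and b: "local_frame A F r U b"
  shows "\<exists>\<kappa>. local_coords A F r U \<kappa>"
proof -
  interpret sheaf_of_modules A F by fact
  have bU: "b i \<in> sec F U" if "i < r" for i
    using b that by (auto simp: local_frame_def)
  define P where "P V s a \<longleftrightarrow> a \<in> {..<r} \<rightarrow>\<^sub>E carrier (structure_sheaf A V) \<and>
      s = (\<Oplus>\<^bsub>sections F V\<^esub>i\<in>{..<r}. a i \<odot>\<^bsub>sections F V\<^esub> restr F U V (b i))" for V s a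
  have ex1: "\<exists>!a. P V s a" if "open V" "V \<subseteq> U" "s \<in> sec F V" for V s
    using b that unfolding P_def local_frame_def by blast
  define \<kappa> where "\<kappa> V s = (THE a. P V s a)" for V s
  have \<kappa>: "P V s (\<kappa> V s)" if "open V" "V \<subseteq> U" "s \<in> sec F V" for V s
    using theI'[OF ex1[OF that]] by (simp add: \<kappa>_def)
  have \<kappa>_eq: "\<kappa> V s = a" if "open V" "V \<subseteq> U" "s \<in> sec F V" "P V s a" for V s a
    using ex1[OF that(1-3)] \<kappa>[OF that(1-3)] that(4) by blast
  have \<kappa>_in: "\<kappa> V s i \<in> carrier (structure_sheaf A V)" if "open V" "V \<subseteq> U" "s \<in> sec F V" "i < r" for V s i
    using \<kappa>[OF that(1-3)] that(4) by (auto simp: P_def PiE_iff)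
  have rb: "restr F U V (b i) \<in> sec F V" if "open V" "V \<subseteq> U" "i < r" for V i
    using that bU U by (auto intro: restr_closed)
  have "local_coords A F r U \<kappa>"
  proof (rule local_coords.intro[OF A U])
    fix V s t i p
    assume V: "open V" "V \<subseteq> U" and s: "s \<in> sec F V" and t: "t \<in> sec F V" and i: "i < r" and p: "p \<in> V"
    interpret m: module "structure_sheaf A V" "sections F V" by (rule sections_module) fact
    note [simp] = \<kappa>_in[OF V] rb[OF V]
    have "P V (s \<oplus>\<^bsub>sections F V\<^esub> t) (\<lambda>i\<in>{..<r}. \<kappa> V s i \<oplus>\<^bsub>structure_sheaf A V\<^esub> \<kappa> V t i)"
      unfolding P_def
    proof (intro conjI)
      have "s \<oplus>\<^bsub>sections F V\<^esub> t =
         (\<Oplus>\<^bsub>sections F V\<^esub>i\<in>{..<r}. \<kappa> V s i \<odot>\<^bsub>sections F V\<^esub> restr F U V (b i)) \<oplus>\<^bsub>sections F V\<^esub>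
         (\<Oplus>\<^bsub>sections F V\<^esub>i\<in>{..<r}. \<kappa> V t i \<odot>\<^bsub>sections F V\<^esub> restr F U V (b i))"
        using \<kappa>[OF V s] \<kappa>[OF V t] by (auto simp: P_def)
      also have "\<dots> = (\<Oplus>\<^bsub>sections F V\<^esub>i\<in>{..<r}. (\<kappa> V s i \<odot>\<^bsub>sections F V\<^esub> restr F U V (b i)) \<oplus>\<^bsub>sections F V\<^esub>
           (\<kappa> V t i \<odot>\<^bsub>sections F V\<^esub> restr F U V (b i)))"
        using s t by (subst m.finsum_addf) auto
      also have "\<dots> = (\<Oplus>\<^bsub>sections F V\<^esub>i\<in>{..<r}. (\<lambda>i\<in>{..<r}. \<kappa> V s i \<oplus>\<^bsub>structure_sheaf A V\<^esub> \<kappa> V t i) i \<odot>\<^bsub>sections F V\<^esub> restr F U V (b i))"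
        using s t by (intro m.finsum_cong') (auto simp: m.smult_l_distr)
      finally show "s \<oplus>\<^bsub>sections F V\<^esub> t = \<dots>" .
    qed (use s t in auto)
    from \<kappa>_eq[OF V _ this] show "\<kappa> V (s \<oplus>\<^bsub>sections F V\<^esub> t) i p = \<kappa> V s i p + \<kappa> V t i p"
      using s t i p by (simp add: structure_sheaf_def)
  next
    fix V s f i p
    assume V: "open V" "V \<subseteq> U" and s: "s \<in> sec F V" and f: "f \<in> carrier (structure_sheaf A V)" and i: "i < r" and p: "p \<in> V"
    interpret m: module "structure_sheaf A V" "sections F V" by (rule sections_module) fact
    note [simp] = \<kappa>_in[OF V] rb[OF V]
    have "P V (f \<odot>\<^bsub>sections F V\<^esub> s) (\<lambda>i\<in>{..<r}. f \<otimes>\<^bsub>structure_sheaf A V\<^esub> \<kappa> V s i)"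
      unfolding P_def
    proof (intro conjI)
      have "f \<odot>\<^bsub>sections F V\<^esub> s = f \<odot>\<^bsub>sections F V\<^esub>
         (\<Oplus>\<^bsub>sections F V\<^esub>i\<in>{..<r}. \<kappa> V s i \<odot>\<^bsub>sections F V\<^esub> restr F U V (b i))"
        using \<kappa>[OF V s] by (auto simp: P_def)
      also have "\<dots> = (\<Oplus>\<^bsub>sections F V\<^esub>i\<in>{..<r}. f \<odot>\<^bsub>sections F V\<^esub> (\<kappa> V s i \<odot>\<^bsub>sections F V\<^esub> restr F U V (b i)))"
        using s f by (subst m.finsum_smult_ldistr) auto
      also have "\<dots> = (\<Oplus>\<^bsub>sections F V\<^esub>i\<in>{..<r}. (\<lambda>i\<in>{..<r}. f \<otimes>\<^bsub>structure_sheaf A V\<^esub> \<kappa> V s i) i \<odot>\<^bsub>sections F V\<^esub> restr F U V (b i))"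
        using s f by (intro m.finsum_cong') (auto simp: m.smult_assoc1)
      finally show "f \<odot>\<^bsub>sections F V\<^esub> s = \<dots>" .
    qed (use s f in auto)
    from \<kappa>_eq[OF V _ this] show "\<kappa> V (f \<odot>\<^bsub>sections F V\<^esub> s) i p = f p * \<kappa> V s i p"
      using s f i p by (simp add: structure_sheaf_def)
  next
    fix V W s i p
    assume V: "open V" "V \<subseteq> U" and W: "open W" "W \<subseteq> V" and s: "s \<in> sec F V" and i: "i < r" and p: "p \<in> W"
    interpret mV: module "structure_sheaf A V" "sections F V" by (rule sections_module) fact
    interpret mW: module "structure_sheaf A W" "sections F W" by (rule sections_module) fact
    note [simp] = \<kappa>_in[OF V] rb[OF V]
    have WU: "W \<subseteq> U" using V W by blast
    have rs: "restrict (\<kappa> V s i) W \<in> carrier (structure_sheaf A W)" if "i < r" for i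
      using \<kappa>_in[OF V s that] W by (intro restrict_in_structure_sheaf[OF A]) (auto simp: structure_sheaf_iff)
    have "P W (restr F V W s) (\<lambda>i\<in>{..<r}. restrict (\<kappa> V s i) W)"
      unfolding P_def
    proof (intro conjI)
      have "restr F V W s = restr F V W (\<Oplus>\<^bsub>sections F V\<^esub>i\<in>{..<r}. \<kappa> V s i \<odot>\<^bsub>sections F V\<^esub> restr F U V (b i))"
        using \<kappa>[OF V s] by (auto simp: P_def)
      also have "\<dots> = (\<Oplus>\<^bsub>sections F W\<^esub>i\<in>{..<r}. restr F V W (\<kappa> V s i \<odot>\<^bsub>sections F V\<^esub> restr F U V (b i)))"
        using s by (intro restr_finsum V W) auto
      also have "\<dots> = (\<Oplus>\<^bsub>sections F W\<^esub>i\<in>{..<r}. (\<lambda>i\<in>{..<r}. restrict (\<kappa> V s i) W) i \<odot>\<^bsub>sections F W\<^esub> restr F U W (b i))"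
        using s V W rs rb[OF W(1) WU] bU U
        by (intro mW.finsum_cong') (auto simp: restr_smult restr_restr)
      finally show "restr F V W s = \<dots>" .
    qed (use rs in auto)
    from \<kappa>_eq[OF W(1) WU _ this] show "\<kappa> W (restr F V W s) i p = \<kappa> V s i p"
      using s i p V W by (simp add: restr_closed)
  next
    fix V s t
    assume V: "open V" "V \<subseteq> U" and s: "s \<in> sec F V" and t: "t \<in> sec F V"
      and eq: "\<And>i p. i < r \<Longrightarrow> p \<in> V \<Longrightarrow> \<kappa> V s i p = \<kappa> V t i p"
    \<comment> \<open>The section is recovered from the coefficient family as a whole, so equality
      is also needed for indices from \<open>r\<close> on and for points outside \<open>V\<close>;
      there it holds by extensionality.\<close>
    have "\<kappa> V s i p = \<kappa> V t i p" for i p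
    proof (cases "i < r")
      case True
      then show ?thesis
        using \<kappa>_in[OF V s True] \<kappa>_in[OF V t True] eq[of i p]
        by (cases "p \<in> V") (auto simp: structure_sheaf_iff extensional_def)
    next
      case False
      then show ?thesis
        using \<kappa>[OF V s] \<kappa>[OF V t] by (auto simp: P_def PiE_iff extensional_def)
    qed
    then have "\<kappa> V s = \<kappa> V t" by blast
    then show "s = t"
      using \<kappa>[OF V s] \<kappa>[OF V t] unfolding P_def by simp
  next
    fix V and a :: "nat \<Rightarrow> 'a \<Rightarrow> complex"
    assume V: "open V" "V \<subseteq> U" and a: "\<And>i. i < r \<Longrightarrow> holomorphic_fun A V (a i)"
    interpret m: module "structure_sheaf A V" "sections F V" by (rule sections_module) fact
    define a' where "a' = (\<lambda>i\<in>{..<r}. restrict (a i) V)"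
    have a': "a' i \<in> carrier (structure_sheaf A V)" if "i < r" for i
      using that restrict_in_structure_sheaf[OF A a[OF that]] by (simp add: a'_def)
    define s where "s = (\<Oplus>\<^bsub>sections F V\<^esub>i\<in>{..<r}. a' i \<odot>\<^bsub>sections F V\<^esub> restr F U V (b i))"
    have s: "s \<in> sec F V"
      unfolding s_def using a' rb[OF V] by (intro m.finsum_closed) auto
    have "\<kappa> V s = a'"
      using a' by (intro \<kappa>_eq V s) (auto simp: P_def s_def a'_def)
    then show "\<exists>s\<in>sec F V. \<forall>i<r. \<forall>p\<in>V. \<kappa> V s i p = a i p"
      by (intro bexI[OF _ s]) (simp add: a'_def)
  qed (use \<kappa>_in in \<open>auto intro: add_in smult_in restr_closed simp: structure_sheaf_iff\<close>)
  then show ?thesis by blast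
qed

text \<open>The frame consists of the unit sections. Existence and uniqueness of coefficients both
  come from \<open>co\<close>: the coordinates of a combination of unit sections are its
  coefficients.\<close>

lemma local_coords_frame:
  assumes sheaf: "sheaf_of_modules A F" and coords: "local_coords A F r U \<kappa>"
  shows "\<exists>b. local_frame A F r U b"
proof -
  interpret sheaf_of_modules A F by fact
  interpret local_coords A F r U \<kappa> by fact
  have "local_frame A F r U (unit_section U)"
    unfolding local_frame_def
  proof (intro conjI allI impI; (elim conjE)?)
    show "unit_section U i \<in> sec F U" for i
      by (intro unit_section open_domain order_refl)
    fix V s assume V: "open V" "V \<subseteq> U" and s: "s \<in> sec F V"
    interpret m: module "structure_sheaf A V" "sections F V" by (rule sections_module) fact
    note ru = restr_unit_section[OF open_domain order_refl V]
    have zero: "\<kappa> V \<zero>\<^bsub>sections F V\<^esub> j p = 0" if "j < r" "p \<in> V" for j p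
      using coord_add[OF V, of "\<zero>\<^bsub>sections F V\<^esub>" "\<zero>\<^bsub>sections F V\<^esub>" j p] that by simp
    have sum: "\<kappa> V (finsum (sections F V) g I) j p = (\<Sum>i\<in>I. \<kappa> V (g i) j p)"
      if "finite I" "\<And>i. i \<in> I \<Longrightarrow> g i \<in> sec F V" "j < r" "p \<in> V" for I :: "nat set" and g j p
      using that
    proof (induction I rule: finite_induct)
      case (insert i I)
      have "g \<in> I \<rightarrow> sec F V" "g i \<in> sec F V" using insert by auto
      then show ?case
        using insert V by (simp add: m.finsum_insert coord_add m.finsum_closed)
    qed (simp add: zero)
    have co: "\<kappa> V (\<Oplus>\<^bsub>sections F V\<^esub>i\<in>{..<r}. a i \<odot>\<^bsub>sections F V\<^esub> unit_section V i) j p = a j p"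
      if "j < r" "p \<in> V" "a \<in> {..<r} \<rightarrow>\<^sub>E carrier (structure_sheaf A V)" for a j p
    proof -
      have ai: "a i \<in> carrier (structure_sheaf A V)" if "i < r" for i
        using \<open>a \<in> _\<close> that by (auto dest: PiE_mem)
      have "\<kappa> V (\<Oplus>\<^bsub>sections F V\<^esub>i\<in>{..<r}. a i \<odot>\<^bsub>sections F V\<^esub> unit_section V i) j p =
        (\<Sum>i<r. \<kappa> V (a i \<odot>\<^bsub>sections F V\<^esub> unit_section V i) j p)"
        using that V by (intro sum) (auto intro!: unit_section)
      also have "\<dots> = (\<Sum>i<r. if i = j then a i p else 0)"
        using that V ai by (intro sum.cong) (auto simp: coord_smult unit_section_in coord_unit_section)
      finally show ?thesis using that by simp
    qed
    define a where "a = (\<lambda>i\<in>{..<r}. restrict (\<kappa> V s i) V)"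
    have a: "a \<in> {..<r} \<rightarrow>\<^sub>E carrier (structure_sheaf A V)"
      unfolding a_def using restrict_in_structure_sheaf[OF surface coord_holomorphic[OF V s]] by auto
    show "\<exists>!a. a \<in> {..<r} \<rightarrow>\<^sub>E carrier (structure_sheaf A V) \<and>
              s = (\<Oplus>\<^bsub>sections F V\<^esub>i\<in>{..<r}. a i \<odot>\<^bsub>sections F V\<^esub> restr F U V (unit_section U i))"
      unfolding ru
    proof (intro ex1I[of _ a] conjI a)
      show "s = (\<Oplus>\<^bsub>sections F V\<^esub>i\<in>{..<r}. a i \<odot>\<^bsub>sections F V\<^esub> unit_section V i)"
      proof (rule coord_inj[OF V s])
        show "(\<Oplus>\<^bsub>sections F V\<^esub>i\<in>{..<r}. a i \<odot>\<^bsub>sections F V\<^esub> unit_section V i) \<in> sec F V"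
          using a V by (intro m.finsum_closed) (auto intro!: unit_section)
      qed (simp add: co[OF _ _ a], simp add: a_def)
      fix a' assume a': "a' \<in> {..<r} \<rightarrow>\<^sub>E carrier (structure_sheaf A V) \<and>
        s = (\<Oplus>\<^bsub>sections F V\<^esub>i\<in>{..<r}. a' i \<odot>\<^bsub>sections F V\<^esub> unit_section V i)"
      show "a' = a"
      proof (rule PiE_ext[OF conjunct1[OF a'] a])
        fix i assume "i \<in> {..<r}"
        then show "a' i = a i"
          using a' a co[of i _ a'] by (intro extensionalityI[of _ V]) (auto simp: a_def structure_sheaf_iff PiE_iff)
      qed
    qed
  qed
  then show ?thesis by blast
qed

section \<open>Fibres in local coordinates\<close>

text \<open>The operations on a fibre and the form on it are defined as unions over representatives;
  this lemma reduces them to one representative.\<close>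

lemma Union_constant: "I \<noteq> {} \<Longrightarrow> (\<And>i. i \<in> I \<Longrightarrow> f i = c) \<Longrightarrow> (\<Union>i\<in>I. f i) = c"
  by auto

locale sheaf_coords = sheaf_of_modules A F + local_coords A F r U \<kappa>
  for A :: "('a::t2_space) chart set" and F :: "('a, 's) module_sheaf" and r :: nat
    and U :: "'a set" and \<kappa> :: "'a set \<Rightarrow> 's \<Rightarrow> nat \<Rightarrow> 'a \<Rightarrow> complex"
begin

text \<open>Elements of a fibre are represented by sections over neighbourhoods that need not lie in
  \<open>U\<close>, whereas coordinates exist only inside \<open>U\<close>; hence the restriction to
  the intersection.\<close>

definition coords_at :: "'a \<Rightarrow> 'a set \<Rightarrow> 's \<Rightarrow> nat \<Rightarrow> complex" where
  "coords_at y V s i = \<kappa> (V \<inter> U) (restr F V (V \<inter> U) s) i y"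

lemma coords_at_eq: "open V \<Longrightarrow> V \<subseteq> U \<Longrightarrow> s \<in> sec F V \<Longrightarrow> coords_at y V s i = \<kappa> V s i y"
  by (simp add: coords_at_def restr_id Int_absorb2)

lemma coords_at_restr:
  assumes "open V" "open W" "W \<subseteq> V" "y \<in> W" "y \<in> U" "s \<in> sec F V" "i < r"
  shows "coords_at y W (restr F V W s) i = coords_at y V s i"
proof -
  have "restr F W (W \<inter> U) (restr F V W s) = restr F (V \<inter> U) (W \<inter> U) (restr F V (V \<inter> U) s)"
    using assms open_domain by (subst (1 2) restr_restr) auto
  then show ?thesis
    unfolding coords_at_def using assms open_domain
    by (simp, subst coord_restr) (auto intro: restr_closed)
qed

lemma coords_at_add:
  assumes "open V" "y \<in> V" "y \<in> U" "s \<in> sec F V" "t \<in> sec F V" "i < r"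
  shows "coords_at y V (s \<oplus>\<^bsub>sections F V\<^esub> t) i = coords_at y V s i + coords_at y V t i"
  unfolding coords_at_def using assms open_domain
  by (simp add: restr_add coord_add restr_closed open_Int)

lemma coords_at_smult:
  assumes "open V" "y \<in> V" "y \<in> U" "f \<in> carrier (structure_sheaf A V)" "s \<in> sec F V" "i < r"
  shows "coords_at y V (f \<odot>\<^bsub>sections F V\<^esub> s) i = f y * coords_at y V s i"
proof -
  have "restrict f (V \<inter> U) \<in> carrier (structure_sheaf A (V \<inter> U))"
    using assms by (intro restrict_in_structure_sheaf[OF surface]) (auto simp: structure_sheaf_iff)
  then show ?thesis
    unfolding coords_at_def using assms open_domain
    by (simp add: restr_smult coord_smult restr_closed open_Int)
qed

lemma coords_at_zero:
  assumes "open V" "y \<in> V" "y \<in> U" "i < r"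
  shows "coords_at y V \<zero>\<^bsub>sections F V\<^esub> i = 0"
proof -
  interpret m: module "structure_sheaf A V" "sections F V" by (rule sections_module) fact
  show ?thesis
    using coords_at_add[of V y "\<zero>\<^bsub>sections F V\<^esub>" "\<zero>\<^bsub>sections F V\<^esub>" i] assms by simp
qed

lemma coords_at_minus:
  assumes "open V" "y \<in> V" "y \<in> U" "s \<in> sec F V" "t \<in> sec F V" "i < r"
  shows "coords_at y V (s \<ominus>\<^bsub>sections F V\<^esub> t) i = coords_at y V s i - coords_at y V t i"
proof -
  interpret m: module "structure_sheaf A V" "sections F V" by (rule sections_module) fact
  have "(s \<ominus>\<^bsub>sections F V\<^esub> t) \<oplus>\<^bsub>sections F V\<^esub> t = s"
    using assms by (simp add: m.minus_eq m.a_assoc m.l_neg)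
  then show ?thesis
    using coords_at_add[of V y "s \<ominus>\<^bsub>sections F V\<^esub> t" t i] assms by simp
qed

section \<open>The fibre at a point as a space of coordinate vectors\<close>

lemma ideal_multiples_submodule:
  assumes "open V"
  shows "submodule (structure_sheaf A V) (ideal_multiples A y F V) (sections F V)"
proof -
  interpret m: module "structure_sheaf A V" "sections F V" by (rule sections_module) fact
  show ?thesis
    unfolding ideal_multiples_def
    by (rule m.span_is_submodule) (auto simp: vanishing_ideal_def)
qed

text \<open>The sections whose coordinates vanish at \<open>y\<close> form a submodule that contains
  all generators of the span.\<close>

lemma ideal_multiples_coords_at:
  assumes "open V" "y \<in> V" "y \<in> U" "s \<in> ideal_multiples A y F V" "i < r"
  shows "coords_at y V s i = 0"
proof -
  interpret m: module "structure_sheaf A V" "sections F V" by (rule sections_module) fact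
  define N where "N = {s \<in> sec F V. \<forall>i<r. coords_at y V s i = 0}"
  have "submodule (structure_sheaf A V) N (sections F V)"
    using assms by unfold_locales (auto simp: N_def coords_at_add coords_at_smult coords_at_zero)
  moreover have "{f \<odot>\<^bsub>sections F V\<^esub> s | f s. f \<in> vanishing_ideal A y V \<and> s \<in> sec F V} \<subseteq> N"
    using assms by (auto simp: N_def vanishing_ideal_def coords_at_smult)
  ultimately have "ideal_multiples A y F V \<subseteq> N"
    unfolding ideal_multiples_def by (intro m.span_is_subset)
  with assms show ?thesis by (auto simp: N_def)
qed

lemma in_ideal_multiples:
  assumes V: "open V" and f: "f \<in> vanishing_ideal A y V" and s: "s \<in> sec F V"
  shows "f \<odot>\<^bsub>sections F V\<^esub> s \<in> ideal_multiples A y F V"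
proof -
  interpret m: module "structure_sheaf A V" "sections F V" by (rule sections_module) fact
  have "{f \<odot>\<^bsub>sections F V\<^esub> s | f s. f \<in> vanishing_ideal A y V \<and> s \<in> sec F V} \<subseteq> ideal_multiples A y F V"
    unfolding ideal_multiples_def by (rule m.in_own_span) (auto simp: vanishing_ideal_def)
  with f s show ?thesis by blast
qed

text \<open>For the converse, \<open>s\<close> is the combination of the unit sections with its own
  coordinates as coefficients, and these lie in the ideal of \<open>y\<close>. If \<open>y\<close>
  is outside \<open>V\<close>, the ideal is the whole ring.\<close>

lemma ideal_multiples_iff:
  assumes V: "open V" "V \<subseteq> U" and s: "s \<in> sec F V"
  shows "s \<in> ideal_multiples A y F V \<longleftrightarrow> (y \<in> V \<longrightarrow> (\<forall>i<r. \<kappa> V s i y = 0))"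
proof
  assume "s \<in> ideal_multiples A y F V"
  then show "y \<in> V \<longrightarrow> (\<forall>i<r. \<kappa> V s i y = 0)"
    using ideal_multiples_coords_at[OF V(1), of y s] V s by (auto simp: coords_at_eq)
next
  assume *: "y \<in> V \<longrightarrow> (\<forall>i<r. \<kappa> V s i y = 0)"
  interpret m: module "structure_sheaf A V" "sections F V" by (rule sections_module) fact
  interpret N: submodule "structure_sheaf A V" "ideal_multiples A y F V" "sections F V"
    by (rule ideal_multiples_submodule) fact
  show "s \<in> ideal_multiples A y F V"
  proof (rule coord_induct[OF V s])
    fix t assume t: "t \<in> sec F V" "\<And>i p. i < r \<Longrightarrow> p \<in> V \<Longrightarrow> \<kappa> V t i p = 0"
    have "t = \<zero>\<^bsub>sections F V\<^esub>"
      using t V coords_at_zero[OF V(1)] by (intro coord_inj[OF V]) (auto simp: coords_at_eq)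
    then show "t \<in> ideal_multiples A y F V" by simp
  next
    fix i assume i: "i < r"
    have "restrict (\<kappa> V s i) V \<in> carrier (structure_sheaf A V)"
      using V s i by (intro restrict_in_structure_sheaf[OF surface coord_holomorphic]) auto
    with i * have "restrict (\<kappa> V s i) V \<in> vanishing_ideal A y V"
      by (auto simp: vanishing_ideal_def)
    then show "restrict (\<kappa> V s i) V \<odot>\<^bsub>sections F V\<^esub> unit_section V i \<in> ideal_multiples A y F V"
      by (intro in_ideal_multiples V unit_section)
  qed simp
qed

text \<open>This makes the fibre a copy of \<complex>^r. On a common neighbourhood inside
  \<open>U\<close>, the difference of the two germs is a multiple of the ideal exactly when its
  coordinates vanish at \<open>y\<close>.\<close>

lemma fibre_rel_iff:
  assumes y: "y \<in> U" and s: "(V, s) \<in> local_sections F y" and t: "(W, t) \<in> local_sections F y"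
  shows "((V, s), (W, t)) \<in> fibre_rel A F y \<longleftrightarrow> (\<forall>i<r. coords_at y V s i = coords_at y W t i)"
proof
  assume "((V, s), (W, t)) \<in> fibre_rel A F y"
  then obtain N where N: "open N" "y \<in> N" "N \<subseteq> V \<inter> W"
    and id: "restr F V N s \<ominus>\<^bsub>sections F N\<^esub> restr F W N t \<in> ideal_multiples A y F N"
    by (auto simp: fibre_rel_def)
  have "restr F V N s \<in> sec F N" "restr F W N t \<in> sec F N"
    using s t N by (auto simp: local_sections_def intro: restr_closed)
  then show "\<forall>i<r. coords_at y V s i = coords_at y W t i"
    using ideal_multiples_coords_at[OF N(1,2) y id] y s t N
    by (auto simp: coords_at_minus coords_at_restr local_sections_def)
next
  assume eq: "\<forall>i<r. coords_at y V s i = coords_at y W t i"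
  define N where "N = V \<inter> W \<inter> U"
  have N: "open N" "y \<in> N" "N \<subseteq> V \<inter> W" "N \<subseteq> U"
    using y s t open_domain by (auto simp: N_def local_sections_def)
  interpret m: module "structure_sheaf A N" "sections F N" by (rule sections_module) fact
  have st: "restr F V N s \<in> sec F N" "restr F W N t \<in> sec F N"
    using s t N by (auto simp: local_sections_def intro: restr_closed)
  have "coords_at y N (restr F V N s \<ominus>\<^bsub>sections F N\<^esub> restr F W N t) i = 0" if "i < r" for i
    using that st N y s t eq by (simp add: coords_at_minus coords_at_restr local_sections_def)
  then have "restr F V N s \<ominus>\<^bsub>sections F N\<^esub> restr F W N t \<in> ideal_multiples A y F N"
    using st N by (subst ideal_multiples_iff) (auto simp: coords_at_eq)
  then show "((V, s), (W, t)) \<in> fibre_rel A F y"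
    using s t N by (auto simp: fibre_rel_def)
qed

text \<open>The isomorphism from \<complex>^r to the fibre, with the section of constant coordinates
  \<open>c\<close> as representative. Entries of \<open>c\<close> from \<open>r\<close> on have no
  effect, so it is injective only up to them.\<close>

definition value_of :: "'a \<Rightarrow> (nat \<Rightarrow> complex) \<Rightarrow> ('a set \<times> 's) set" where
  "value_of y c = section_value A F y U (of_coords U (\<lambda>i p. c i))"

lemma of_const_coords:
  shows "of_coords U (\<lambda>i p. c i) \<in> sec F U"
    and "i < r \<Longrightarrow> p \<in> U \<Longrightarrow> \<kappa> U (of_coords U (\<lambda>i p. c i)) i p = c i"
  using of_coords[OF open_domain order_refl, of "\<lambda>i p. c i"] by (simp_all add: holomorphic_fun_const)

lemma section_value_eq:
  assumes y: "y \<in> U" and s: "open V" "y \<in> V" "s \<in> sec F V"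
  shows "section_value A F y V s =
    {(W, t). open W \<and> y \<in> W \<and> t \<in> sec F W \<and> (\<forall>i<r. coords_at y W t i = coords_at y V s i)}"
proof -
  have V: "(V, s) \<in> local_sections F y"
    using s by (simp add: local_sections_def)
  have "((V, s), (W, t)) \<in> fibre_rel A F y \<longleftrightarrow>
     (W, t) \<in> local_sections F y \<and> (\<forall>i<r. coords_at y W t i = coords_at y V s i)" for W t
  proof (cases "(W, t) \<in> local_sections F y")
    case True
    show ?thesis using fibre_rel_iff[OF y V True] True by auto
  qed (auto simp: fibre_rel_def)
  then show ?thesis
    by (auto simp: section_value_def local_sections_def)
qed

lemma value_of_eq:
  assumes y: "y \<in> U"
  shows "value_of y c = {(W, t). open W \<and> y \<in> W \<and> t \<in> sec F W \<and> (\<forall>i<r. coords_at y W t i = c i)}"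
  using y open_domain of_const_coords[where c=c] unfolding value_of_def
  by (subst section_value_eq) (auto simp: coords_at_eq)

lemma section_value_value_of:
  assumes "y \<in> U" "open V" "y \<in> V" "s \<in> sec F V" "\<And>i. i < r \<Longrightarrow> coords_at y V s i = c i"
  shows "section_value A F y V s = value_of y c"
  using assms by (auto simp: section_value_eq value_of_eq)

lemma value_of_nonempty: "y \<in> U \<Longrightarrow> (U, of_coords U (\<lambda>i p. c i)) \<in> value_of y c"
  using of_const_coords[where c=c] open_domain by (simp add: value_of_eq coords_at_eq)

lemma value_of_not_empty: "y \<in> U \<Longrightarrow> value_of y c \<noteq> {}"
  using value_of_nonempty[of y c] by (metis empty_iff)

lemma value_of_eq_iff:
  assumes "y \<in> U"
  shows "value_of y c = value_of y d \<longleftrightarrow> (\<forall>i<r. c i = d i)"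
proof
  assume "value_of y c = value_of y d"
  then have "(U, of_coords U (\<lambda>i p. c i)) \<in> value_of y d"
    using value_of_nonempty[OF assms, of c] by simp
  then show "\<forall>i<r. c i = d i"
    using of_const_coords[where c=c] open_domain assms by (simp add: value_of_eq coords_at_eq)
qed (use assms in \<open>auto simp: value_of_eq\<close>)

lemma fibre_carrier:
  assumes y: "y \<in> U"
  shows "carrier (fibre A F y) = range (value_of y)"
proof -
  have "carrier (fibre A F y) = (\<Union>(V, s)\<in>local_sections F y. {section_value A F y V s})"
    by (auto simp: fibre_def quotient_def section_value_def)
  also have "\<dots> = range (value_of y)"
  proof (intro equalityI subsetI)
    fix P assume "P \<in> (\<Union>(V, s)\<in>local_sections F y. {section_value A F y V s})"
    then obtain V s where "open V" "y \<in> V" "s \<in> sec F V" "P = section_value A F y V s"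
      by (auto simp: local_sections_def)
    with y show "P \<in> range (value_of y)"
      using section_value_value_of[OF y, of V s "coords_at y V s"] by auto
  next
    fix P assume "P \<in> range (value_of y)"
    then show "P \<in> (\<Union>(V, s)\<in>local_sections F y. {section_value A F y V s})"
      using y open_domain of_const_coords(1)
      by (force simp: value_of_def local_sections_def)
  qed
  finally show ?thesis .
qed

lemma fibre_zero: "y \<in> U \<Longrightarrow> \<zero>\<^bsub>fibre A F y\<^esub> = value_of y (\<lambda>i. 0)"
  by (simp add: fibre_def section_value_value_of zero_in coords_at_zero)

lemma fibre_add:
  assumes y: "y \<in> U"
  shows "value_of y c \<oplus>\<^bsub>fibre A F y\<^esub> value_of y d = value_of y (\<lambda>i. c i + d i)"
proof -
  have main: "section_value A F y (V \<inter> W)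
      (restr F V (V \<inter> W) s \<oplus>\<^bsub>sections F (V \<inter> W)\<^esub> restr F W (V \<inter> W) t) = value_of y (\<lambda>i. c i + d i)"
    if "(V, s) \<in> value_of y c" "(W, t) \<in> value_of y d" for V s W t
  proof -
    have s: "open V" "y \<in> V" "s \<in> sec F V" "\<And>i. i < r \<Longrightarrow> coords_at y V s i = c i"
      and t: "open W" "y \<in> W" "t \<in> sec F W" "\<And>i. i < r \<Longrightarrow> coords_at y W t i = d i"
      using y that by (auto simp: value_of_eq)
    then show ?thesis
      using y by (intro section_value_value_of)
        (auto simp: coords_at_add coords_at_restr restr_closed open_Int intro!: add_in)
  qed
  have "(\<Union>(W, t)\<in>value_of y d. section_value A F y (V \<inter> W)
      (restr F V (V \<inter> W) s \<oplus>\<^bsub>sections F (V \<inter> W)\<^esub> restr F W (V \<inter> W) t)) = value_of y (\<lambda>i. c i + d i)"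
    if "(V, s) \<in> value_of y c" for V s
    by (intro Union_constant) (use value_of_not_empty[OF y] main that in auto)
  then show ?thesis
    unfolding fibre_def ring_record_simps
    by (intro Union_constant) (use value_of_not_empty[OF y] in auto)
qed

lemma fibre_smult:
  assumes y: "y \<in> U"
  shows "a \<odot>\<^bsub>fibre A F y\<^esub> value_of y c = value_of y (\<lambda>i. a * c i)"
proof -
  have "section_value A F y V ((\<lambda>z\<in>V. a) \<odot>\<^bsub>sections F V\<^esub> s) = value_of y (\<lambda>i. a * c i)"
    if "(V, s) \<in> value_of y c" for V s
  proof -
    have s: "open V" "y \<in> V" "s \<in> sec F V" "\<And>i. i < r \<Longrightarrow> coords_at y V s i = c i"
      using y that by (auto simp: value_of_eq)
    have "(\<lambda>z\<in>V. a) \<in> carrier (structure_sheaf A V)"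
      using restrict_in_structure_sheaf[OF surface holomorphic_fun_const] by blast
    with y s show ?thesis
      by (intro section_value_value_of) (auto simp: coords_at_smult intro: smult_in)
  qed
  then show ?thesis
    unfolding fibre_def module.simps
    by (intro Union_constant) (use value_of_not_empty[OF y] in auto)
qed

end

text \<open>Keeps the rank 1 of a line bundle, a locale argument, in its syntactic form.\<close>

declare One_nat_def [simp del]

section \<open>Bilinear forms in local coordinates\<close>

lemma sum_mult_eq_0_iff:
  fixes f :: "nat \<Rightarrow> complex"
  shows "(\<forall>d. (\<Sum>j<r. f j * d j) = 0) \<longleftrightarrow> (\<forall>j<r. f j = 0)"
proof (intro iffI allI impI)
  fix j assume *: "\<forall>d. (\<Sum>j<r. f j * d j) = 0" and j: "j < r"
  have "(\<Sum>k<r. f k * (if k = j then 1 else 0)) = (\<Sum>k<r. if k = j then f k else 0)"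
    by (intro sum.cong) auto
  with * j show "f j = 0" by simp
qed simp

locale coords_pair = F: sheaf_coords A F r U \<kappa> + M: sheaf_coords A M 1 U \<mu>
  for A :: "('a::t2_space) chart set" and F :: "('a, 's) module_sheaf" and r :: nat
    and U :: "'a set" and \<kappa> :: "'a set \<Rightarrow> 's \<Rightarrow> nat \<Rightarrow> 'a \<Rightarrow> complex"
    and M :: "('a, 'm) module_sheaf" and \<mu> :: "'a set \<Rightarrow> 'm \<Rightarrow> nat \<Rightarrow> 'a \<Rightarrow> complex"
begin

text \<open>A homomorphism to a line bundle is a row of functions, given by its values on the unit
  sections; 0 is the only index of a coordinate of \<open>M\<close>.\<close>

definition hom_coord :: "'a set \<Rightarrow> ('a set \<Rightarrow> 's \<Rightarrow> 'm) \<Rightarrow> nat \<Rightarrow> 'a \<Rightarrow> complex" where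
  "hom_coord V h j p = \<mu> V (h V (F.unit_section V j)) 0 p"

lemma hom_sections:
  assumes "h \<in> sec (hom_sheaf A F M) V" "open W" "W \<subseteq> V"
  shows hom_sections_hom: "h W \<in> module_hom (structure_sheaf A W) (sections F W) (sections M W)"
    and hom_sections_restr: "open W' \<Longrightarrow> W' \<subseteq> W \<Longrightarrow> s \<in> sec F W \<Longrightarrow> h W' (restr F W W' s) = restr M W W' (h W s)"
  using assms by (auto simp: hom_sheaf_def opens_in_def PiE_iff)

lemma hom_unit_section:
  assumes h: "h \<in> sec (hom_sheaf A F M) V" and V: "open V" "V \<subseteq> U"
    and W: "open W" "W \<subseteq> V" and p: "p \<in> W"
  shows "\<mu> W (h W (F.unit_section W i)) 0 p = hom_coord V h i p"
proof -
  have "h W (F.unit_section W i) = restr M V W (h V (F.unit_section V i))"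
    using hom_sections_restr[OF h V(1) order_refl W F.unit_section_in[OF V]] F.restr_unit_section[OF V W] by simp
  moreover have "h V (F.unit_section V i) \<in> sec M V"
    using module_hom_closed[OF hom_sections_hom[OF h V(1) order_refl]] F.unit_section_in[OF V] by blast
  ultimately show ?thesis
    using V W p by (simp add: hom_coord_def M.coord_restr)
qed

lemma hom_expansion:
  assumes h: "h \<in> sec (hom_sheaf A F M) V" and V: "open V" "V \<subseteq> U"
    and W: "open W" "W \<subseteq> V" and s: "s \<in> sec F W" and p: "p \<in> W"
  shows "\<mu> W (h W s) 0 p = (\<Sum>i<r. \<kappa> W s i p * hom_coord V h i p)"
proof -
  note hom = hom_sections_hom[OF h W]
  have WU: "W \<subseteq> U" using V W by blast
  have "\<mu> W (h W s) 0 p = (\<Sum>i<r. \<kappa> W s i p * \<mu> W (h W (F.unit_section W i)) 0 p)"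
    using W WU p s module_hom_closed[OF hom]
    by (intro F.coord_expansion[where T = "\<lambda>s. \<mu> W (h W s) 0 p"])
      (auto simp: module_hom_add[OF hom] module_hom_smult[OF hom] M.coord_add M.coord_smult Pi_iff)
  then show ?thesis
    by (simp add: hom_unit_section[OF h V W p])
qed

text \<open>Sections of \<open>M\<close> are determined by their coordinate, so a formula that is
  linear in the coordinates of \<open>s\<close>, with coefficients \<open>a\<close> common to all
  smaller open sets, already yields linearity and compatibility with restriction.\<close>

lemma hom_sectionI:
  assumes V: "open V" "V \<subseteq> U"
    and g: "\<And>W s. open W \<Longrightarrow> W \<subseteq> V \<Longrightarrow> s \<in> sec F W \<Longrightarrow> g W s \<in> sec M W"
    and a: "\<And>W s p. open W \<Longrightarrow> W \<subseteq> V \<Longrightarrow> s \<in> sec F W \<Longrightarrow> p \<in> W \<Longrightarrow>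
        \<mu> W (g W s) 0 p = (\<Sum>i<r. \<kappa> W s i p * a i p)"
  shows "(\<lambda>W\<in>opens_in V. \<lambda>s\<in>sec F W. g W s) \<in> sec (hom_sheaf A F M) V"
proof -
  have "(\<lambda>s\<in>sec F W. g W s) \<in> module_hom (structure_sheaf A W) (sections F W) (sections M W)"
    if W: "open W" "W \<subseteq> V" for W
  proof -
    have WU: "W \<subseteq> U" using V W by blast
    show ?thesis
      unfolding module_hom_def mem_Collect_eq
    proof (intro conjI allI impI; (elim conjE)?)
      fix s t assume st: "s \<in> sec F W" "t \<in> sec F W"
      have "g W (s \<oplus>\<^bsub>sections F W\<^esub> t) = g W s \<oplus>\<^bsub>sections M W\<^esub> g W t"
        by (rule M.coord_inj[OF W(1) WU])
          (use st W WU in \<open>auto simp: g a F.add_in F.coord_add M.coord_add ring_distribs sum.distrib intro!: M.add_in\<close>)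
      then show "(\<lambda>s\<in>sec F W. g W s) (s \<oplus>\<^bsub>sections F W\<^esub> t) =
          (\<lambda>s\<in>sec F W. g W s) s \<oplus>\<^bsub>sections M W\<^esub> (\<lambda>s\<in>sec F W. g W s) t"
        using st W by (simp add: F.add_in)
    next
      fix f s assume st: "f \<in> carrier (structure_sheaf A W)" "s \<in> sec F W"
      have "g W (f \<odot>\<^bsub>sections F W\<^esub> s) = f \<odot>\<^bsub>sections M W\<^esub> g W s"
        by (rule M.coord_inj[OF W(1) WU])
          (use st W WU in \<open>auto simp: g a F.smult_in F.coord_smult M.coord_smult sum_distrib_left mult.assoc intro!: M.smult_in\<close>)
      then show "(\<lambda>s\<in>sec F W. g W s) (f \<odot>\<^bsub>sections F W\<^esub> s) = f \<odot>\<^bsub>sections M W\<^esub> (\<lambda>s\<in>sec F W. g W s) s"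
        using st W by (simp add: F.smult_in)
    qed (use g W in auto)
  qed
  moreover have "g W' (restr F W W' s) = restr M W W' (g W s)"
    if W: "open W" "W \<subseteq> V" "open W'" "W' \<subseteq> W" "s \<in> sec F W" for W W' s
  proof -
    have sub: "W' \<subseteq> V" "W' \<subseteq> U" "W \<subseteq> U" using V W by auto
    show ?thesis
      by (rule M.coord_inj[of W'])
        (use W sub in \<open>auto simp: g a F.restr_closed F.coord_restr M.coord_restr subset_iff intro!: M.restr_closed\<close>)
  qed
  ultimately show ?thesis
    using F.restr_closed by (auto simp: hom_sheaf_def opens_in_def subset_iff)
qed

text \<open>The unit sections of these coordinates are the dual frame. The sum, the multiple and the
  prescribed homomorphism are each recognised as sections by \<open>hom_sectionI\<close>; a
  homomorphism is determined by its row because of \<open>hom_expansion\<close>.\<close>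

lemma hom_coords: "local_coords A (hom_sheaf A F M) r U hom_coord"
proof (rule local_coords.intro[OF F.surface F.open_domain])
  let ?H = "hom_sheaf A F M"
  note hin = funcset_mem[OF module_hom_closed[OF hom_sections_hom]]
  have add: "h \<oplus>\<^bsub>sections ?H V\<^esub> k = (\<lambda>W\<in>opens_in V. \<lambda>s\<in>sec F W. h W s \<oplus>\<^bsub>sections M W\<^esub> k W s)" for h k V
    by (simp add: hom_sheaf_def)
  have smult: "f \<odot>\<^bsub>sections ?H V\<^esub> h = (\<lambda>W\<in>opens_in V. \<lambda>s\<in>sec F W. restrict f W \<odot>\<^bsub>sections M W\<^esub> h W s)" for f h V
    by (simp add: hom_sheaf_def)
  {
    fix V h k assume V: "open V" "V \<subseteq> U" and h: "h \<in> sec ?H V" and k: "k \<in> sec ?H V"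
    show "h \<oplus>\<^bsub>sections ?H V\<^esub> k \<in> sec ?H V"
      unfolding add
    proof (rule hom_sectionI[OF V, where a = "\<lambda>i p. hom_coord V h i p + hom_coord V k i p"])
      fix W s p assume W: "open W" "W \<subseteq> V" "s \<in> sec F W" "p \<in> W"
      have "W \<subseteq> U" using V W by blast
      with W show "\<mu> W (h W s \<oplus>\<^bsub>sections M W\<^esub> k W s) 0 p = (\<Sum>i<r. \<kappa> W s i p * (hom_coord V h i p + hom_coord V k i p))"
        by (simp add: M.coord_add hin[OF h] hin[OF k] hom_expansion[OF h V] hom_expansion[OF k V] ring_distribs sum.distrib)
    qed (auto intro!: M.add_in hin[OF h] hin[OF k])
    fix i p assume "i < r" "p \<in> V"
    then show "hom_coord V (h \<oplus>\<^bsub>sections ?H V\<^esub> k) i p = hom_coord V h i p + hom_coord V k i p"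
      using V F.unit_section_in[OF V]
      by (simp add: add hom_coord_def opens_in_def M.coord_add hin[OF h] hin[OF k])
  }
  {
    fix V f h assume V: "open V" "V \<subseteq> U" and f: "f \<in> carrier (structure_sheaf A V)" and h: "h \<in> sec ?H V"
    have rf: "restrict f W \<in> carrier (structure_sheaf A W)" if "W \<subseteq> V" for W
      using f that by (intro restrict_in_structure_sheaf[OF F.surface]) (auto simp: structure_sheaf_iff)
    show "f \<odot>\<^bsub>sections ?H V\<^esub> h \<in> sec ?H V"
      unfolding smult
    proof (rule hom_sectionI[OF V, where a = "\<lambda>i p. f p * hom_coord V h i p"])
      fix W s p assume W: "open W" "W \<subseteq> V" "s \<in> sec F W" "p \<in> W"
      have "W \<subseteq> U" using V W by blast
      with W show "\<mu> W (restrict f W \<odot>\<^bsub>sections M W\<^esub> h W s) 0 p = (\<Sum>i<r. \<kappa> W s i p * (f p * hom_coord V h i p))"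
        by (simp add: M.coord_smult rf hin[OF h] hom_expansion[OF h V] sum_distrib_left mult.left_commute)
    qed (auto intro!: M.smult_in hin[OF h] rf)
    fix i p assume "i < r" "p \<in> V"
    then show "hom_coord V (f \<odot>\<^bsub>sections ?H V\<^esub> h) i p = f p * hom_coord V h i p"
      using V F.unit_section_in[OF V] rf[of V]
      by (simp add: smult hom_coord_def opens_in_def M.coord_smult hin[OF h])
  }
  {
    fix V W h assume V: "open V" "V \<subseteq> U" and W: "open W" "W \<subseteq> V" and h: "h \<in> sec ?H V"
    show "restr ?H V W h \<in> sec ?H W"
      using h W by (auto simp: hom_sheaf_def opens_in_def PiE_iff)
    fix i p assume "i < r" "p \<in> W"
    then show "hom_coord W (restr ?H V W h) i p = hom_coord V h i p"
      using hom_unit_section[OF h V W, of p i] W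
      by (simp add: hom_coord_def hom_sheaf_def opens_in_def)
  }
  {
    fix V h k assume V: "open V" "V \<subseteq> U" and h: "h \<in> sec ?H V" and k: "k \<in> sec ?H V"
      and eq: "\<And>i p. i < r \<Longrightarrow> p \<in> V \<Longrightarrow> hom_coord V h i p = hom_coord V k i p"
    have hk: "h W s = k W s" if W: "open W" "W \<subseteq> V" "s \<in> sec F W" for W s
    proof (rule M.coord_inj[OF W(1)])
      show "\<mu> W (h W s) j p = \<mu> W (k W s) j p" if "j < 1" "p \<in> W" for j p
        using that W eq by (auto simp: hom_expansion[OF h V] hom_expansion[OF k V] subset_iff)
    qed (use V W hin[OF h] hin[OF k] in auto)
    show "h = k"
    proof (rule ext)
      fix W
      show "h W = k W"
      proof (cases "W \<in> opens_in V")
        case True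
        then have "h W \<in> extensional (sec F W)" "k W \<in> extensional (sec F W)"
          using h k by (auto simp: hom_sheaf_def PiE_iff)
        then show ?thesis
          using True hk by (intro extensionalityI) (auto simp: opens_in_def)
      next
        case False
        then show ?thesis
          using h k by (auto simp: hom_sheaf_def PiE_iff extensional_def)
      qed
    qed
  }
  {
    fix V h i assume V: "open V" "V \<subseteq> U" and h: "h \<in> sec ?H V"
    show "holomorphic_fun A V (hom_coord V h i)"
      unfolding hom_coord_def using V F.unit_section_in[OF V]
      by (intro M.coord_holomorphic hin[OF h]) auto
  }
  fix V and a :: "nat \<Rightarrow> 'a \<Rightarrow> complex"
  assume V: "open V" "V \<subseteq> U" and a: "\<And>i. i < r \<Longrightarrow> holomorphic_fun A V (a i)"
  \<comment> \<open>The homomorphism with prescribed row \<open>a\<close> pairs the coordinates of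
    \<open>s\<close> with \<open>a\<close>; the bound index of the \<open>M\<close>-coordinate is
    ignored because the rank is 1.\<close>
  define g where "g W s = M.of_coords W (\<lambda>k p. \<Sum>i<r. \<kappa> W s i p * a i p)" for W s
  define h where "h = (\<lambda>W\<in>opens_in V. \<lambda>s\<in>sec F W. g W s)"
  have holo: "holomorphic_fun A W (\<lambda>p. \<Sum>i<r. \<kappa> W s i p * a i p)" if "open W" "W \<subseteq> V" "s \<in> sec F W" for W s
    using that V holomorphic_fun_subset[OF a]
    by (intro holomorphic_fun_sum holomorphic_fun_mult F.coord_holomorphic) auto
  have g: "g W s \<in> sec M W" "p \<in> W \<Longrightarrow> \<mu> W (g W s) 0 p = (\<Sum>i<r. \<kappa> W s i p * a i p)"
    if W: "open W" "W \<subseteq> V" "s \<in> sec F W" for W s p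
  proof -
    have "W \<subseteq> U" using V W by blast
    note oc = M.of_coords[OF W(1) this, of "\<lambda>k p. \<Sum>i<r. \<kappa> W s i p * a i p", OF holo[OF W]]
    show "g W s \<in> sec M W" unfolding g_def by (rule oc(1))
    show "p \<in> W \<Longrightarrow> \<mu> W (g W s) 0 p = (\<Sum>i<r. \<kappa> W s i p * a i p)"
      unfolding g_def by (rule oc(2)) auto
  qed
  have "h \<in> sec ?H V"
    unfolding h_def by (rule hom_sectionI[OF V, where a = a]) (auto simp: g)
  moreover have "hom_coord V h i p = a i p" if "i < r" "p \<in> V" for i p
  proof -
    have "hom_coord V h i p = (\<Sum>j<r. \<kappa> V (F.unit_section V i) j p * a j p)"
      using V that F.unit_section_in[OF V] by (simp add: hom_coord_def h_def opens_in_def g)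
    also have "\<dots> = (\<Sum>j<r. if j = i then a j p else 0)"
      using V that by (intro sum.cong) (auto simp: F.coord_unit_section)
    finally show ?thesis using that by simp
  qed
  ultimately show "\<exists>h\<in>sec ?H V. \<forall>i<r. \<forall>p\<in>V. hom_coord V h i p = a i p"
    by blast
qed

end

section \<open>The Gram matrix of a bilinear form\<close>

locale form_coords = coords_pair A F r U \<kappa> M \<mu>
  for A :: "('a::t2_space) chart set" and F :: "('a, 's) module_sheaf" and r :: nat
    and U :: "'a set" and \<kappa> :: "'a set \<Rightarrow> 's \<Rightarrow> nat \<Rightarrow> 'a \<Rightarrow> complex"
    and M :: "('a, 'm) module_sheaf" and \<mu> :: "'a set \<Rightarrow> 'm \<Rightarrow> nat \<Rightarrow> 'a \<Rightarrow> complex" +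
  fixes \<psi> :: "'a set \<Rightarrow> 's \<Rightarrow> 's \<Rightarrow> 'm"
  assumes bilinear: "bilinear_form A F M \<psi>"
begin

definition gram :: "nat \<Rightarrow> nat \<Rightarrow> 'a \<Rightarrow> complex" where
  "gram i j p = \<mu> U (\<psi> U (F.unit_section U i) (F.unit_section U j)) 0 p"

lemma form_hom_left:
  "open V \<Longrightarrow> t \<in> sec F V \<Longrightarrow> (\<lambda>s. \<psi> V s t) \<in> module_hom (structure_sheaf A V) (sections F V) (sections M V)"
  using bilinear unfolding bilinear_form_def by blast

lemma form_hom_right:
  "open V \<Longrightarrow> s \<in> sec F V \<Longrightarrow> \<psi> V s \<in> module_hom (structure_sheaf A V) (sections F V) (sections M V)"
  using bilinear unfolding bilinear_form_def by blast

lemma form_restr: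
  "open V \<Longrightarrow> open W \<Longrightarrow> W \<subseteq> V \<Longrightarrow> s \<in> sec F V \<Longrightarrow> t \<in> sec F V \<Longrightarrow>
    \<psi> W (restr F V W s) (restr F V W t) = restr M V W (\<psi> V s t)"
  using bilinear unfolding bilinear_form_def by blast

lemma form_in: "open V \<Longrightarrow> s \<in> sec F V \<Longrightarrow> t \<in> sec F V \<Longrightarrow> \<psi> V s t \<in> sec M V"
  using module_hom_closed[OF form_hom_right] by blast

lemmas form_add_left = module_hom_add[OF form_hom_left]
lemmas form_add_right = module_hom_add[OF form_hom_right]
lemmas form_smult_left = module_hom_smult[OF form_hom_left]
lemmas form_smult_right = module_hom_smult[OF form_hom_right]
lemmas form_linear = form_in form_add_left form_add_right form_smult_left form_smult_right

lemma gram_holomorphic: "i < r \<Longrightarrow> j < r \<Longrightarrow> holomorphic_fun A U (gram i j)"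
  unfolding gram_def using F.open_domain F.unit_section[OF F.open_domain order_refl]
  by (auto intro!: M.coord_holomorphic form_in)

lemma form_unit_sections:
  assumes "open V" "V \<subseteq> U" "p \<in> V"
  shows "\<mu> V (\<psi> V (F.unit_section V i) (F.unit_section V j)) 0 p = gram i j p"
proof -
  have "\<psi> V (F.unit_section V i) (F.unit_section V j) = restr M U V (\<psi> U (F.unit_section U i) (F.unit_section U j))"
    using assms F.open_domain form_restr[of U V "F.unit_section U i" "F.unit_section U j"]
    by (simp add: F.unit_section_in F.restr_unit_section)
  then show ?thesis
    unfolding gram_def using assms F.open_domain
    by (simp add: M.coord_restr form_in F.unit_section)
qed

lemma form_unit_right:
  assumes V: "open V" "V \<subseteq> U" and s: "s \<in> sec F V" and p: "p \<in> V"
  shows "\<mu> V (\<psi> V s (F.unit_section V j)) 0 p = (\<Sum>i<r. \<kappa> V s i p * gram i j p)"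
proof -
  have "\<mu> V (\<psi> V s (F.unit_section V j)) 0 p =
      (\<Sum>i<r. \<kappa> V s i p * \<mu> V (\<psi> V (F.unit_section V i) (F.unit_section V j)) 0 p)"
    using V p s by (intro F.coord_expansion[where T = "\<lambda>s. \<mu> V (\<psi> V s (F.unit_section V j)) 0 p"])
      (auto simp: form_linear M.coord_add M.coord_smult F.unit_section)
  then show ?thesis by (simp add: form_unit_sections V p)
qed

lemma form_expansion:
  assumes V: "open V" "V \<subseteq> U" and s: "s \<in> sec F V" and t: "t \<in> sec F V" and p: "p \<in> V"
  shows "\<mu> V (\<psi> V s t) 0 p = (\<Sum>j<r. (\<Sum>i<r. \<kappa> V s i p * gram i j p) * \<kappa> V t j p)"
proof -
  have "\<mu> V (\<psi> V s t) 0 p = (\<Sum>j<r. \<kappa> V t j p * \<mu> V (\<psi> V s (F.unit_section V j)) 0 p)"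
    using V p s t by (intro F.coord_expansion[where T = "\<lambda>t. \<mu> V (\<psi> V s t) 0 p"])
      (auto simp: form_linear M.coord_add M.coord_smult)
  then show ?thesis by (simp add: form_unit_right V s p mult.commute)
qed

lemma coords_at_form:
  assumes y: "y \<in> U" and V: "open V" "y \<in> V" and s: "s \<in> sec F V" and t: "t \<in> sec F V"
  shows "M.coords_at y V (\<psi> V s t) 0 =
    (\<Sum>j<r. (\<Sum>i<r. F.coords_at y V s i * gram i j y) * F.coords_at y V t j)"
proof -
  have o: "open (V \<inter> U)" using V F.open_domain by auto
  have st: "restr F V (V \<inter> U) s \<in> sec F (V \<inter> U)" "restr F V (V \<inter> U) t \<in> sec F (V \<inter> U)"
    using V o s t by (auto intro: F.restr_closed)
  have "M.coords_at y V (\<psi> V s t) 0 = \<mu> (V \<inter> U) (\<psi> (V \<inter> U) (restr F V (V \<inter> U) s) (restr F V (V \<inter> U) t)) 0 y"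
    unfolding M.coords_at_def using V o s t by (simp add: form_restr)
  then show ?thesis
    unfolding F.coords_at_def using y V o st by (simp add: form_expansion)
qed

lemma fibre_form_value_of:
  assumes y: "y \<in> U"
  shows "fibre_form A F M \<psi> y (F.value_of y c) (F.value_of y d) =
    M.value_of y (\<lambda>k. \<Sum>j<r. (\<Sum>i<r. c i * gram i j y) * d j)"
proof -
  let ?R = "M.value_of y (\<lambda>k. \<Sum>j<r. (\<Sum>i<r. c i * gram i j y) * d j)"
  have main: "section_value A M y (V \<inter> W) (\<psi> (V \<inter> W) (restr F V (V \<inter> W) s) (restr F W (V \<inter> W) t)) = ?R"
    if "(V, s) \<in> F.value_of y c" "(W, t) \<in> F.value_of y d" for V s W t
  proof -
    have s: "open V" "y \<in> V" "s \<in> sec F V" "\<And>i. i < r \<Longrightarrow> F.coords_at y V s i = c i"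
      and t: "open W" "y \<in> W" "t \<in> sec F W" "\<And>i. i < r \<Longrightarrow> F.coords_at y W t i = d i"
      using y that by (auto simp: F.value_of_eq)
    then show ?thesis
      using y by (intro M.section_value_value_of)
        (auto simp: coords_at_form F.coords_at_restr F.restr_closed open_Int intro!: form_in)
  qed
  have "(\<Union>(W, t)\<in>F.value_of y d. section_value A M y (V \<inter> W)
      (\<psi> (V \<inter> W) (restr F V (V \<inter> W) s) (restr F W (V \<inter> W) t))) = ?R"
    if "(V, s) \<in> F.value_of y c" for V s
    by (intro Union_constant) (use F.value_of_not_empty[OF y] main that in auto)
  then show ?thesis
    unfolding fibre_form_def
    by (intro Union_constant) (use F.value_of_not_empty[OF y] in auto)
qed

text \<open>With B the Gram matrix, the radical consists of the c with c^T B = 0 at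
  \<open>y\<close>: \<open>form_radical\<close> puts its vector into the first argument, and a
  linear functional is 0 only if all its coefficients are.\<close>

lemma form_radical_fibre:
  assumes y: "y \<in> U"
  shows "form_radical (fibre A F y) (fibre A M y) (fibre_form A F M \<psi> y) =
    F.value_of y ` {c. \<forall>j<r. (\<Sum>i<r. c i * gram i j y) = 0}"
proof -
  have "(\<forall>w\<in>carrier (fibre A F y). fibre_form A F M \<psi> y (F.value_of y c) w = \<zero>\<^bsub>fibre A M y\<^esub>) \<longleftrightarrow>
    (\<forall>d. (\<Sum>j<r. (\<Sum>i<r. c i * gram i j y) * d j) = 0)" for c
  proof -
    have "fibre_form A F M \<psi> y (F.value_of y c) (F.value_of y d) = \<zero>\<^bsub>fibre A M y\<^esub> \<longleftrightarrow>
        (\<Sum>j<r. (\<Sum>i<r. c i * gram i j y) * d j) = 0" for d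
      unfolding fibre_form_value_of[OF y] M.fibre_zero[OF y] M.value_of_eq_iff[OF y] by simp
    then show ?thesis
      unfolding F.fibre_carrier[OF y] by blast
  qed
  also have "(\<forall>d. (\<Sum>j<r. (\<Sum>i<r. c i * gram i j y) * d j) = 0) \<longleftrightarrow> (\<forall>j<r. (\<Sum>i<r. c i * gram i j y) = 0)" for c
    by (rule sum_mult_eq_0_iff)
  finally have "F.value_of y c \<in> form_radical (fibre A F y) (fibre A M y) (fibre_form A F M \<psi> y) \<longleftrightarrow>
    (\<forall>j<r. (\<Sum>i<r. c i * gram i j y) = 0)" for c
    unfolding form_radical_def F.fibre_carrier[OF y] by blast
  moreover have "form_radical (fibre A F y) (fibre A M y) (fibre_form A F M \<psi> y) \<subseteq> range (F.value_of y)"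
    unfolding form_radical_def F.fibre_carrier[OF y] by blast
  ultimately show ?thesis by blast
qed

lemma nondegenerate_fibre_iff:
  assumes y: "y \<in> U"
  shows "nondegenerate (fibre A F y) (fibre A M y) (fibre_form A F M \<psi> y) \<longleftrightarrow>
    (\<forall>c. (\<forall>j<r. (\<Sum>i<r. c i * gram i j y) = 0) \<longrightarrow> (\<forall>i<r. c i = 0))"
proof -
  define K where "K = {c. \<forall>j<r. (\<Sum>i<r. c i * gram i j y) = 0}"
  have "(\<lambda>i. 0) \<in> K" by (simp add: K_def)
  then have "F.value_of y ` K = {F.value_of y (\<lambda>i. 0)} \<longleftrightarrow> (\<forall>c\<in>K. F.value_of y c = F.value_of y (\<lambda>i. 0))"
    by blast
  then show ?thesis
    unfolding nondegenerate_def form_radical_fibre[OF y] F.fibre_zero[OF y] F.value_of_eq_iff[OF y]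
    by (simp add: K_def)
qed

end

section \<open>The Gram matrix of a form whose adjoint has a cokernel of length one\<close>

lemma choice_lt: "(\<And>j::nat. j < r \<Longrightarrow> \<exists>y. P j y) \<Longrightarrow> \<exists>a. \<forall>j<r. P j (a j)"
proof (intro exI allI impI)
  assume ex: "\<And>j::nat. j < r \<Longrightarrow> \<exists>y. P j y"
  show "P j (SOME y. P j y)" if "j < r" for j
    by (rule someI_ex[OF ex[OF that]])
qed

locale length_one_form = form_coords A F r U \<kappa> M \<mu> \<psi>
  for A :: "('a::t2_space) chart set" and F r U \<kappa> M \<mu> \<psi> +
  fixes x :: 'a and q
  assumes exact: "short_exact A F (hom_sheaf A F M) (skyscraper x complex_line) (adjoint_map F \<psi>) q"
    and symmetric: "symmetric_form F \<psi>"
begin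

sublocale H: local_coords A "hom_sheaf A F M" r U hom_coord
  by (rule hom_coords)

lemma gram_symmetric: "gram i j p = gram j i p"
proof -
  have "\<psi> U (F.unit_section U i) (F.unit_section U j) = \<psi> U (F.unit_section U j) (F.unit_section U i)"
    using symmetric F.unit_section_in[OF F.open_domain order_refl] F.open_domain
    unfolding symmetric_form_def by blast
  then show ?thesis by (simp only: gram_def)
qed

lemma adjoint_in: "open V \<Longrightarrow> s \<in> sec F V \<Longrightarrow> adjoint_map F \<psi> V s \<in> sec (hom_sheaf A F M) V"
  using module_hom_closed[OF sheaf_hom_module_hom[OF short_exact_hom(1)[OF exact]]] by blast

lemma adjoint_coord:
  assumes "open V" "V \<subseteq> U" "s \<in> sec F V" "p \<in> V"
  shows "hom_coord V (adjoint_map F \<psi> V s) j p = (\<Sum>i<r. \<kappa> V s i p * gram i j p)"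
proof -
  have "adjoint_map F \<psi> V s V (F.unit_section V j) = \<psi> V s (F.unit_section V j)"
    using assms(1,3) F.unit_section_in[OF assms(1,2)]
    by (simp add: adjoint_map_def opens_in_def F.restr_id)
  then show ?thesis
    unfolding hom_coord_def by (simp only: form_unit_right[OF assms])
qed

text \<open>Injectivity of the adjoint in matrix form. An identity over a whole open set determines
  \<open>a\<close> even at a point where the Gram matrix is singular, since the two sections with
  coordinates \<open>a\<close> and 0 coincide.\<close>

lemma gram_mult_inj:
  assumes V: "open V" "V \<subseteq> U"
    and a: "\<And>i. i < r \<Longrightarrow> holomorphic_fun A V (a i)"
    and zero: "\<And>j p. j < r \<Longrightarrow> p \<in> V \<Longrightarrow> (\<Sum>i<r. a i p * gram i j p) = 0"
    and i: "i < r" and p: "p \<in> V"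
  shows "a i p = 0"
proof -
  let ?a = "F.of_coords V a" and ?z = "F.of_coords V (\<lambda>i p. 0)"
  have a_in: "?a \<in> sec F V" and z_in: "?z \<in> sec F V"
    by (intro F.of_coords_in V a holomorphic_fun_const; assumption)+
  have ca: "\<kappa> V ?a i p = a i p" and cz: "\<kappa> V ?z i p = 0" if "i < r" "p \<in> V" for i p
    by (intro F.coord_of_coords[of _ a, OF V a] F.coord_of_coords[OF V holomorphic_fun_const] that; assumption)+
  have "adjoint_map F \<psi> V ?a = adjoint_map F \<psi> V ?z"
  proof (rule H.coord_inj[OF V adjoint_in[OF V(1) a_in] adjoint_in[OF V(1) z_in]])
    fix j p assume jp: "j < r" "p \<in> V"
    have "(\<Sum>i<r. \<kappa> V ?a i p * gram i j p) = (\<Sum>i<r. a i p * gram i j p)"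
      by (intro sum.cong) (simp_all add: ca jp)
    moreover have "(\<Sum>i<r. \<kappa> V ?z i p * gram i j p) = 0"
      by (intro sum.neutral) (simp add: cz jp)
    ultimately show "hom_coord V (adjoint_map F \<psi> V ?a) j p = hom_coord V (adjoint_map F \<psi> V ?z) j p"
      unfolding adjoint_coord[OF V a_in jp(2)] adjoint_coord[OF V z_in jp(2)] using zero[OF jp] by simp
  qed
  then have "?a = ?z"
    using short_exact_inj[OF exact V(1)] a_in z_in by (meson inj_onD)
  then show ?thesis
    using ca[OF i p] cz[OF i p] by simp
qed

text \<open>The numbers \<lambda>_j. The skyscraper sheaf is modelled on
  \<open>complex_line\<close>, so the values of \<open>q\<close> are complex numbers.\<close>

definition coker_coeff :: "nat \<Rightarrow> complex" where
  "coker_coeff j = q U (H.unit_section U j)"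

lemma coker_hom:
  "open V \<Longrightarrow> q V \<in> module_hom (structure_sheaf A V) (sections (hom_sheaf A F M) V) (sections (skyscraper x complex_line) V)"
  by (rule sheaf_hom_module_hom[OF short_exact_hom(2)[OF exact]])

text \<open>Functions act on the skyscraper sheaf through their value at \<open>x\<close>, so
  \<open>q\<close> depends only on the row of \<open>h\<close> at \<open>x\<close>.\<close>

lemma coker_expansion:
  assumes V: "open V" "V \<subseteq> U" "x \<in> V" and h: "h \<in> sec (hom_sheaf A F M) V"
  shows "q V h = (\<Sum>j<r. hom_coord V h j x * coker_coeff j)"
proof -
  note hom = coker_hom[OF V(1)]
  have "q V h = (\<Sum>j<r. hom_coord V h j x * q V (H.unit_section V j))"
    using V h module_hom_add[OF hom] module_hom_smult[OF hom]
    by (intro H.coord_expansion) (auto simp: skyscraper_def complex_line_def)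
  moreover have "q V (H.unit_section V j) = coker_coeff j" for j
  proof -
    have "q V (restr (hom_sheaf A F M) U V (H.unit_section U j)) = restr (skyscraper x complex_line) U V (q U (H.unit_section U j))"
      by (rule sheaf_hom_restr[OF short_exact_hom(2)[OF exact] F.open_domain V(1,2)
            H.unit_section_in[OF F.open_domain order_refl]])
    then show ?thesis
      using V F.open_domain by (simp add: H.restr_unit_section coker_coeff_def skyscraper_def)
  qed
  ultimately show ?thesis by simp
qed

text \<open>Otherwise \<open>q\<close> would vanish over every neighbourhood of \<open>x\<close>
  inside \<open>U\<close>, whereas surjectivity requires it to take the value 1 over some of
  them.\<close>

lemma coker_coeff_nonzero:
  assumes "x \<in> U"
  shows "\<exists>j<r. coker_coeff j \<noteq> 0"
proof -
  have one: "1 \<in> sec (skyscraper x complex_line) U"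
    using assms by (simp add: skyscraper_def complex_line_def)
  obtain W where W: "open W" "x \<in> W" "W \<subseteq> U"
    and "restr (skyscraper x complex_line) U W 1 \<in> q W ` sec (hom_sheaf A F M) W"
    using short_exact_surj[OF exact F.open_domain one assms] by (elim exE conjE)
  then obtain h where h: "h \<in> sec (hom_sheaf A F M) W" "q W h = restr (skyscraper x complex_line) U W 1"
    by (elim imageE) simp
  then have q1: "q W h = 1"
    using W(2) by (simp add: skyscraper_def)
  show ?thesis
  proof (rule ccontr)
    assume "\<not> ?thesis"
    then have "(\<Sum>j<r. hom_coord W h j x * coker_coeff j) = 0"
      by (intro sum.neutral) auto
    with coker_expansion[OF W(1,3,2) h(1)] q1 show False by simp
  qed
qed

lemma coker_zero_iff:
  assumes V: "open V" and h: "h \<in> sec (hom_sheaf A F M) V"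
  shows "q V h = \<zero>\<^bsub>sections (skyscraper x complex_line) V\<^esub> \<longleftrightarrow> (\<forall>y\<in>V. \<exists>W. open W \<and> y \<in> W \<and> W \<subseteq> V \<and>
    restr (hom_sheaf A F M) V W h \<in> adjoint_map F \<psi> W ` sec F W)"
  by (rule short_exact_kernel[OF exact V h])

text \<open>Exactness in the middle: the row \<open>a\<close> is locally of the form g^T B as soon
  as \<open>q\<close> kills it. Off \<open>x\<close> the skyscraper has only the zero section, so
  the condition is vacuous there. Images of sheaf maps are local, hence the passage to a smaller
  \<open>W\<close>.\<close>

lemma gram_mult_surj:
  assumes V: "open V" "V \<subseteq> U" "y \<in> V"
    and a: "\<And>j. j < r \<Longrightarrow> holomorphic_fun A V (a j)"
    and ax: "x \<in> V \<Longrightarrow> (\<Sum>j<r. a j x * coker_coeff j) = 0"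
  shows "\<exists>W s. open W \<and> y \<in> W \<and> W \<subseteq> V \<and> s \<in> sec F W \<and>
    (\<forall>j<r. \<forall>p\<in>W. (\<Sum>i<r. \<kappa> W s i p * gram i j p) = a j p)"
proof -
  let ?h = "H.of_coords V a"
  have h_in: "?h \<in> sec (hom_sheaf A F M) V"
    by (rule H.of_coords_in[OF V(1,2)]) (rule a)
  have ch: "hom_coord V ?h j p = a j p" if "j < r" "p \<in> V" for j p
    by (rule H.coord_of_coords[OF V(1,2) _ that]) (rule a)
  have "q V ?h = \<zero>\<^bsub>sections (skyscraper x complex_line) V\<^esub>"
  proof (cases "x \<in> V")
    case True
    have "q V ?h = (\<Sum>j<r. a j x * coker_coeff j)"
      unfolding coker_expansion[OF V(1,2) True h_in]
      by (intro sum.cong refl) (simp add: ch True)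
    then show ?thesis
      using ax True by (simp add: skyscraper_def complex_line_def)
  next
    case False
    have "q V ?h \<in> carrier (sections (skyscraper x complex_line) V)"
      using module_hom_closed[OF coker_hom[OF V(1)]] h_in by blast
    with False show ?thesis by (simp add: skyscraper_def)
  qed
  then have "\<exists>W. open W \<and> y \<in> W \<and> W \<subseteq> V \<and> restr (hom_sheaf A F M) V W ?h \<in> adjoint_map F \<psi> W ` sec F W"
    using coker_zero_iff[OF V(1) h_in] V(3) by simp
  then obtain W s where W: "open W" "y \<in> W" "W \<subseteq> V"
    and s: "s \<in> sec F W" "restr (hom_sheaf A F M) V W ?h = adjoint_map F \<psi> W s"
    by (elim exE conjE imageE)
  have WU: "W \<subseteq> U" using W V by blast
  have "(\<Sum>i<r. \<kappa> W s i p * gram i j p) = a j p" if "j < r" "p \<in> W" for j p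
  proof -
    have pV: "p \<in> V" using that W by blast
    have "(\<Sum>i<r. \<kappa> W s i p * gram i j p) = hom_coord W (restr (hom_sheaf A F M) V W ?h) j p"
      unfolding s(2) by (rule adjoint_coord[OF W(1) WU s(1) that(2), symmetric])
    also have "\<dots> = hom_coord V ?h j p"
      by (rule H.coord_restr[OF V(1,2) W(1,3) h_in that])
    also have "\<dots> = a j p"
      by (rule ch[OF that(1) pV])
    finally show ?thesis .
  qed
  with W s(1) show ?thesis
    by (intro exI[of _ W] exI[of _ s]) simp
qed

text \<open>If \<open>c\<^sup>T B = \<zeta> h\<close> and \<open>h\<close> lies in the image of the adjoint, \<open>h = g\<^sup>T B\<close>, then \<open>c = \<zeta> g\<close>
  vanishes at the zero of \<open>\<zeta>\<close>.\<close>

lemma constant_zero_if_divisible: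
  assumes V: "open V" "V \<subseteq> U" "y \<in> V" and \<zeta>: "holomorphic_fun A V \<zeta>" "\<zeta> y = 0"
    and a: "\<And>j. j < r \<Longrightarrow> holomorphic_fun A V (a j)"
    and ax: "x \<in> V \<Longrightarrow> (\<Sum>j<r. a j x * coker_coeff j) = 0"
    and eq: "\<And>j p. j < r \<Longrightarrow> p \<in> V \<Longrightarrow> (\<Sum>i<r. c i * gram i j p) = \<zeta> p * a j p"
    and i: "i < r"
  shows "c i = 0"
proof -
  have "\<exists>W s. open W \<and> y \<in> W \<and> W \<subseteq> V \<and> s \<in> sec F W \<and>
      (\<forall>j<r. \<forall>p\<in>W. (\<Sum>i<r. \<kappa> W s i p * gram i j p) = a j p)"
    by (rule gram_mult_surj[OF V]) (fact a, fact ax)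
  then obtain W s where W: "open W" "y \<in> W" "W \<subseteq> V" and s: "s \<in> sec F W"
    and g: "\<forall>j<r. \<forall>p\<in>W. (\<Sum>i<r. \<kappa> W s i p * gram i j p) = a j p"
    by (elim exE conjE)
  have WU: "W \<subseteq> U" using W V by blast
  have "c i - \<zeta> y * \<kappa> W s i y = 0"
  proof (rule gram_mult_inj[OF W(1) WU _ _ i W(2)])
    show "holomorphic_fun A W (\<lambda>p. c i - \<zeta> p * \<kappa> W s i p)" if "i < r" for i
      using holomorphic_fun_subset[OF \<zeta>(1) W(3)] F.coord_holomorphic[OF W(1) WU s that]
      by (intro holomorphic_fun_intros)
    fix j p assume jp: "j < r" "p \<in> W"
    have "(\<Sum>i<r. (c i - \<zeta> p * \<kappa> W s i p) * gram i j p) =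
      (\<Sum>i<r. c i * gram i j p) - \<zeta> p * (\<Sum>i<r. \<kappa> W s i p * gram i j p)"
      by (simp add: left_diff_distrib sum_subtractf sum_distrib_left mult.assoc)
    then show "(\<Sum>i<r. (c i - \<zeta> p * \<kappa> W s i p) * gram i j p) = 0"
      using g eq[OF jp(1)] jp W(3) by auto
  qed
  with \<zeta>(2) show ?thesis by simp
qed

text \<open>Extending the kernel vector \<open>c\<close> by constant coordinates gives a row c^T B
  of holomorphic functions, all of which vanish at \<open>y\<close> and are therefore divisible by
  the parameter.\<close>

lemma divide_kernel_vector:
  assumes \<zeta>: "local_parameter A y V \<zeta>" "V \<subseteq> U" and c: "\<forall>j<r. (\<Sum>i<r. c i * gram i j y) = 0"
  shows "\<exists>a. \<forall>j<r. holomorphic_fun A V (a j) \<and> (\<forall>p\<in>V. (\<Sum>i<r. c i * gram i j p) = \<zeta> p * a j p)"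
proof -
  have "\<exists>g. holomorphic_fun A V g \<and> (\<forall>p\<in>V. (\<Sum>i<r. c i * gram i j p) = \<zeta> p * g p)" if "j < r" for j
  proof -
    have "holomorphic_fun A V (\<lambda>p. \<Sum>i<r. c i * gram i j p)"
      using that holomorphic_fun_subset[OF gram_holomorphic \<zeta>(2)] by (intro holomorphic_fun_intros) auto
    then show ?thesis
      using local_parameter_divide[OF \<zeta>(1) local_parameter_open[OF \<zeta>(1)]] c that by simp
  qed
  then show ?thesis by (intro choice_lt)
qed

text \<open>The argument at \<open>x\<close> applies with a parameter at \<open>y\<close>, and now
  there is no obstruction because the adjoint is locally onto off \<open>x\<close>.\<close>

lemma gram_kernel_away:
  assumes y: "y \<in> U" "y \<noteq> x" and c: "\<forall>j<r. (\<Sum>i<r. c i * gram i j y) = 0" and i: "i < r"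
  shows "c i = 0"
proof -
  obtain W \<zeta> where W: "y \<in> W" "local_parameter A y W \<zeta>"
    using exists_local_parameter[OF F.surface] by blast
  \<comment> \<open>Removing \<open>x\<close> makes the condition of
    \<open>constant_zero_if_divisible\<close> on the skyscraper vacuous.\<close>
  define V where "V = (W \<inter> U) - {x}"
  have V: "open V" "V \<subseteq> U" "y \<in> V" "V \<subseteq> W" "x \<notin> V"
    using W y F.open_domain local_parameter_open[OF W(2)] by (auto simp: V_def)
  have \<zeta>: "local_parameter A y V \<zeta>"
    by (rule local_parameter_subset[OF W(2) V(1,4)])
  then have \<zeta>': "holomorphic_fun A V \<zeta>" "\<zeta> y = 0"
    using local_parameter_holomorphic local_parameter_zero_iff V(3) by blast+
  obtain a where "\<forall>j<r. holomorphic_fun A V (a j) \<and> (\<forall>p\<in>V. (\<Sum>i<r. c i * gram i j p) = \<zeta> p * a j p)"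
    using divide_kernel_vector[OF \<zeta> V(2) c] by (elim exE)
  then have a: "\<And>j. j < r \<Longrightarrow> holomorphic_fun A V (a j)"
      "\<And>j p. j < r \<Longrightarrow> p \<in> V \<Longrightarrow> (\<Sum>i<r. c i * gram i j p) = \<zeta> p * a j p"
    by simp_all
  show ?thesis
  proof (rule constant_zero_if_divisible[OF V(1-3) \<zeta>' _ _ _ i])
    show "(\<Sum>j<r. a j x * coker_coeff j) = 0" if "x \<in> V"
      using that V(5) by contradiction
  qed (fact a)+
qed

text \<open>The composite of the adjoint with \<open>q\<close> is 0; on the unit sections this says
  B \<lambda> = 0 at \<open>x\<close>. Symmetry of B turns this into the left kernel.\<close>

lemma gram_coker_coeff:
  assumes x: "x \<in> U" and j: "j < r"
  shows "(\<Sum>i<r. coker_coeff i * gram i j x) = 0"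
proof -
  let ?s = "F.unit_section U j"
  have s: "?s \<in> sec F U" by (rule F.unit_section_in[OF F.open_domain order_refl])
  note ad = adjoint_in[OF F.open_domain s]
  have "restr (hom_sheaf A F M) U U (adjoint_map F \<psi> U ?s) = adjoint_map F \<psi> U ?s"
    by (simp add: hom_sheaf_def adjoint_map_def)
  then have "q U (adjoint_map F \<psi> U ?s) = \<zero>\<^bsub>sections (skyscraper x complex_line) U\<^esub>"
    unfolding coker_zero_iff[OF F.open_domain ad]
    by (intro ballI exI[of _ U] conjI) (use s F.open_domain in simp_all)
  then have "(\<Sum>k<r. (\<Sum>i<r. \<kappa> U ?s i x * gram i k x) * coker_coeff k) = 0"
    unfolding coker_expansion[OF F.open_domain order_refl x ad]
      adjoint_coord[OF F.open_domain order_refl s x]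
    by (simp add: skyscraper_def complex_line_def)
  moreover have "(\<Sum>i<r. \<kappa> U ?s i x * gram i k x) = gram j k x" for k
  proof -
    have "(\<Sum>i<r. \<kappa> U ?s i x * gram i k x) = (\<Sum>i<r. if i = j then gram i k x else 0)"
      using x F.open_domain by (intro sum.cong) (auto simp: F.coord_unit_section)
    with j show ?thesis by simp
  qed
  ultimately show ?thesis
    using gram_symmetric[of j] by (simp add: mult.commute)
qed

text \<open>The vector \<open>l\<close> is \<lambda>. Both remaining claims come from
  \<open>constant_zero_if_divisible\<close>, whose condition at \<open>x\<close> is the vanishing of
  one number: it cannot vanish for \<lambda> itself, and for any other kernel vector it can be made
  to vanish.\<close>

lemma gram_kernel_at:
  assumes x: "x \<in> U" and \<zeta>: "local_parameter A x U \<zeta>"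
  shows "\<exists>l. (\<exists>i<r. l i \<noteq> 0) \<and>
    (\<forall>c. (\<forall>j<r. (\<Sum>i<r. c i * gram i j x) = 0) \<longleftrightarrow> (\<exists>a. \<forall>i<r. c i = a * l i)) \<and>
    (\<exists>u. holomorphic_fun A U u \<and> u x \<noteq> 0 \<and>
      (\<forall>p\<in>U. (\<Sum>j<r. (\<Sum>i<r. l i * gram i j p) * l j) = \<zeta> p * u p))"
proof -
  let ?l = coker_coeff
  have \<zeta>': "holomorphic_fun A U \<zeta>" "\<zeta> x = 0"
    using local_parameter_holomorphic[OF \<zeta>] local_parameter_zero_iff[OF \<zeta> x] by simp_all
  have kl: "\<forall>j<r. (\<Sum>i<r. ?l i * gram i j x) = 0"
    using gram_coker_coeff[OF x] by simp
  obtain b where "\<forall>j<r. holomorphic_fun A U (b j) \<and> (\<forall>p\<in>U. (\<Sum>i<r. ?l i * gram i j p) = \<zeta> p * b j p)"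
    using divide_kernel_vector[OF \<zeta> order_refl kl] by (elim exE)
  then have b: "\<And>j. j < r \<Longrightarrow> holomorphic_fun A U (b j)"
      "\<And>j p. j < r \<Longrightarrow> p \<in> U \<Longrightarrow> (\<Sum>i<r. ?l i * gram i j p) = \<zeta> p * b j p"
    by simp_all
  define u where "u p = (\<Sum>j<r. b j p * ?l j)" for p
  have u: "holomorphic_fun A U u"
    unfolding u_def using b(1) by (intro holomorphic_fun_intros) auto
  have l: "\<exists>i<r. ?l i \<noteq> 0"
    by (rule coker_coeff_nonzero[OF x])
  \<comment> \<open>The value \<open>u x\<close> is the obstruction for the vector \<lambda>; were
    it 0, \<lambda> would be 0.\<close>
  have ux: "u x \<noteq> 0"
  proof
    assume "u x = 0"
    have "?l i = 0" if "i < r" for i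
    proof (rule constant_zero_if_divisible[OF F.open_domain order_refl x \<zeta>' _ _ _ that])
      show "(\<Sum>j<r. b j x * ?l j) = 0"
        using \<open>u x = 0\<close> by (simp add: u_def)
    qed (fact b)+
    with l show False by blast
  qed
  have "(\<Sum>j<r. (\<Sum>i<r. ?l i * gram i j p) * ?l j) = \<zeta> p * u p" if "p \<in> U" for p
    using that by (simp add: b(2) u_def sum_distrib_left mult.assoc)
  moreover have "(\<forall>j<r. (\<Sum>i<r. c i * gram i j x) = 0) \<longleftrightarrow> (\<exists>t. \<forall>i<r. c i = t * ?l i)" for c
  proof
    assume c: "\<forall>j<r. (\<Sum>i<r. c i * gram i j x) = 0"
    obtain a where "\<forall>j<r. holomorphic_fun A U (a j) \<and> (\<forall>p\<in>U. (\<Sum>i<r. c i * gram i j p) = \<zeta> p * a j p)"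
      using divide_kernel_vector[OF \<zeta> order_refl c] by (elim exE)
    then have a: "\<And>j. j < r \<Longrightarrow> holomorphic_fun A U (a j)"
        "\<And>j p. j < r \<Longrightarrow> p \<in> U \<Longrightarrow> (\<Sum>i<r. c i * gram i j p) = \<zeta> p * a j p"
      by simp_all
    \<comment> \<open>The multiple of \<lambda> whose obstruction equals that of \<open>c\<close>,
      so that the difference has none.\<close>
    define t where "t = (\<Sum>j<r. a j x * ?l j) / u x"
    have "c i - t * ?l i = 0" if "i < r" for i
    proof (rule constant_zero_if_divisible[where a = "\<lambda>j p. a j p - t * b j p", OF F.open_domain order_refl x \<zeta>' _ _ _ that])
      show "holomorphic_fun A U (\<lambda>p. a j p - t * b j p)" if "j < r" for j
        using a(1)[OF that] b(1)[OF that] by (intro holomorphic_fun_intros)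
      have "(\<Sum>j<r. (a j x - t * b j x) * ?l j) = (\<Sum>j<r. a j x * ?l j) - t * u x"
        by (simp add: left_diff_distrib sum_subtractf u_def sum_distrib_left mult.assoc)
      then show "(\<Sum>j<r. (a j x - t * b j x) * ?l j) = 0"
        using ux by (simp add: t_def)
      fix j p assume jp: "j < r" "p \<in> U"
      have "(\<Sum>i<r. (c i - t * ?l i) * gram i j p) = (\<Sum>i<r. c i * gram i j p) - t * (\<Sum>i<r. ?l i * gram i j p)"
        by (simp add: left_diff_distrib sum_subtractf sum_distrib_left mult.assoc)
      then show "(\<Sum>i<r. (c i - t * ?l i) * gram i j p) = \<zeta> p * (a j p - t * b j p)"
        using a(2)[OF jp] b(2)[OF jp] by (simp add: algebra_simps)
    qed
    then show "\<exists>t. \<forall>i<r. c i = t * ?l i" by auto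
  next
    assume "\<exists>t. \<forall>i<r. c i = t * ?l i"
    then obtain t where t: "\<And>i. i < r \<Longrightarrow> c i = t * ?l i" by blast
    have "(\<Sum>i<r. c i * gram i j x) = t * (\<Sum>i<r. ?l i * gram i j x)" for j
      by (simp add: t sum_distrib_left mult.assoc cong: sum.cong_simp)
    then show "\<forall>j<r. (\<Sum>i<r. c i * gram i j x) = 0"
      by (simp add: kl)
  qed
  ultimately show ?thesis
    by (intro exI[of _ ?l] conjI exI[of _ u] allI ballI l u ux)
qed

end

section \<open>Linear algebra\<close>

lemma inverse_matrix_sum:
  fixes Q Q' :: "nat \<Rightarrow> nat \<Rightarrow> complex"
  assumes inv: "\<forall>i<r. \<forall>j<r. (\<Sum>m<r. Q i m * Q' m j) = (if i = j then 1 else 0)" and i: "i < r"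
  shows "(\<Sum>m<r. Q i m * (\<Sum>j<r. Q' m j * c j)) = c i"
proof -
  have "(\<Sum>m<r. Q i m * (\<Sum>j<r. Q' m j * c j)) = (\<Sum>m<r. \<Sum>j<r. Q i m * Q' m j * c j)"
    by (simp add: sum_distrib_left mult.assoc)
  also have "\<dots> = (\<Sum>j<r. (\<Sum>m<r. Q i m * Q' m j) * c j)"
    by (subst sum.swap) (simp add: sum_distrib_right)
  also have "\<dots> = (\<Sum>j<r. if j = i then c j else 0)"
    using inv i by (intro sum.cong) auto
  finally show ?thesis using i by simp
qed

text \<open>For a square matrix, trivial left and right kernels both mean a nonzero determinant, and
  transposition preserves the determinant.\<close>

lemma nondegenerate_transpose:
  fixes D :: "nat \<Rightarrow> nat \<Rightarrow> complex"
  assumes "\<And>u. (\<And>j. j < n \<Longrightarrow> (\<Sum>i<n. u i * D i j) = 0) \<Longrightarrow> (\<And>i. i < n \<Longrightarrow> u i = 0)"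
    and v: "\<And>i. i < n \<Longrightarrow> (\<Sum>j<n. D i j * v j) = 0" and j: "j < n"
  shows "v j = 0"
proof -
  define N where "N = mat n n (\<lambda>(i, j). D i j)"
  have N: "N \<in> carrier_mat n n" "N\<^sup>T \<in> carrier_mat n n"
    by (simp_all add: N_def)
  have "det N\<^sup>T \<noteq> 0"
  proof
    assume "det N\<^sup>T = 0"
    then obtain w where w: "w \<in> carrier_vec n" "w \<noteq> 0\<^sub>v n" "N\<^sup>T *\<^sub>v w = 0\<^sub>v n"
      using det_0_iff_vec_prod_zero[OF N(2)] by blast
    have "(\<Sum>i<n. w $ i * D i j) = 0" if "j < n" for j
    proof -
      have "(N\<^sup>T *\<^sub>v w) $ j = (\<Sum>i<n. w $ i * D i j)"
        using that w(1) by (simp add: N_def scalar_prod_def mult.commute lessThan_atLeast0)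
      with w(3) that show ?thesis by simp
    qed
    then have "w $ i = 0" if "i < n" for i
      using assms(1)[of "\<lambda>i. w $ i"] that by blast
    then have "w = 0\<^sub>v n"
      using w(1) by (intro eq_vecI) auto
    with w(2) show False by contradiction
  qed
  then have *: "det N \<noteq> 0"
    using det_transpose[OF N(1)] by simp
  have "(N *\<^sub>v vec n v) $ i = 0" if "i < n" for i
    using that v by (simp add: N_def scalar_prod_def lessThan_atLeast0)
  then have "N *\<^sub>v vec n v = 0\<^sub>v n"
    using N by (intro eq_vecI) auto
  with * have "vec n v = 0\<^sub>v n"
    using det_0_iff_vec_prod_zero[OF N(1)] vec_carrier by blast
  then show ?thesis
    using j by (metis index_vec index_zero_vec(1))
qed

text \<open>Vectors are functions that vanish from \<^term>\<open>r\<close> on.  The columns of \<^term>\<open>P\<close> form a basis whose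
  first \<^term>\<open>k\<close> members span \<^term>\<open>W\<close>.\<close>

lemma adapted_basis:
  fixes W :: "(nat \<Rightarrow> complex) set"
  assumes W: "W \<subseteq> {f. \<forall>i\<ge>r. f i = 0}"
    and add: "\<And>f g. f \<in> W \<Longrightarrow> g \<in> W \<Longrightarrow> (\<lambda>i. f i + g i) \<in> W"
    and scale: "\<And>a f. f \<in> W \<Longrightarrow> (\<lambda>i. a * f i) \<in> W"
    and l: "l \<in> W" "l \<noteq> (\<lambda>i. 0)"
  shows "\<exists>k P R. 1 \<le> k \<and> k \<le> r \<and>
    (\<forall>i<r. \<forall>j<r. (\<Sum>m<r. P i m * R m j) = (if i = j then 1 else 0)) \<and>
    (\<forall>i<r. \<forall>j<r. (\<Sum>m<r. R i m * P m j) = (if i = j then 1 else 0)) \<and>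
    (\<forall>i<r. P i 0 = l i) \<and>
    (\<forall>c. (\<forall>i\<ge>r. c i = 0) \<longrightarrow> (c \<in> W \<longleftrightarrow> (\<forall>m. k \<le> m \<and> m < r \<longrightarrow> (\<Sum>j<r. R m j * c j) = 0)))"
proof -
  \<comment> \<open>Pointwise scaling, together with pointwise addition of functions, gives an
    instance of \<open>vector_space\<close>, whose results on extending bases are used
    below.\<close>
  define sc where "sc a f = (\<lambda>i. a * f i)" for a :: complex and f :: "nat \<Rightarrow> complex"
  interpret V: vector_space sc
    by unfold_locales (auto simp: sc_def algebra_simps)
  define C where "C = {f :: nat \<Rightarrow> complex. \<forall>i\<ge>r. f i = 0}"
  define e where "e i = (\<lambda>j. if j = i then 1 else 0 :: complex)" for i :: nat
  have ap: "sum f I j = (\<Sum>i\<in>I. f i j)" for f :: "'b \<Rightarrow> nat \<Rightarrow> complex" and I j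
    by (induction I rule: infinite_finite_induct) auto
  have e_exp: "c = (\<Sum>j<r. sc (c j) (e j))" if "c \<in> C" for c
  proof
    fix i
    have "(\<Sum>j<r. c j * e j i) = (\<Sum>j<r. if j = i then c j else 0)"
      by (intro sum.cong) (auto simp: e_def)
    then show "c i = (\<Sum>j<r. sc (c j) (e j)) i"
      using that by (auto simp: ap sc_def C_def)
  qed
  have e_C: "e i \<in> C" if "i < r" for i
    using that by (auto simp: e_def C_def)
  have C_sub: "V.subspace C"
    by (auto simp: V.subspace_def C_def sc_def)
  have C_span: "C \<subseteq> V.span (e ` {..<r})"
  proof
    fix c assume "c \<in> C"
    have "(\<Sum>j<r. sc (c j) (e j)) \<in> V.span (e ` {..<r})"
      by (intro V.span_sum V.span_scale V.span_base) auto
    then show "c \<in> V.span (e ` {..<r})"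
      using e_exp[OF \<open>c \<in> C\<close>] by simp
  qed
  have inj_e: "inj_on e {..<r}"
    by (rule inj_onI) (metis e_def zero_neq_one)
  have indep_e: "V.independent (e ` {..<r})"
  proof (rule V.independent_if_scalars_zero)
    fix f v assume s: "(\<Sum>x\<in>e ` {..<r}. sc (f x) x) = 0" and v: "v \<in> e ` {..<r}"
    then obtain i where i: "i < r" "v = e i" by auto
    have "0 = (\<Sum>j<r. sc (f (e j)) (e j)) i"
      using s by (simp add: sum.reindex inj_e)
    also have "\<dots> = (\<Sum>j<r. if j = i then f (e j) else 0)"
      unfolding ap by (intro sum.cong) (auto simp: sc_def e_def)
    finally show "f v = 0" using i by simp
  qed simp
  have dim_C: "V.dim C = r"
    by (rule V.dim_unique[OF _ C_span indep_e]) (auto simp: e_C card_image inj_e)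
  have W_sub: "V.subspace W"
    unfolding V.subspace_def using l(1) scale[OF l(1), of 0] add scale by (auto simp: sc_def zero_fun_def plus_fun_def)
  have "V.independent {l}"
    using l(2) by (simp add: zero_fun_def)
  then obtain B0 where B0: "{l} \<subseteq> B0" "B0 \<subseteq> W" "V.independent B0" "W \<subseteq> V.span B0"
    using l(1) V.maximal_independent_subset_extend[of "{l}" W] by blast
  have WC: "W \<subseteq> C" using W by (simp add: C_def)
  obtain B where B: "B0 \<subseteq> B" "B \<subseteq> C" "V.independent B" "C \<subseteq> V.span B"
    using V.maximal_independent_subset_extend[OF order_trans[OF B0(2) WC] B0(3)] by metis
  have card_B: "card B = r"
    using V.basis_card_eq_dim[OF B(2,4,3)] dim_C by simp
  have fin_B: "finite B"
    using V.independent_span_bound[OF _ B(3), of "e ` {..<r}"] B(2) C_span by auto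
  have spanB0: "V.span B0 = W"
    using V.span_minimal[OF B0(2) W_sub] B0(4) by blast
  obtain xs1 where xs1: "set xs1 = B0 - {l}" "distinct xs1"
    using finite_distinct_list[of "B0 - {l}"] fin_B B(1) finite_subset by blast
  obtain xs2 where xs2: "set xs2 = B - B0" "distinct xs2"
    using finite_distinct_list[of "B - B0"] fin_B by blast
  \<comment> \<open>The order of the basis is what makes it adapted: first \<open>l\<close>, then
    the rest of a basis of \<open>W\<close>, then the remaining vectors. Thus \<open>k\<close> is
    the dimension of \<open>W\<close>.\<close>
  define xs where "xs = l # xs1 @ xs2"
  define k where "k = Suc (length xs1)"
  define p where "p m = xs ! m" for m
  have xs: "distinct xs" "set xs = B"
    using xs1 xs2 B0(1) B(1) by (auto simp: xs_def)
  have len: "length xs = r"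
    using distinct_card[OF xs(1)] xs(2) card_B by simp
  have k: "1 \<le> k" "k \<le> r"
    using len by (auto simp: k_def xs_def)
  have pB: "bij_betw p {..<r} B"
    using bij_betw_nth[OF xs(1), of "{..<r}" B] len xs(2) by (simp add: p_def[abs_def])
  have p_less: "p m \<in> B0" if "m < k" for m
    using that xs1(1) B0(1) nth_mem[of "m - 1" xs1] by (cases m) (auto simp: p_def xs_def k_def nth_append)
  have p_ge: "p m \<in> B - B0" if "k \<le> m" "m < r" for m
  proof -
    have "p m = xs2 ! (m - k)"
      using that by (cases m) (auto simp: p_def xs_def k_def nth_append)
    moreover have "m - k < length xs2"
      using that len by (auto simp: xs_def k_def)
    ultimately show ?thesis
      using xs2(1) nth_mem by metis
  qed
  define P where "P i m = p m i" for i m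
  \<comment> \<open>Column \<open>j\<close> of \<open>R\<close> lists the coordinates of the
    standard vector \<open>e j\<close> in the new basis, so \<open>R\<close> is the inverse of the
    matrix \<open>P\<close> of basis columns.\<close>
  define R where "R m j = V.representation B (e j) (p m)" for m j
  have rep: "V.representation B c b = (\<Sum>j<r. c j * V.representation B (e j) b)" if "c \<in> C" for c b
  proof -
    have "V.representation B c b = V.representation B (\<Sum>j<r. sc (c j) (e j)) b"
      using e_exp[OF that] by simp
    also have "\<dots> = (\<Sum>j<r. V.representation B (sc (c j) (e j)) b)"
      using B(4) e_C by (subst V.representation_sum[OF B(3)]) (auto intro!: V.span_scale)
    also have "\<dots> = (\<Sum>j<r. c j * V.representation B (e j) b)"
      using B(4) e_C by (intro sum.cong) (auto simp: V.representation_scale[OF B(3)] subset_iff)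
    finally show ?thesis .
  qed
  have repR: "V.representation B c (p m) = (\<Sum>j<r. R m j * c j)" if "c \<in> C" for c m
    by (simp add: rep[OF that] R_def mult.commute)
  have expand: "c = (\<Sum>m<r. sc (V.representation B c (p m)) (p m))" if "c \<in> C" for c
  proof -
    have "c = (\<Sum>b\<in>B. sc (V.representation B c b) b)"
      using V.sum_representation_eq[OF B(3) _ fin_B order_refl] that B(4) by auto
    also have "\<dots> = (\<Sum>m<r. sc (V.representation B c (p m)) (p m))"
      by (rule sum.reindex_bij_betw[OF pB, symmetric])
    finally show ?thesis .
  qed
  have PR: "(\<Sum>m<r. P i m * R m j) = (if i = j then 1 else 0)" if "i < r" "j < r" for i j
    using fun_cong[OF expand[OF e_C[OF that(2)]], of i]
    by (simp add: ap sc_def P_def R_def e_def mult.commute)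
  have RP: "(\<Sum>m<r. R i m * P m j) = (if i = j then 1 else 0)" if "i < r" "j < r" for i j
  proof -
    have "p j \<in> B" using bij_betwE[OF pB] that by auto
    then have "(\<Sum>m<r. R i m * P m j) = V.representation B (p j) (p i)"
      using repR[of "p j" i] B(2) by (auto simp: P_def)
    also have "\<dots> = (if p i = p j then 1 else 0)"
      using \<open>p j \<in> B\<close> by (simp add: V.representation_basis[OF B(3)])
    also have "p i = p j \<longleftrightarrow> i = j"
      using bij_betw_imp_inj_on[OF pB] that by (auto dest: inj_onD)
    finally show ?thesis .
  qed
  have "c \<in> W \<longleftrightarrow> (\<forall>m. k \<le> m \<and> m < r \<longrightarrow> (\<Sum>j<r. R m j * c j) = 0)" if c: "\<forall>i\<ge>r. c i = 0" for c
  proof -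
    have cC: "c \<in> C" using c by (simp add: C_def)
    show ?thesis
      unfolding repR[OF cC, symmetric]
    proof
      assume "c \<in> W"
      \<comment> \<open>A vector in the span of \<open>B0\<close> has the same coefficients in
        \<open>B\<close> as in \<open>B0\<close>, so those at the basis vectors outside
        \<open>B0\<close> vanish.\<close>
      then have "V.representation B c = V.representation B0 c"
        using V.representation_extend[OF B(3) _ B(1)] spanB0 by auto
      then show "\<forall>m. k \<le> m \<and> m < r \<longrightarrow> V.representation B c (p m) = 0"
        using V.representation_ne_zero[of B0 c] p_ge by (metis DiffD2)
    next
      assume *: "\<forall>m. k \<le> m \<and> m < r \<longrightarrow> V.representation B c (p m) = 0"
      have "(\<Sum>m<r. sc (V.representation B c (p m)) (p m)) \<in> V.span B0"
      proof (rule V.span_sum)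
        fix m assume "m \<in> {..<r}"
        then show "sc (V.representation B c (p m)) (p m) \<in> V.span B0"
          using * p_less[of m] by (cases "m < k") (auto intro: V.span_scale V.span_base V.span_zero)
      qed
      with expand[OF cC] spanB0 show "c \<in> W" by simp
    qed
  qed
  moreover have "P i 0 = l i" for i
    by (simp add: P_def p_def xs_def)
  ultimately show ?thesis
    using k PR RP by (intro exI[of _ k] exI[of _ P] exI[of _ R]) simp
qed

text \<open>The three blocks will be the radical, the remaining directions of the isotropic
  subspace, and a complement.\<close>

lemma sum_split_middle:
  fixes f :: "nat \<Rightarrow> complex"
  shows "(\<Sum>i<2 * n + 1. f i) = f 0 + (\<Sum>i<n. f (Suc i)) + (\<Sum>i<n. f (Suc (n + i)))"
proof -
  have split: "(\<Sum>i<n + m. g i) = (\<Sum>i<n. g i) + (\<Sum>i<m. g (n + i))" for g :: "nat \<Rightarrow> complex" and n m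
    by (induction m) (simp_all add: add.assoc)
  have "(\<Sum>i<2 * n + 1. f i) = f 0 + (\<Sum>i<n + n. f (Suc i))"
    by (simp add: sum.lessThan_Suc_shift mult_2 One_nat_def del: sum.lessThan_Suc)
  also have "(\<Sum>i<n + n. f (Suc i)) = (\<Sum>i<n. f (Suc i)) + (\<Sum>i<n. f (Suc (n + i)))"
    using split[of "\<lambda>i. f (Suc i)" n n] by simp
  finally show ?thesis by (simp add: add.assoc)
qed

text \<open>In block form with blocks of sizes \<open>1, n, n\<close>, \<open>B\<close> has the only nonzero blocks \<open>D\<close>, \<open>D\<^sup>T\<close> and
  the lower right one, and \<open>C\<close> has a nonzero upper left entry, the blocks \<open>D\<close> and \<open>D\<^sup>T\<close>, zero entries
  in the lower right block and arbitrary ones elsewhere.\<close>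

lemma twisted_matrix_nondegenerate:
  fixes B C :: "nat \<Rightarrow> nat \<Rightarrow> complex"
  assumes sym: "\<And>i j. B i j = B j i"
    and iso: "\<And>i j. i \<le> n \<Longrightarrow> j \<le> n \<Longrightarrow> B i j = 0"
    and row0: "\<And>j. j < 2 * n + 1 \<Longrightarrow> B 0 j = 0"
    and ker: "\<And>c i. \<forall>j<2 * n + 1. (\<Sum>i<2 * n + 1. c i * B i j) = 0 \<Longrightarrow> 0 < i \<Longrightarrow> i < 2 * n + 1 \<Longrightarrow> c i = 0"
    and C: "\<And>i j. i \<le> n \<Longrightarrow> n < j \<Longrightarrow> j < 2 * n + 1 \<Longrightarrow> C i j = B i j"
      "\<And>i j. i \<le> n \<Longrightarrow> n < j \<Longrightarrow> j < 2 * n + 1 \<Longrightarrow> C j i = B j i"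
      "\<And>i j. n < i \<Longrightarrow> n < j \<Longrightarrow> i < 2 * n + 1 \<Longrightarrow> j < 2 * n + 1 \<Longrightarrow> C i j = 0"
      "C 0 0 \<noteq> 0"
    and c: "\<forall>j<2 * n + 1. (\<Sum>i<2 * n + 1. c i * C i j) = 0"
    and i: "i < 2 * n + 1"
  shows "c i = 0"
proof -
  define D where "D i j = B (Suc i) (Suc (n + j))" for i j
  \<comment> \<open>The left kernel of \<open>D\<close> is trivial: padding \<open>u\<close> with
    zeros gives a vector killed by \<open>B\<close>, in the columns up to \<open>n\<close> by
    isotropy and in the others by assumption. By \<open>ker\<close> only its entry 0 could be
    nonzero.\<close>
  have D: "u i = 0" if u: "\<And>j. j < n \<Longrightarrow> (\<Sum>i<n. u i * D i j) = 0" and i: "i < n" for u i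
  proof -
    define d where "d m = (if 1 \<le> m \<and> m \<le> n then u (m - 1) else 0)" for m
    have "(\<Sum>m<2 * n + 1. d m * B m j) = 0" if j: "j < 2 * n + 1" for j
    proof -
      have "(\<Sum>m<2 * n + 1. d m * B m j) = (\<Sum>m<n. u m * B (Suc m) j)"
        unfolding sum_split_middle by (simp add: d_def)
      also have "\<dots> = 0"
      proof (cases "j \<le> n")
        case True
        then show ?thesis by (intro sum.neutral) (simp add: iso)
      next
        case False
        then obtain j' where "j = Suc (n + j')" using less_iff_Suc_add[of n j] by auto
        with j u[of j'] show ?thesis by (simp add: D_def)
      qed
      finally show ?thesis .
    qed
    then have "d (Suc i) = 0"
      using ker[of d "Suc i"] i by simp
    then show ?thesis using i by (simp add: d_def)
  qed
  \<comment> \<open>The order of elimination matters. The columns of \<open>C\<close> beyond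
    \<open>n\<close> meet only \<open>D\<close> and kill the middle entries of \<open>c\<close>;
    column 0 then meets only the corner entry; columns 1 to \<open>n\<close> are finally left with
    the transpose of \<open>D\<close>.\<close>
  have mid: "c (Suc i) = 0" if "i < n" for i
  proof (rule D[OF _ that])
    fix j assume j: "j < n"
    have "0 = (\<Sum>i<2 * n + 1. c i * C i (Suc (n + j)))"
      using c j by simp
    also have "\<dots> = (\<Sum>i<n. c (Suc i) * D i j)"
      unfolding sum_split_middle using j by (simp add: C row0 D_def)
    finally show "(\<Sum>i<n. c (Suc i) * D i j) = 0" by simp
  qed
  have first: "c 0 = 0"
  proof -
    have "0 = (\<Sum>i<2 * n + 1. c i * C i 0)"
      using c by simp
    also have "\<dots> = c 0 * C 0 0"
      unfolding sum_split_middle by (simp add: C mid sym[of _ 0] row0)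
    finally show ?thesis using C(4) by simp
  qed
  have last: "c (Suc (n + i)) = 0" if "i < n" for i
  proof (rule nondegenerate_transpose[of n D "\<lambda>i. c (Suc (n + i))" i])
    show "i < n" by fact
    show "u i = 0" if "\<And>j. j < n \<Longrightarrow> (\<Sum>i<n. u i * D i j) = 0" "i < n" for u i
      using that by (rule D)
    fix j assume j: "j < n"
    have "0 = (\<Sum>i<2 * n + 1. c i * C i (Suc j))"
      using c j by simp
    also have "\<dots> = (\<Sum>i<n. D j i * c (Suc (n + i)))"
      unfolding sum_split_middle using j by (simp add: first mid C D_def sym[of _ "Suc j"] mult.commute)
    finally show "(\<Sum>i<n. D j i * c (Suc (n + i))) = 0" by simp
  qed
  consider "i = 0" | k where "i = Suc k" "k < n" | k where "i = Suc (n + k)" "k < n"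
  proof (cases "i \<le> n")
    case True
    then show thesis using that(1,2) by (cases i) auto
  next
    case False
    then obtain k where "i = Suc (n + k)" using less_iff_Suc_add[of n i] by auto
    then show thesis using that(3)[of k] i by simp
  qed
  then show ?thesis
    using first mid last by cases simp_all
qed

section \<open>Subsheaves and twists\<close>

text \<open>The new frame vectors have the columns of \<open>P\<close> as old coordinates, so the
  coordinates are multiplied by the inverse matrix \<open>R\<close>. All entries are constants,
  which keeps everything holomorphic.\<close>

lemma change_of_coords:
  assumes "local_coords A F r U \<kappa>"
    and PR: "\<forall>i<r. \<forall>j<r. (\<Sum>m<r. P i m * R m j) = (if i = j then 1 else 0)"
    and RP: "\<forall>i<r. \<forall>j<r. (\<Sum>m<r. R i m * P m j) = (if i = j then 1 else 0)"
  shows "local_coords A F r U (\<lambda>V s m p. \<Sum>j<r. R m j * \<kappa> V s j p)"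
proof -
  interpret local_coords A F r U \<kappa> by fact
  show ?thesis
  proof (rule local_coords.intro[OF surface open_domain])
    fix V s t
    assume V: "open V" "V \<subseteq> U" and s: "s \<in> sec F V" and t: "t \<in> sec F V"
      and eq: "\<And>m p. m < r \<Longrightarrow> p \<in> V \<Longrightarrow> (\<Sum>j<r. R m j * \<kappa> V s j p) = (\<Sum>j<r. R m j * \<kappa> V t j p)"
    show "s = t"
    proof (rule coord_inj[OF V s t])
      fix i p assume ip: "i < r" "p \<in> V"
      have "(\<Sum>m<r. P i m * (\<Sum>j<r. R m j * \<kappa> V s j p)) = (\<Sum>m<r. P i m * (\<Sum>j<r. R m j * \<kappa> V t j p))"
        using ip by (intro sum.cong) (auto simp: eq)
      then show "\<kappa> V s i p = \<kappa> V t i p"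
        unfolding inverse_matrix_sum[OF PR ip(1)] .
    qed
  next
    fix V and a :: "nat \<Rightarrow> 'a \<Rightarrow> complex"
    assume V: "open V" "V \<subseteq> U" and a: "\<And>i. i < r \<Longrightarrow> holomorphic_fun A V (a i)"
    have "holomorphic_fun A V ((\<lambda>i p. \<Sum>j<r. P i j * a j p) i)" for i
      using a by (intro holomorphic_fun_intros) auto
    then obtain s where s: "s \<in> sec F V" "\<forall>i<r. \<forall>p\<in>V. \<kappa> V s i p = (\<Sum>j<r. P i j * a j p)"
      using coord_surj[OF V, of "\<lambda>i p. \<Sum>j<r. P i j * a j p"] by blast
    have "(\<Sum>j<r. R m j * \<kappa> V s j p) = a m p" if "m < r" "p \<in> V" for m p
    proof -
      have "(\<Sum>j<r. R m j * \<kappa> V s j p) = (\<Sum>j<r. R m j * (\<Sum>i<r. P j i * a i p))"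
        using s(2) that by (intro sum.cong) auto
      then show ?thesis
        unfolding inverse_matrix_sum[OF RP that(1)] .
    qed
    with s(1) show "\<exists>s\<in>sec F V. \<forall>i<r. \<forall>p\<in>V. (\<Sum>j<r. R i j * \<kappa> V s j p) = a i p"
      by (intro bexI[of _ s]) simp_all
  next
    fix V s i assume "open V" "V \<subseteq> U" "s \<in> sec F V" "i < r"
    then show "holomorphic_fun A V (\<lambda>p. \<Sum>j<r. R i j * \<kappa> V s j p)"
      by (intro holomorphic_fun_intros coord_holomorphic) auto
  qed (simp_all add: add_closed smult_closed restr_in coord_add coord_smult coord_restr
      distrib_left sum.distrib sum_distrib_left mult.left_commute)
qed

text \<open>A subsheaf cut out by the vanishing at \<open>x\<close> of the coordinates in
  \<open>D\<close> gets coordinates by dividing exactly those by \<zeta>. One lemma serves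
  \<open>E\<close>, with \<open>D\<close> the indices beyond \<open>n\<close>, and M(-x), with all
  indices. The relation to the old coordinates is kept in the conclusion for the comparison of Gram
  matrices.\<close>

lemma subsheaf_coords:
  assumes F: "local_coords A F r U \<kappa>" and G: "sheaf_of_modules A G"
    and hom: "sheaf_hom A G F \<iota>" and inj: "\<And>V. open V \<Longrightarrow> inj_on (\<iota> V) (sec G V)"
    and \<zeta>: "local_parameter A x U \<zeta>"
    and image: "\<And>V. open V \<Longrightarrow> V \<subseteq> U \<Longrightarrow>
      \<iota> V ` sec G V = {s \<in> sec F V. x \<in> V \<longrightarrow> (\<forall>i<r. i \<in> D \<longrightarrow> \<kappa> V s i x = 0)}"
  shows "\<exists>\<kappa>'. local_coords A G r U \<kappa>' \<and> (\<forall>V t i p. open V \<and> V \<subseteq> U \<and> t \<in> sec G V \<and> i < r \<and> p \<in> V \<longrightarrow>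
    \<kappa> V (\<iota> V t) i p = (if i \<in> D then \<zeta> p else 1) * \<kappa>' V t i p)"
proof -
  interpret local_coords A F r U \<kappa> by fact
  interpret G: sheaf_of_modules A G by fact
  define w where "w i p = (if i \<in> D then \<zeta> p else 1)" for i p
  have w: "holomorphic_fun A U (w i)" for i
    using local_parameter_holomorphic[OF \<zeta>] by (cases "i \<in> D") (simp_all add: w_def[abs_def] holomorphic_fun_const)
  \<comment> \<open>The new coordinates are arbitrary quotients chosen by \<open>SOME\<close>; they
    are pinned down, and inherit all rules, because the factor \<open>w i\<close> can be
    cancelled.\<close>
  have cancel: "f p = g p"
    if V: "open V" "V \<subseteq> U" and fg: "holomorphic_fun A V f" "holomorphic_fun A V g"
      and eq: "\<And>p. p \<in> V \<Longrightarrow> w i p * f p = w i p * g p" and p: "p \<in> V" for V f g i p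
  proof (cases "i \<in> D")
    case True
    have "f p - g p = 0"
      by (rule local_parameter_cancel[OF \<zeta> V holomorphic_fun_diff[OF fg] _ p])
        (use True eq in \<open>simp add: w_def right_diff_distrib\<close>)
    then show ?thesis by simp
  next
    case False
    then show ?thesis using eq[OF p] by (simp add: w_def)
  qed
  have \<iota>_in: "\<iota> V t \<in> sec F V" if "open V" "t \<in> sec G V" for V t
    using that module_hom_closed[OF sheaf_hom_module_hom[OF hom]] by blast
  have ex: "\<exists>g. holomorphic_fun A V g \<and> (\<forall>p\<in>V. \<kappa> V (\<iota> V t) i p = w i p * g p)"
    if V: "open V" "V \<subseteq> U" and t: "t \<in> sec G V" and i: "i < r" for V t i
  proof -
    have h: "holomorphic_fun A V (\<kappa> V (\<iota> V t) i)"
      by (intro coord_holomorphic V i \<iota>_in t)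
    show ?thesis
    proof (cases "i \<in> D")
      case True
      have "\<iota> V t \<in> \<iota> V ` sec G V" using t by blast
      then have "x \<in> V \<Longrightarrow> \<kappa> V (\<iota> V t) i x = 0"
        unfolding image[OF V] using True i by blast
      then show ?thesis
        using local_parameter_divide[OF \<zeta> V h] True by (simp add: w_def)
    next
      case False
      then show ?thesis using h by (intro exI[of _ "\<kappa> V (\<iota> V t) i"]) (simp add: w_def)
    qed
  qed
  define \<kappa>' where "\<kappa>' V t i = (SOME g. holomorphic_fun A V g \<and> (\<forall>p\<in>V. \<kappa> V (\<iota> V t) i p = w i p * g p))" for V t i
  have \<kappa>'_holo: "holomorphic_fun A V (\<kappa>' V t i)"
    and \<kappa>': "\<And>p. p \<in> V \<Longrightarrow> \<kappa> V (\<iota> V t) i p = w i p * \<kappa>' V t i p"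
    if "open V" "V \<subseteq> U" "t \<in> sec G V" "i < r" for V t i
    using someI_ex[OF ex[OF that]] unfolding \<kappa>'_def[symmetric] by blast+
  have "local_coords A G r U \<kappa>'"
  proof (rule local_coords.intro[OF surface open_domain])
    fix V s t i p
    assume V: "open V" "V \<subseteq> U" and s: "s \<in> sec G V" and t: "t \<in> sec G V" and i: "i < r" and p: "p \<in> V"
    have st: "s \<oplus>\<^bsub>sections G V\<^esub> t \<in> sec G V" by (intro G.add_in V s t)
    show "\<kappa>' V (s \<oplus>\<^bsub>sections G V\<^esub> t) i p = \<kappa>' V s i p + \<kappa>' V t i p"
    proof (rule cancel[OF V _ _ _ p])
      fix p assume p: "p \<in> V"
      have "w i p * \<kappa>' V (s \<oplus>\<^bsub>sections G V\<^esub> t) i p = \<kappa> V (\<iota> V s \<oplus>\<^bsub>sections F V\<^esub> \<iota> V t) i p"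
        using \<kappa>'[OF V st i p] module_hom_add[OF sheaf_hom_module_hom[OF hom V(1)] s t] by simp
      also have "\<dots> = w i p * (\<kappa>' V s i p + \<kappa>' V t i p)"
        using V s t i p by (simp add: coord_add \<iota>_in \<kappa>' distrib_left)
      finally show "w i p * \<kappa>' V (s \<oplus>\<^bsub>sections G V\<^esub> t) i p = w i p * (\<kappa>' V s i p + \<kappa>' V t i p)" .
    qed (intro \<kappa>'_holo holomorphic_fun_add V s t i st)+
  next
    fix V f s i p
    assume V: "open V" "V \<subseteq> U" and f: "f \<in> carrier (structure_sheaf A V)" and s: "s \<in> sec G V"
      and i: "i < r" and p: "p \<in> V"
    have fs: "f \<odot>\<^bsub>sections G V\<^esub> s \<in> sec G V" by (intro G.smult_in V s f)
    have fh: "holomorphic_fun A V f" using f by (simp add: structure_sheaf_iff)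
    show "\<kappa>' V (f \<odot>\<^bsub>sections G V\<^esub> s) i p = f p * \<kappa>' V s i p"
    proof (rule cancel[OF V _ _ _ p])
      fix p assume p: "p \<in> V"
      have "w i p * \<kappa>' V (f \<odot>\<^bsub>sections G V\<^esub> s) i p = \<kappa> V (f \<odot>\<^bsub>sections F V\<^esub> \<iota> V s) i p"
        using \<kappa>'[OF V fs i p] module_hom_smult[OF sheaf_hom_module_hom[OF hom V(1)] f s] by simp
      also have "\<dots> = w i p * (f p * \<kappa>' V s i p)"
        using V s f i p by (simp add: coord_smult \<iota>_in \<kappa>')
      finally show "w i p * \<kappa>' V (f \<odot>\<^bsub>sections G V\<^esub> s) i p = w i p * (f p * \<kappa>' V s i p)" .
    qed (intro \<kappa>'_holo holomorphic_fun_mult fh V s i fs)+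
  next
    fix V W s i p
    assume V: "open V" "V \<subseteq> U" and W: "open W" "W \<subseteq> V" and s: "s \<in> sec G V" and i: "i < r" and p: "p \<in> W"
    have WU: "W \<subseteq> U" using V W by blast
    have rs: "restr G V W s \<in> sec G W" by (intro G.restr_closed V W s)
    show "\<kappa>' W (restr G V W s) i p = \<kappa>' V s i p"
    proof (rule cancel[OF W(1) WU _ _ _ p])
      fix p assume p: "p \<in> W"
      have pV: "p \<in> V" using p W by blast
      have "w i p * \<kappa>' W (restr G V W s) i p = \<kappa> W (restr F V W (\<iota> V s)) i p"
        using \<kappa>'[OF W(1) WU rs i p] sheaf_hom_restr[OF hom V(1) W s] by simp
      also have "\<dots> = w i p * \<kappa>' V s i p"
        using \<kappa>'[OF V s i pV] V W s i p by (simp add: coord_restr \<iota>_in)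
      finally show "w i p * \<kappa>' W (restr G V W s) i p = w i p * \<kappa>' V s i p" .
    qed (intro \<kappa>'_holo W WU rs i, rule holomorphic_fun_subset[OF \<kappa>'_holo[OF V s i] W(2)])
  next
    fix V s t
    assume V: "open V" "V \<subseteq> U" and s: "s \<in> sec G V" and t: "t \<in> sec G V"
      and eq: "\<And>i p. i < r \<Longrightarrow> p \<in> V \<Longrightarrow> \<kappa>' V s i p = \<kappa>' V t i p"
    have "\<iota> V s = \<iota> V t"
      by (rule coord_inj[OF V]) (use V s t eq in \<open>simp_all add: \<iota>_in \<kappa>'\<close>)
    with inj[OF V(1)] s t show "s = t" by (blast dest: inj_onD)
  next
    fix V and a :: "nat \<Rightarrow> 'a \<Rightarrow> complex"
    assume V: "open V" "V \<subseteq> U" and a: "\<And>i. i < r \<Longrightarrow> holomorphic_fun A V (a i)"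
    have "holomorphic_fun A V ((\<lambda>i p. w i p * a i p) i)" if "i < r" for i
      by (intro holomorphic_fun_mult holomorphic_fun_subset[OF w V(2)] a that)
    then obtain s where s: "s \<in> sec F V" "\<forall>i<r. \<forall>p\<in>V. \<kappa> V s i p = w i p * a i p"
      using coord_surj[OF V, of "\<lambda>i p. w i p * a i p"] by blast
    have "w i x = 0" if "x \<in> V" "i \<in> D" for i
      using that V local_parameter_zero_iff[OF \<zeta>, of x] by (auto simp: w_def)
    then have "s \<in> \<iota> V ` sec G V"
      unfolding image[OF V] using s by simp
    then obtain t where t: "t \<in> sec G V" "s = \<iota> V t" by blast
    have "\<kappa>' V t i p = a i p" if i: "i < r" and p: "p \<in> V" for i p
    proof (rule cancel[OF V _ _ _ p])
      show "w i p * \<kappa>' V t i p = w i p * a i p" if "p \<in> V" for p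
        unfolding \<kappa>'[OF V t(1) i that, symmetric] t(2)[symmetric] using s(2) i that by blast
    qed (intro \<kappa>'_holo V t a i)+
    with t show "\<exists>s\<in>sec G V. \<forall>i<r. \<forall>p\<in>V. \<kappa>' V s i p = a i p"
      by blast
  qed (intro G.add_in G.smult_in G.restr_closed \<kappa>'_holo; assumption)+
  moreover have "\<forall>V t i p. open V \<and> V \<subseteq> U \<and> t \<in> sec G V \<and> i < r \<and> p \<in> V \<longrightarrow>
      \<kappa> V (\<iota> V t) i p = (if i \<in> D then \<zeta> p else 1) * \<kappa>' V t i p"
    using \<kappa>' by (simp add: w_def)
  ultimately show ?thesis by blast
qed

text \<open>Exactness yields only local preimages. Injectivity makes them unique, hence compatible
  on overlaps, and the gluing axiom for \<open>E\<close> assembles them over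
  \<open>V\<close>.\<close>

lemma short_exact_image:
  assumes E: "sheaf_of_modules A E" and F: "sheaf_of_modules A F"
    and exact: "short_exact A E F G \<alpha> \<beta>" and V: "open V"
  shows "\<alpha> V ` sec E V = {s \<in> sec F V. \<beta> V s = \<zero>\<^bsub>sections G V\<^esub>}"
proof (intro equalityI subsetI)
  interpret E: sheaf_of_modules A E by fact
  interpret F: sheaf_of_modules A F by fact
  note hom = short_exact_hom(1)[OF exact]
  have \<alpha>_in: "\<alpha> W e \<in> sec F W" if "open W" "e \<in> sec E W" for W e
    using that module_hom_closed[OF sheaf_hom_module_hom[OF hom]] by blast
  {
    fix s assume "s \<in> \<alpha> V ` sec E V"
    then obtain e where e: "e \<in> sec E V" "s = \<alpha> V e" by blast
    then have s: "s \<in> sec F V" using V \<alpha>_in by blast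
    moreover have "\<beta> V s = \<zero>\<^bsub>sections G V\<^esub>"
      unfolding short_exact_kernel[OF exact V s]
      by (intro ballI exI[of _ V]) (use V e s F.restr_id in auto)
    ultimately show "s \<in> {s \<in> sec F V. \<beta> V s = \<zero>\<^bsub>sections G V\<^esub>}" by blast
  }
  fix s assume "s \<in> {s \<in> sec F V. \<beta> V s = \<zero>\<^bsub>sections G V\<^esub>}"
  then have s: "s \<in> sec F V" and loc: "\<forall>y\<in>V. \<exists>W. open W \<and> y \<in> W \<and> W \<subseteq> V \<and> restr F V W s \<in> \<alpha> W ` sec E W"
    using short_exact_kernel[OF exact V] by auto
  define \<C> where "\<C> = {W. open W \<and> W \<subseteq> V \<and> restr F V W s \<in> \<alpha> W ` sec E W}"
  have U: "\<Union>\<C> = V"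
  proof
    show "\<Union>\<C> \<subseteq> V" by (auto simp: \<C>_def)
    show "V \<subseteq> \<Union>\<C>"
    proof
      fix y assume "y \<in> V"
      from bspec[OF loc this] obtain W where W: "open W" "y \<in> W" "W \<subseteq> V" "restr F V W s \<in> \<alpha> W ` sec E W"
        by (elim exE conjE)
      then have "W \<in> \<C>" by (simp add: \<C>_def)
      with W(2) show "y \<in> \<Union>\<C>" by (rule UnionI[rotated])
    qed
  qed
  define \<sigma> where "\<sigma> W = inv_into (sec E W) (\<alpha> W) (restr F V W s)" for W
  have \<sigma>: "\<sigma> W \<in> sec E W" "\<alpha> W (\<sigma> W) = restr F V W s" if "W \<in> \<C>" for W
    using that unfolding \<sigma>_def \<C>_def by (auto intro: inv_into_into f_inv_into_f)
  have restr_\<sigma>: "\<alpha> N (restr E W N (\<sigma> W)) = restr F V N s" if "W \<in> \<C>" "open N" "N \<subseteq> W" for W N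
    using that V s \<sigma>[OF that(1)] sheaf_hom_restr[OF hom, of W N "\<sigma> W"]
    by (simp add: \<C>_def F.restr_restr)
  have "\<exists>e\<in>sec E (\<Union>\<C>). \<forall>W\<in>\<C>. restr E (\<Union>\<C>) W e = \<sigma> W"
  proof (rule E.gluing)
    fix W W' assume W: "W \<in> \<C>" "W' \<in> \<C>"
    let ?N = "W \<inter> W'"
    have N: "open ?N" using W by (auto simp: \<C>_def)
    have "\<alpha> ?N (restr E W ?N (\<sigma> W)) = \<alpha> ?N (restr E W' ?N (\<sigma> W'))"
      using W N by (simp add: restr_\<sigma>)
    moreover have "restr E W ?N (\<sigma> W) \<in> sec E ?N" "restr E W' ?N (\<sigma> W') \<in> sec E ?N"
      using W N \<sigma> by (auto simp: \<C>_def intro!: E.restr_closed)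
    ultimately show "restr E W ?N (\<sigma> W) = restr E W' ?N (\<sigma> W')"
      using short_exact_inj[OF exact N] by (blast dest: inj_onD)
  qed (use \<sigma> in \<open>auto simp: \<C>_def\<close>)
  then obtain e where e: "e \<in> sec E V" "\<And>W. W \<in> \<C> \<Longrightarrow> restr E V W e = \<sigma> W"
    unfolding U by blast
  have "\<alpha> V e = s"
  proof (rule F.sections_eqI[OF V \<alpha>_in[OF V e(1)] s])
    fix y assume "y \<in> V"
    then obtain W where W: "W \<in> \<C>" "y \<in> W" using U by blast
    then have "open W" "W \<subseteq> V" by (auto simp: \<C>_def)
    moreover have "restr F V W (\<alpha> V e) = restr F V W s"
      using sheaf_hom_restr[OF hom V \<open>open W\<close> \<open>W \<subseteq> V\<close> e(1)] e(2)[OF W(1)] \<sigma>(2)[OF W(1)] by simp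
    ultimately show "\<exists>W. open W \<and> y \<in> W \<and> W \<subseteq> V \<and> restr F V W (\<alpha> V e) = restr F V W s"
      using W by blast
  qed
  with e(1) show "s \<in> \<alpha> V ` sec E V" by blast
qed

text \<open>The local condition defining the twist has content only at \<open>x\<close>: on the
  complement of \<open>x\<close> the ideal contains 1, so every section is a multiple. The set
  \<open>V\<close> may be larger than \<open>U\<close>, as long as coordinates exist at
  \<open>x\<close>.\<close>

lemma (in sheaf_coords) twist_sections:
  assumes V: "open V" and x: "x \<in> V \<Longrightarrow> x \<in> U"
  shows "sec (twist A F x) V = {s \<in> sec F V. x \<in> V \<longrightarrow> (\<forall>i<r. coords_at x V s i = 0)}"
proof (intro equalityI subsetI)
  fix s assume "s \<in> sec (twist A F x) V"
  then have s: "s \<in> sec F V"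
    and loc: "\<And>y. y \<in> V \<Longrightarrow> \<exists>W. open W \<and> y \<in> W \<and> W \<subseteq> V \<and> restr F V W s \<in> ideal_multiples A x F W"
    by (auto simp: twist_def)
  have "coords_at x V s i = 0" if xV: "x \<in> V" and i: "i < r" for i
  proof -
    obtain W where W: "open W" "x \<in> W" "W \<subseteq> V" "restr F V W s \<in> ideal_multiples A x F W"
      using loc[OF xV] by blast
    show ?thesis
      using ideal_multiples_coords_at[OF W(1,2) x[OF xV] W(4) i] coords_at_restr[OF V W(1,3,2) x[OF xV] s i] by simp
  qed
  with s show "s \<in> {s \<in> sec F V. x \<in> V \<longrightarrow> (\<forall>i<r. coords_at x V s i = 0)}" by blast
next
  fix s assume "s \<in> {s \<in> sec F V. x \<in> V \<longrightarrow> (\<forall>i<r. coords_at x V s i = 0)}"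
  then have s: "s \<in> sec F V" and zero: "x \<in> V \<Longrightarrow> i < r \<Longrightarrow> coords_at x V s i = 0" for i
    by auto
  have "\<exists>W. open W \<and> y \<in> W \<and> W \<subseteq> V \<and> restr F V W s \<in> ideal_multiples A x F W" if y: "y \<in> V" for y
  proof (cases "y = x")
    case True
    let ?W = "V \<inter> U"
    have W: "open ?W" "x \<in> ?W" "?W \<subseteq> V" "?W \<subseteq> U"
      using True y x V open_domain by auto
    have rs: "restr F V ?W s \<in> sec F ?W" by (intro restr_closed V W s)
    have "\<forall>i<r. \<kappa> ?W (restr F V ?W s) i x = 0"
      using zero W(2) by (simp add: coords_at_def)
    then have "restr F V ?W s \<in> ideal_multiples A x F ?W"
      using ideal_multiples_iff[OF W(1,4) rs] by blast
    with W True show ?thesis by blast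
  next
    case False
    let ?W = "V - {x}"
    have W: "open ?W" "y \<in> ?W" "?W \<subseteq> V"
      using False y V by auto
    have rs: "restr F V ?W s \<in> sec F ?W" by (intro restr_closed V W s)
    interpret m: module "structure_sheaf A ?W" "sections F ?W" by (rule sections_module[OF W(1)])
    have "\<one>\<^bsub>structure_sheaf A ?W\<^esub> \<in> vanishing_ideal A x ?W"
      using m.R.one_closed by (simp add: vanishing_ideal_def)
    from in_ideal_multiples[OF W(1) this rs] have "restr F V ?W s \<in> ideal_multiples A x F ?W"
      using rs by simp
    with W show ?thesis by blast
  qed
  with s show "s \<in> sec (twist A F x) V" by (simp add: twist_def)
qed

text \<open>The condition on a section is a condition on its value at the one point
  \<open>x\<close>. It is inherited by a glued section from any member of the cover that contains
  \<open>x\<close>.\<close>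

lemma (in sheaf_coords) twist_sheaf:
  assumes x: "x \<in> U"
  shows "sheaf_of_modules A (twist A F x)"
proof -
  have sec: "sec (twist A F x) V = {s \<in> sec F V. x \<in> V \<longrightarrow> (\<forall>i<r. coords_at x V s i = 0)}" if "open V" for V
    by (rule twist_sections[OF that x])
  have ops: "sections (twist A F x) V = sections F V \<lparr>carrier := sec (twist A F x) V\<rparr>"
    and rs: "restr (twist A F x) = restr F" for V
    by (simp_all add: twist_def)
  have ops': "(\<oplus>\<^bsub>sections (twist A F x) V\<^esub>) = (\<oplus>\<^bsub>sections F V\<^esub>)"
    "(\<odot>\<^bsub>sections (twist A F x) V\<^esub>) = (\<odot>\<^bsub>sections F V\<^esub>)" for V
    by (simp_all add: twist_def)
  have sub: "s \<in> sec F V" if "s \<in> sec (twist A F x) V" for s V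
    using that by (simp add: twist_def)
  show ?thesis
  proof (rule sheaf_of_modules.intro)
    fix V :: "'a set" assume V: "open V"
    interpret m: module "structure_sheaf A V" "sections F V" by (rule sections_module[OF V])
    have "submodule (structure_sheaf A V) (sec (twist A F x) V) (sections F V)"
      unfolding sec[OF V] using V x
      by unfold_locales (auto simp: coords_at_add coords_at_smult coords_at_zero)
    then show "module (structure_sheaf A V) (sections (twist A F x) V)"
      by (subst ops) (rule m.submodule_is_module)
  next
    fix V W s assume *: "open V" "open W" "W \<subseteq> V" "s \<in> sec (twist A F x) V"
    then show "restr (twist A F x) V W s \<in> sec (twist A F x) W"
      using x by (auto simp: rs sec coords_at_restr restr_closed subset_iff)
  next
    fix \<C> s t
    assume op: "\<And>V. V \<in> \<C> \<Longrightarrow> open V" and st: "s \<in> sec (twist A F x) (\<Union>\<C>)" "t \<in> sec (twist A F x) (\<Union>\<C>)"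
      and eq: "\<And>V. V \<in> \<C> \<Longrightarrow> restr (twist A F x) (\<Union>\<C>) V s = restr (twist A F x) (\<Union>\<C>) V t"
    show "s = t"
      by (rule locality[OF op sub[OF st(1)] sub[OF st(2)] eq[unfolded rs]])
  next
    fix \<C> \<sigma>
    assume op: "\<And>V. V \<in> \<C> \<Longrightarrow> open V" and \<sigma>: "\<And>V. V \<in> \<C> \<Longrightarrow> \<sigma> V \<in> sec (twist A F x) V"
      and compat: "\<And>V W. V \<in> \<C> \<Longrightarrow> W \<in> \<C> \<Longrightarrow> restr (twist A F x) V (V \<inter> W) (\<sigma> V) = restr (twist A F x) W (V \<inter> W) (\<sigma> W)"
    have "\<exists>s\<in>sec F (\<Union>\<C>). \<forall>V\<in>\<C>. restr F (\<Union>\<C>) V s = \<sigma> V"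
      by (rule gluing[OF op sub[OF \<sigma>] compat[unfolded rs]])
    then obtain s where s: "s \<in> sec F (\<Union>\<C>)" "\<And>V. V \<in> \<C> \<Longrightarrow> restr F (\<Union>\<C>) V s = \<sigma> V" by blast
    have oU: "open (\<Union>\<C>)" using op by blast
    have "coords_at x (\<Union>\<C>) s i = 0" if xU: "x \<in> \<Union>\<C>" and i: "i < r" for i
    proof -
      from xU obtain V where V: "V \<in> \<C>" "x \<in> V" by (rule UnionE)
      have "coords_at x V (\<sigma> V) i = 0"
        using \<sigma>[OF V(1)] V(2) i unfolding sec[OF op[OF V(1)]] by simp
      then show ?thesis
        using coords_at_restr[OF oU op[OF V(1)] Union_upper[OF V(1)] V(2) x s(1) i] s(2)[OF V(1)] by simp
    qed
    then have "s \<in> sec (twist A F x) (\<Union>\<C>)"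
      unfolding sec[OF oU] using s(1) by blast
    then show "\<exists>s\<in>sec (twist A F x) (\<Union>\<C>). \<forall>V\<in>\<C>. restr (twist A F x) (\<Union>\<C>) V s = \<sigma> V"
      using s(2) by (auto simp: rs)
  qed (simp_all add: ops' rs restr_add restr_smult restr_id restr_restr sub)
qed

lemma (in sheaf_coords) twist_inclusion:
  "sheaf_hom A (twist A F x) F (\<lambda>V s. s)"
  by (auto simp: sheaf_hom_def module_hom_def twist_def)

section \<open>The quotient of a fibre by the radical\<close>

context form_coords
begin

definition kernel_at :: "'a \<Rightarrow> (nat \<Rightarrow> complex) set" where
  "kernel_at y = {c. \<forall>j<r. (\<Sum>i<r. c i * gram i j y) = 0}"

text \<open>The element of \<open>quotient_at y\<close> represented by the coordinate vector
  \<open>c\<close>; elements of the quotient are sets of fibre elements.\<close>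

definition coset_at :: "'a \<Rightarrow> (nat \<Rightarrow> complex) \<Rightarrow> ('a set \<times> 's) set set" where
  "coset_at y c = F.value_of y ` {d. (\<lambda>i. d i - c i) \<in> kernel_at y}"

abbreviation radical_at :: "'a \<Rightarrow> ('a set \<times> 's) set set" where
  "radical_at y \<equiv> form_radical (fibre A F y) (fibre A M y) (fibre_form A F M \<psi> y)"

abbreviation quotient_at :: "'a \<Rightarrow> (complex, ('a set \<times> 's) set set) module" where
  "quotient_at y \<equiv> quotient_space (fibre A F y) (radical_at y)"

lemma kernel_at_add: "c \<in> kernel_at y \<Longrightarrow> d \<in> kernel_at y \<Longrightarrow> (\<lambda>i. c i + d i) \<in> kernel_at y"
  by (simp add: kernel_at_def distrib_right sum.distrib)

lemma kernel_at_diff: "c \<in> kernel_at y \<Longrightarrow> d \<in> kernel_at y \<Longrightarrow> (\<lambda>i. c i - d i) \<in> kernel_at y"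
  by (simp add: kernel_at_def left_diff_distrib sum_subtractf)

lemma kernel_at_scale: "c \<in> kernel_at y \<Longrightarrow> (\<lambda>i. a * c i) \<in> kernel_at y"
  by (simp add: kernel_at_def mult.assoc flip: sum_distrib_left)

lemma kernel_at_zero: "(\<lambda>i. 0) \<in> kernel_at y"
  by (simp add: kernel_at_def)

lemma kernel_at_cong: "(\<And>i. i < r \<Longrightarrow> c i = d i) \<Longrightarrow> c \<in> kernel_at y \<longleftrightarrow> d \<in> kernel_at y"
  by (simp add: kernel_at_def cong: sum.cong_simp)

context
  fixes y assumes y: "y \<in> U"
begin

lemma radical_at_eq: "radical_at y = F.value_of y ` kernel_at y"
  unfolding form_radical_fibre[OF y] kernel_at_def ..

lemma coset_at_eq: "radical_at y +>\<^bsub>fibre A F y\<^esub> F.value_of y c = coset_at y c"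
proof -
  have "radical_at y +>\<^bsub>fibre A F y\<^esub> F.value_of y c = (\<lambda>k. F.value_of y (\<lambda>i. k i + c i)) ` kernel_at y"
    by (auto simp: a_r_coset_def' radical_at_eq F.fibre_add[OF y])
  also have "\<dots> = coset_at y c"
  proof (intro equalityI subsetI)
    fix P assume "P \<in> coset_at y c"
    then obtain d where "P = F.value_of y d" "(\<lambda>i. d i - c i) \<in> kernel_at y"
      by (auto simp: coset_at_def)
    then show "P \<in> (\<lambda>k. F.value_of y (\<lambda>i. k i + c i)) ` kernel_at y"
      by (intro image_eqI[of _ _ "\<lambda>i. d i - c i"]) simp_all
  qed (auto simp: coset_at_def)
  finally show ?thesis .
qed

lemma value_in_coset_at: "F.value_of y d \<in> coset_at y c \<longleftrightarrow> (\<lambda>i. d i - c i) \<in> kernel_at y"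
proof
  assume "F.value_of y d \<in> coset_at y c"
  then obtain d' where d': "F.value_of y d = F.value_of y d'" "(\<lambda>i. d' i - c i) \<in> kernel_at y"
    by (auto simp: coset_at_def)
  then show "(\<lambda>i. d i - c i) \<in> kernel_at y"
    using kernel_at_cong[of "\<lambda>i. d i - c i" "\<lambda>i. d' i - c i" y] by (simp add: F.value_of_eq_iff y)
qed (simp add: coset_at_def)

lemma coset_at_eq_iff: "coset_at y c = coset_at y d \<longleftrightarrow> (\<lambda>i. c i - d i) \<in> kernel_at y"
proof
  assume "coset_at y c = coset_at y d"
  then have "F.value_of y c \<in> coset_at y d"
    using value_in_coset_at[of c c] kernel_at_zero by simp
  then show "(\<lambda>i. c i - d i) \<in> kernel_at y"
    by (simp add: value_in_coset_at)
next
  assume *: "(\<lambda>i. c i - d i) \<in> kernel_at y"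
  have "(\<lambda>i. e i - c i) \<in> kernel_at y \<longleftrightarrow> (\<lambda>i. e i - d i) \<in> kernel_at y" for e
    using kernel_at_add[OF _ *, of "\<lambda>i. e i - c i"] kernel_at_diff[OF _ *, of "\<lambda>i. e i - d i"]
    by (auto simp: algebra_simps)
  then show "coset_at y c = coset_at y d"
    by (simp add: coset_at_def)
qed

lemma coset_at_cong: "(\<And>i. i < r \<Longrightarrow> c i = d i) \<Longrightarrow> coset_at y c = coset_at y d"
  using kernel_at_cong[of "\<lambda>i. c i - d i" "\<lambda>i. 0" y] by (simp add: coset_at_eq_iff kernel_at_zero)

lemma quotient_carrier: "carrier (quotient_at y) = range (coset_at y)"
  by (auto simp: quotient_space_def A_RCOSETS_def' F.fibre_carrier[OF y] coset_at_eq)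

lemma quotient_zero: "\<zero>\<^bsub>quotient_at y\<^esub> = coset_at y (\<lambda>i. 0)"
  by (simp add: quotient_space_def radical_at_eq coset_at_def)

lemma quotient_add: "coset_at y c \<oplus>\<^bsub>quotient_at y\<^esub> coset_at y d = coset_at y (\<lambda>i. c i + d i)"
proof -
  have "coset_at y c \<oplus>\<^bsub>quotient_at y\<^esub> coset_at y d =
    {F.value_of y (\<lambda>i. a i + b i) | a b. (\<lambda>i. a i - c i) \<in> kernel_at y \<and> (\<lambda>i. b i - d i) \<in> kernel_at y}"
    by (auto simp: quotient_space_def set_add_def' coset_at_def F.fibre_add[OF y])
  also have "\<dots> = coset_at y (\<lambda>i. c i + d i)"
  proof (intro equalityI subsetI)
    fix P assume "P \<in> {F.value_of y (\<lambda>i. a i + b i) | a b. (\<lambda>i. a i - c i) \<in> kernel_at y \<and> (\<lambda>i. b i - d i) \<in> kernel_at y}"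
    then obtain a b where ab: "P = F.value_of y (\<lambda>i. a i + b i)"
      "(\<lambda>i. a i - c i) \<in> kernel_at y" "(\<lambda>i. b i - d i) \<in> kernel_at y" by blast
    have "(\<lambda>i. (a i + b i) - (c i + d i)) \<in> kernel_at y"
      using kernel_at_add[OF ab(2,3)] by (simp add: algebra_simps)
    then show "P \<in> coset_at y (\<lambda>i. c i + d i)"
      unfolding ab(1) value_in_coset_at .
  next
    fix P assume "P \<in> coset_at y (\<lambda>i. c i + d i)"
    then obtain e where e: "P = F.value_of y e" "(\<lambda>i. e i - (c i + d i)) \<in> kernel_at y"
      by (auto simp: coset_at_def)
    have "P = F.value_of y (\<lambda>i. (e i - d i) + d i)" "(\<lambda>i. (e i - d i) - c i) \<in> kernel_at y"
      "(\<lambda>i. d i - d i) \<in> kernel_at y"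
      using e kernel_at_zero by (simp_all add: algebra_simps)
    then show "P \<in> {F.value_of y (\<lambda>i. a i + b i) | a b. (\<lambda>i. a i - c i) \<in> kernel_at y \<and> (\<lambda>i. b i - d i) \<in> kernel_at y}"
      unfolding mem_Collect_eq by (intro exI[of _ "\<lambda>i. e i - d i"] exI[of _ d] conjI)
  qed
  finally show ?thesis .
qed

lemma quotient_smult: "a \<odot>\<^bsub>quotient_at y\<^esub> coset_at y c = coset_at y (\<lambda>i. a * c i)"
proof -
  have "radical_at y +>\<^bsub>fibre A F y\<^esub> (a \<odot>\<^bsub>fibre A F y\<^esub> P) = coset_at y (\<lambda>i. a * c i)" if "P \<in> coset_at y c" for P
  proof -
    from that obtain d where d: "P = F.value_of y d" "(\<lambda>i. d i - c i) \<in> kernel_at y"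
      by (auto simp: coset_at_def)
    have "(\<lambda>i. a * d i - a * c i) \<in> kernel_at y"
      using kernel_at_scale[OF d(2), of a] by (simp add: right_diff_distrib)
    then show ?thesis
      by (simp add: d(1) F.fibre_smult[OF y] coset_at_eq coset_at_eq_iff)
  qed
  moreover have "coset_at y c \<noteq> {}"
    using value_in_coset_at[of c c] kernel_at_zero by auto
  ultimately show ?thesis
    unfolding quotient_space_def module.simps by (intro Union_constant) auto
qed

text \<open>The value is independent of representatives in the first argument because
  \<open>kernel_at\<close> is a left kernel, and in the second argument by the symmetry expressed in
  \<open>swap\<close>.\<close>

lemma quotient_form_coset:
  assumes "\<And>i j p. gram i j p = gram j i p"
  shows "quotient_form (fibre_form A F M \<psi> y) (coset_at y c) (coset_at y d) =
    M.value_of y (\<lambda>k. \<Sum>j<r. (\<Sum>i<r. c i * gram i j y) * d j)"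
proof -
  have swap: "(\<Sum>j<r. (\<Sum>i<r. a i * gram i j y) * b j) = (\<Sum>j<r. (\<Sum>i<r. b i * gram i j y) * a j)" for a b
  proof -
    have "(\<Sum>j<r. (\<Sum>i<r. a i * gram i j y) * b j) = (\<Sum>j<r. \<Sum>i<r. a i * gram i j y * b j)"
      by (simp add: sum_distrib_right)
    also have "\<dots> = (\<Sum>i<r. \<Sum>j<r. a i * gram i j y * b j)"
      by (rule sum.swap)
    also have "\<dots> = (\<Sum>i<r. (\<Sum>j<r. b j * gram j i y) * a i)"
      by (simp add: sum_distrib_left sum_distrib_right assms[of _ _ y] mult.commute mult.left_commute)
    finally show ?thesis .
  qed
  have zero: "(\<Sum>j<r. (\<Sum>i<r. k i * gram i j y) * b j) = 0" if "k \<in> kernel_at y" for k b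
    using that by (simp add: kernel_at_def)
  have eq: "(\<Sum>j<r. (\<Sum>i<r. a i * gram i j y) * b j) = (\<Sum>j<r. (\<Sum>i<r. a' i * gram i j y) * b j)"
    if "(\<lambda>i. a i - a' i) \<in> kernel_at y" for a a' b
    using zero[OF that, of b] by (simp add: left_diff_distrib sum_subtractf)
  have "fibre_form A F M \<psi> y v w = M.value_of y (\<lambda>k. \<Sum>j<r. (\<Sum>i<r. c i * gram i j y) * d j)"
    if "v \<in> coset_at y c" "w \<in> coset_at y d" for v w
  proof -
    from that obtain a b where ab: "v = F.value_of y a" "(\<lambda>i. a i - c i) \<in> kernel_at y"
      "w = F.value_of y b" "(\<lambda>i. b i - d i) \<in> kernel_at y"
      by (auto simp: coset_at_def)
    have "(\<Sum>j<r. (\<Sum>i<r. a i * gram i j y) * b j) = (\<Sum>j<r. (\<Sum>i<r. c i * gram i j y) * b j)"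
      by (rule eq[OF ab(2)])
    also have "\<dots> = (\<Sum>j<r. (\<Sum>i<r. c i * gram i j y) * d j)"
      unfolding swap[of c] by (rule eq[OF ab(4)])
    finally show ?thesis
      unfolding ab(1,3) fibre_form_value_of[OF y] by simp
  qed
  moreover have "coset_at y c \<noteq> {}" "coset_at y d \<noteq> {}"
    using value_in_coset_at[of c c] value_in_coset_at[of d d] kernel_at_zero by auto
  ultimately have "(\<lambda>(v, w). fibre_form A F M \<psi> y v w) ` (coset_at y c \<times> coset_at y d) =
      {M.value_of y (\<lambda>k. \<Sum>j<r. (\<Sum>i<r. c i * gram i j y) * d j)}"
    by (auto simp: image_iff)
  then show ?thesis by (simp add: quotient_form_def)
qed

text \<open>The zero of the quotient by \<open>S\<close> is \<open>S\<close> itself, and a coset of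
  the subgroup \<open>S\<close> equals \<open>S\<close> exactly if its representative lies in
  \<open>S\<close>.\<close>

lemma fibre_projection_zero_iff:
  assumes S: "subspace class_ring S (quotient_at y)" and s: "open V" "y \<in> V" "s \<in> sec F V"
  shows "fibre_projection A F y (radical_at y) S V s = \<zero>\<^bsub>quotient_space (quotient_at y) S\<^esub> \<longleftrightarrow>
    coset_at y (F.coords_at y V s) \<in> S"
proof -
  interpret vs: vectorspace class_ring "quotient_at y"
    using S by (simp add: subspace_def)
  interpret sm: submodule class_ring S "quotient_at y"
    using S by (simp add: subspace_def)
  have "section_value A F y V s = F.value_of y (F.coords_at y V s)"
    by (rule F.section_value_value_of[OF y s]) simp
  then have *: "fibre_projection A F y (radical_at y) S V s = S +>\<^bsub>quotient_at y\<^esub> coset_at y (F.coords_at y V s)"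
    using s(2) by (simp add: fibre_projection_def coset_at_eq)
  have sub: "additive_subgroup S (quotient_at y)"
  proof (rule additive_subgroup.intro, rule group.subgroupI)
    show "Group.group (add_monoid (quotient_at y))"
      by (rule vs.a_group)
    fix a b assume a: "a \<in> S"
    \<comment> \<open>Submodules come with closure under scalars, so negatives are obtained as
      multiples by -1.\<close>
    have "\<ominus>\<^bsub>quotient_at y\<^esub> a = (\<ominus>\<^bsub>class_ring\<^esub> \<one>\<^bsub>class_ring\<^esub>) \<odot>\<^bsub>quotient_at y\<^esub> a"
      using a sm.subset vs.smult_minus_1 by auto
    then show "inv\<^bsub>add_monoid (quotient_at y)\<^esub> a \<in> S"
      using a sm.smult_closed[of "\<ominus>\<^bsub>class_ring\<^esub> \<one>\<^bsub>class_ring\<^esub>" a] by (simp add: a_inv_def)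
    show "b \<in> S \<Longrightarrow> a \<otimes>\<^bsub>add_monoid (quotient_at y)\<^esub> b \<in> S"
      using a by simp
  next
    show "S \<noteq> {}" using sm.zero_closed by blast
  qed (use sm.subset in auto)
  have carr: "coset_at y c \<in> carrier (quotient_at y)" for c
    by (simp add: quotient_carrier)
  have "S +>\<^bsub>quotient_at y\<^esub> X = S \<longleftrightarrow> X \<in> S" if "X \<in> carrier (quotient_at y)" for X
    using vs.a_coset_join1[of S X] vs.a_coset_join2[of X S] sub that
    by (auto simp: additive_subgroup_def dest: subgroup.subset)
  then show ?thesis
    unfolding * by (simp add: quotient_space_def[of "quotient_at y"] carr)
qed

end

text \<open>An adapted basis for the preimage \<open>W\<close> of \<open>S\<close> in \<complex>^r.
  The number \<open>k\<close> of basis vectors in \<open>W\<close> is found to be n + 1 by an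
  explicit isomorphism from \<complex>^(k-1) to \<open>S\<close>: the first basis vector spans the
  radical and is lost in the quotient.\<close>

lemma isotropic_basis:
  assumes y: "y \<in> U" and sym: "\<And>i j p. gram i j p = gram j i p"
    and l: "\<exists>i<r. l i \<noteq> 0" "\<And>c. c \<in> kernel_at y \<longleftrightarrow> (\<exists>a. \<forall>i<r. c i = a * l i)"
    and S: "subspace class_ring S (quotient_at y)"
    and dim: "vectorspace.dim class_ring ((quotient_at y)\<lparr>carrier := S\<rparr>) = n"
    and iso: "isotropic (fibre A M y) (quotient_form (fibre_form A F M \<psi> y)) S"
  shows "\<exists>P R. n < r \<and>
    (\<forall>i<r. \<forall>j<r. (\<Sum>m<r. P i m * R m j) = (if i = j then 1 else 0)) \<and>
    (\<forall>i<r. \<forall>j<r. (\<Sum>m<r. R i m * P m j) = (if i = j then 1 else 0)) \<and>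
    (\<forall>i<r. P i 0 = l i) \<and>
    (\<forall>i\<le>n. \<forall>j\<le>n. (\<Sum>b<r. (\<Sum>a<r. P a i * gram a b y) * P b j) = 0) \<and>
    (\<forall>c. coset_at y c \<in> S \<longleftrightarrow> (\<forall>m. n < m \<and> m < r \<longrightarrow> (\<Sum>j<r. R m j * c j) = 0))"
proof -
  interpret vs: vectorspace class_ring "quotient_at y"
    using S by (simp add: subspace_def)
  interpret sm: submodule class_ring S "quotient_at y"
    using S by (simp add: subspace_def)
  \<comment> \<open>Cosets ignore entries from \<open>r\<close> on, while
    \<open>adapted_basis\<close> works with vectors that vanish there.\<close>
  define cut where "cut c = (\<lambda>i. if i < r then c i else 0)" for c :: "nat \<Rightarrow> complex"
  have coset_cut: "coset_at y (cut c) = coset_at y c" for c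
    by (rule coset_at_cong[OF y]) (simp add: cut_def)
  define W where "W = {c. (\<forall>i\<ge>r. c i = 0) \<and> coset_at y c \<in> S}"
  have l_ker: "l \<in> kernel_at y"
    unfolding l(2) by (intro exI[of _ 1]) simp
  have coset_l: "coset_at y (cut l) \<in> S"
    unfolding coset_cut using sm.zero_closed l_ker coset_at_eq_iff[OF y, of l "\<lambda>i. 0"]
    by (simp add: quotient_zero[OF y])
  have "\<exists>k P R. 1 \<le> k \<and> k \<le> r \<and>
    (\<forall>i<r. \<forall>j<r. (\<Sum>m<r. P i m * R m j) = (if i = j then 1 else 0)) \<and>
    (\<forall>i<r. \<forall>j<r. (\<Sum>m<r. R i m * P m j) = (if i = j then 1 else 0)) \<and>
    (\<forall>i<r. P i 0 = cut l i) \<and>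
    (\<forall>c. (\<forall>i\<ge>r. c i = 0) \<longrightarrow> (c \<in> W \<longleftrightarrow> (\<forall>m. k \<le> m \<and> m < r \<longrightarrow> (\<Sum>j<r. R m j * c j) = 0)))"
  proof (rule adapted_basis)
    show "(\<lambda>i. f i + g i) \<in> W" if "f \<in> W" "g \<in> W" for f g
      using that sm.m_closed[of "coset_at y f" "coset_at y g"] by (simp add: W_def quotient_add[OF y])
    show "(\<lambda>i. a * f i) \<in> W" if "f \<in> W" for a f
      using that sm.smult_closed[of a "coset_at y f"] by (simp add: W_def quotient_smult[OF y])
    show "cut l \<noteq> (\<lambda>i. 0)"
      using l(1) by (metis cut_def)
  qed (use coset_l in \<open>auto simp: W_def cut_def\<close>)
  then obtain k P R where k: "1 \<le> k" "k \<le> r"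
    and PR: "\<forall>i<r. \<forall>j<r. (\<Sum>m<r. P i m * R m j) = (if i = j then 1 else 0)"
    and RP: "\<forall>i<r. \<forall>j<r. (\<Sum>m<r. R i m * P m j) = (if i = j then 1 else 0)"
    and Pl: "\<forall>i<r. P i 0 = cut l i"
    and WR: "\<And>c. \<forall>i\<ge>r. c i = 0 \<Longrightarrow> c \<in> W \<longleftrightarrow> (\<forall>m. k \<le> m \<and> m < r \<longrightarrow> (\<Sum>j<r. R m j * c j) = 0)"
    by (elim exE conjE) blast
  have cut_sum: "(\<Sum>j<r. R m j * cut c j) = (\<Sum>j<r. R m j * c j)" for m c
    by (intro sum.cong) (auto simp: cut_def)
  have SR: "coset_at y c \<in> S \<longleftrightarrow> (\<forall>m. k \<le> m \<and> m < r \<longrightarrow> (\<Sum>j<r. R m j * c j) = 0)" for c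
  proof -
    have "coset_at y c \<in> S \<longleftrightarrow> cut c \<in> W"
      by (simp add: W_def coset_cut) (simp add: cut_def)
    also have "\<dots> \<longleftrightarrow> (\<forall>m. k \<le> m \<and> m < r \<longrightarrow> (\<Sum>j<r. R m j * cut c j) = 0)"
      by (rule WR) (simp add: cut_def)
    finally show ?thesis by (simp add: cut_sum)
  qed
  note RPsum = inverse_matrix_sum[OF RP] and PRsum = inverse_matrix_sum[OF PR]
  \<comment> \<open>In the new coordinates the kernel is the line of the coordinate vector 0, since
    column 0 of \<open>P\<close> is \<open>l\<close>.\<close>
  have kernel_R: "c \<in> kernel_at y \<longleftrightarrow> (\<forall>m. 1 \<le> m \<and> m < r \<longrightarrow> (\<Sum>j<r. R m j * c j) = 0)" for c
  proof
    assume "c \<in> kernel_at y"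
    then obtain a where a: "\<forall>i<r. c i = a * l i" using l(2) by blast
    show "\<forall>m. 1 \<le> m \<and> m < r \<longrightarrow> (\<Sum>j<r. R m j * c j) = 0"
    proof (intro allI impI)
      fix m assume m: "1 \<le> m \<and> m < r"
      have "(\<Sum>j<r. R m j * c j) = a * (\<Sum>j<r. R m j * P j 0)"
        unfolding sum_distrib_left using a Pl by (intro sum.cong) (auto simp: cut_def)
      then show "(\<Sum>j<r. R m j * c j) = 0" using RP m k by auto
    qed
  next
    assume *: "\<forall>m. 1 \<le> m \<and> m < r \<longrightarrow> (\<Sum>j<r. R m j * c j) = 0"
    have "c j = (\<Sum>a<r. R 0 a * c a) * l j" if j: "j < r" for j
    proof -
      have "c j = (\<Sum>i<r. P j i * (\<Sum>a<r. R i a * c a))"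
        by (rule PRsum[OF j, symmetric])
      also have "\<dots> = (\<Sum>i<r. if i = 0 then P j 0 * (\<Sum>a<r. R 0 a * c a) else 0)"
        using * by (intro sum.cong) auto
      also have "\<dots> = (\<Sum>a<r. R 0 a * c a) * l j"
        using k Pl j by (simp add: cut_def)
      finally show ?thesis .
    qed
    then show "c \<in> kernel_at y" unfolding l(2) by blast
  qed
  \<comment> \<open>The combination of the basis columns 1 to k - 1 with the entries of
    \<open>v\<close> as coefficients. The shift by one skips column 0, which would make
    \<open>T\<close> fail to be injective.\<close>
  define comb where "comb v = (\<lambda>i. \<Sum>m<r. P i m * (if 1 \<le> m \<and> m < k then vec_index v (m - 1) else 0))" for v :: "complex vec"
  define T where "T v = coset_at y (comb v)" for v
  have R_comb: "(\<Sum>j<r. R m j * comb v j) = (if 1 \<le> m \<and> m < k then vec_index v (m - 1) else 0)" if "m < r" for m v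
    unfolding comb_def by (rule RPsum[OF that])
  have T_in: "T v \<in> S" for v
    unfolding T_def SR by (auto simp: R_comb)
  have comb_add: "comb (v + w) = (\<lambda>i. comb v i + comb w i)" if "v \<in> carrier_vec (k - 1)" "w \<in> carrier_vec (k - 1)" for v w
  proof
    fix i
    show "comb (v + w) i = comb v i + comb w i"
      unfolding comb_def sum.distrib[symmetric] using that by (intro sum.cong) (auto simp: distrib_left)
  qed
  have comb_smult: "comb (a \<cdot>\<^sub>v v) = (\<lambda>i. a * comb v i)" if "v \<in> carrier_vec (k - 1)" for a v
  proof
    fix i
    show "comb (a \<cdot>\<^sub>v v) i = a * comb v i"
      unfolding comb_def sum_distrib_left using that by (intro sum.cong) auto
  qed
  interpret vec: vec_space "TYPE(complex)" "k - 1" .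
  have vsS: "vectorspace class_ring ((quotient_at y)\<lparr>carrier := S\<rparr>)"
    by (rule vs.subspace_is_vs[OF S])
  have Thom: "T \<in> module_hom class_ring (module_vec TYPE(complex) (k - 1)) ((quotient_at y)\<lparr>carrier := S\<rparr>)"
    unfolding module_hom_def
    by (auto simp: T_in module_vec_def) (simp_all add: T_def comb_add comb_smult quotient_add[OF y] quotient_smult[OF y])
  interpret T: linear_map class_ring "module_vec TYPE(complex) (k - 1)" "(quotient_at y)\<lparr>carrier := S\<rparr>" T
    using vec.vectorspace_axioms vsS Thom
    by (simp add: linear_map_def mod_hom_def mod_hom_axioms_def vectorspace_def)
  have inj: "inj_on T (carrier (module_vec TYPE(complex) (k - 1)))"
  proof (rule inj_onI)
    fix v w assume vw: "v \<in> carrier (module_vec TYPE(complex) (k - 1))" "w \<in> carrier (module_vec TYPE(complex) (k - 1))" "T v = T w"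
    then have d: "v \<in> carrier_vec (k - 1)" "w \<in> carrier_vec (k - 1)" by (auto simp: module_vec_def)
    have ker: "(\<lambda>i. comb v i - comb w i) \<in> kernel_at y"
      using vw(3) by (simp add: T_def coset_at_eq_iff[OF y])
    show "v = w"
    proof (rule eq_vecI)
      fix i assume "i < dim_vec w"
      then have i: "Suc i < k" "Suc i < r" using d k by auto
      have "(\<Sum>j<r. R (Suc i) j * (comb v j - comb w j)) = 0"
        using ker i(2) unfolding kernel_R by simp
      then have "(\<Sum>j<r. R (Suc i) j * comb v j) = (\<Sum>j<r. R (Suc i) j * comb w j)"
        by (simp add: right_diff_distrib sum_subtractf)
      then show "vec_index v i = vec_index w i"
        using i by (simp add: R_comb)
    qed (use d in auto)
  qed
  have surj: "T.im = S"
  proof (intro equalityI subsetI)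
    fix X assume X: "X \<in> S"
    then obtain c where c: "X = coset_at y c"
      using sm.subset by (auto simp: quotient_carrier[OF y])
    define v where "v = vec (k - 1) (\<lambda>i. \<Sum>j<r. R (Suc i) j * c j)"
    have "(\<lambda>i. comb v i - c i) \<in> kernel_at y"
      unfolding kernel_R
    proof (intro allI impI)
      fix m assume m: "1 \<le> m \<and> m < r"
      have "(\<Sum>j<r. R m j * comb v j) = (\<Sum>j<r. R m j * c j)"
      proof (cases "m < k")
        case True
        then show ?thesis using m by (cases m) (simp_all add: R_comb v_def)
      next
        case False
        then show ?thesis using m X[unfolded c SR] by (simp add: R_comb)
      qed
      then show "(\<Sum>j<r. R m j * (comb v j - c j)) = 0"
        by (simp add: right_diff_distrib sum_subtractf)
    qed
    then have "T v = X"
      unfolding T_def c by (simp add: coset_at_eq_iff[OF y])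
    moreover have "v \<in> carrier (module_vec TYPE(complex) (k - 1))"
      by (simp add: v_def module_vec_def)
    ultimately show "X \<in> T.im" by (auto simp: T.im_def)
  qed (auto simp: T.im_def T_in)
  \<comment> \<open>Rank and nullity of the bijection \<open>T\<close> give the dimension of
    \<open>S\<close>, which is \<open>n\<close> by hypothesis.\<close>
  have "vectorspace.dim class_ring ((quotient_at y)\<lparr>carrier := S\<rparr>) = k - 1"
    using T.rank_nullity[OF vec.fin_dim] T.inj_imp_dim_ker0[OF inj] by (simp add: surj vec.dim_is_n)
  with dim k have kn: "k = Suc n" by simp
  have col: "coset_at y (\<lambda>a. P a i) \<in> S" if "i \<le> n" for i
    unfolding SR using RP kn that k by auto
  have "(\<Sum>b<r. (\<Sum>a<r. P a i * gram a b y) * P b j) = 0" if "i \<le> n" "j \<le> n" for i j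
  proof -
    have "quotient_form (fibre_form A F M \<psi> y) (coset_at y (\<lambda>a. P a i)) (coset_at y (\<lambda>a. P a j)) = \<zero>\<^bsub>fibre A M y\<^esub>"
      using iso col that by (simp add: isotropic_def)
    then show ?thesis
      unfolding quotient_form_coset[OF y sym] M.fibre_zero[OF y] M.value_of_eq_iff[OF y] by simp
  qed
  moreover have "\<forall>i<r. P i 0 = l i" using Pl by (simp add: cut_def)
  moreover have "coset_at y c \<in> S \<longleftrightarrow> (\<forall>m. n < m \<and> m < r \<longrightarrow> (\<Sum>j<r. R m j * c j) = 0)" for c
    unfolding SR kn by (simp add: Suc_le_eq)
  ultimately show ?thesis
    using PR RP k kn by (intro exI[of _ P] exI[of _ R]) simp
qed

end

section \<open>The induced form\<close>

text \<open>The coordinates \<open>\<kappa>\<close> are adapted to the kernel and to the isotropic subspace: at \<^term>\<open>x\<close> the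
  kernel of the form is spanned by the coordinate vector 0, and the sections of \<^term>\<open>E\<close> are those whose values
  lie in the span of the coordinate vectors \<open>0, \<dots>, n\<close>.\<close>

locale lagrangian_coords = length_one_form A F "2 * n + 1" U \<kappa> M \<mu> \<psi> x q + E: sheaf_of_modules A E
  for A :: "('a::t2_space) chart set" and F n U \<kappa> M \<mu> \<psi> x q E +
  fixes \<iota> and \<zeta> :: "'a \<Rightarrow> complex"
  assumes hom: "sheaf_hom A E F \<iota>" and inj: "\<And>V. open V \<Longrightarrow> inj_on (\<iota> V) (sec E V)"
    and parameter: "local_parameter A x U \<zeta>"
    and image: "\<And>V. open V \<Longrightarrow> V \<subseteq> U \<Longrightarrow>
      \<iota> V ` sec E V = {s \<in> sec F V. x \<in> V \<longrightarrow> (\<forall>i<2 * n + 1. i \<in> {n<..} \<longrightarrow> \<kappa> V s i x = 0)}"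
    and gram_isotropic: "\<And>i j. x \<in> U \<Longrightarrow> i \<le> n \<Longrightarrow> j \<le> n \<Longrightarrow> gram i j x = 0"
    and gram_row0: "\<And>j. x \<in> U \<Longrightarrow> j < 2 * n + 1 \<Longrightarrow> gram 0 j x = 0"
begin

lemma \<iota>_in: "open V \<Longrightarrow> s \<in> sec E V \<Longrightarrow> \<iota> V s \<in> sec F V"
  using module_hom_closed[OF sheaf_hom_module_hom[OF hom]] by blast

text \<open>At \<open>x\<close> the values of both sections lie in the span of the coordinate
  vectors up to \<open>n\<close>, where the Gram matrix is 0.\<close>

lemma induced_form_zero:
  assumes V: "open V" "V \<subseteq> U" "x \<in> V" and s: "s \<in> sec E V" and t: "t \<in> sec E V"
  shows "\<mu> V (\<psi> V (\<iota> V s) (\<iota> V t)) 0 x = 0"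
proof -
  have zero: "\<kappa> V (\<iota> V s) i x = 0" if "s \<in> sec E V" "i < 2 * n + 1" "n < i" for s i
  proof -
    have "\<iota> V s \<in> \<iota> V ` sec E V" using that by blast
    then show ?thesis unfolding image[OF V(1,2)] using V(3) that by simp
  qed
  have xU: "x \<in> U" using V by blast
  have "(\<Sum>i<2 * n + 1. \<kappa> V (\<iota> V s) i x * gram i j x) * \<kappa> V (\<iota> V t) j x = 0" if j: "j < 2 * n + 1" for j
  proof (cases "j \<le> n")
    case True
    have "\<kappa> V (\<iota> V s) i x * gram i j x = 0" if "i < 2 * n + 1" for i
      using zero[OF s that] gram_isotropic[OF xU _ True, of i] by (cases "i \<le> n") simp_all
    then have "(\<Sum>i<2 * n + 1. \<kappa> V (\<iota> V s) i x * gram i j x) = 0"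
      by (intro sum.neutral) simp
    then show ?thesis by simp
  next
    case False
    then show ?thesis using zero[OF t j] by simp
  qed
  then show ?thesis
    unfolding form_expansion[OF V(1,2) \<iota>_in[OF V(1) s] \<iota>_in[OF V(1) t] V(3)]
    by (intro sum.neutral) simp
qed

text \<open>Membership in the twist is decided at \<open>x\<close>, so for arbitrary
  \<open>V\<close> it suffices to look at the intersection with \<open>U\<close>.\<close>

lemma induced_form_in_twist:
  assumes V: "open V" and s: "s \<in> sec E V" and t: "t \<in> sec E V" and x: "x \<in> U"
  shows "\<psi> V (\<iota> V s) (\<iota> V t) \<in> sec (twist A M x) V"
proof -
  have "M.coords_at x V (\<psi> V (\<iota> V s) (\<iota> V t)) 0 = 0" if "x \<in> V"
  proof -
    let ?W = "V \<inter> U"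
    have W: "open ?W" "?W \<subseteq> V" "?W \<subseteq> U" "x \<in> ?W"
      using V x that F.open_domain by auto
    have "restr M V ?W (\<psi> V (\<iota> V s) (\<iota> V t)) = \<psi> ?W (\<iota> ?W (restr E V ?W s)) (\<iota> ?W (restr E V ?W t))"
      unfolding sheaf_hom_restr[OF hom V W(1,2) s] sheaf_hom_restr[OF hom V W(1,2) t]
      by (rule form_restr[OF V W(1,2) \<iota>_in[OF V s] \<iota>_in[OF V t], symmetric])
    then show ?thesis
      unfolding M.coords_at_def
      using induced_form_zero[OF W(1,3,4) E.restr_closed[OF V W(1,2) s] E.restr_closed[OF V W(1,2) t]] by simp
  qed
  then show ?thesis
    unfolding M.twist_sections[OF V x] using form_in[OF V \<iota>_in[OF V s] \<iota>_in[OF V t]] by simp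
qed

lemma induced_coords:
  "\<exists>\<kappa>'. local_coords A E (2 * n + 1) U \<kappa>' \<and>
    (\<forall>V t i p. open V \<and> V \<subseteq> U \<and> t \<in> sec E V \<and> i < 2 * n + 1 \<and> p \<in> V \<longrightarrow>
      \<kappa> V (\<iota> V t) i p = (if i \<in> {n<..} then \<zeta> p else 1) * \<kappa>' V t i p)"
  by (rule subsheaf_coords[OF F.local_coords_axioms E.sheaf_of_modules_axioms hom inj parameter image])

lemma twist_coords:
  assumes "sheaf_of_modules A (twist A M x)"
  shows "\<exists>\<mu>'. local_coords A (twist A M x) 1 U \<mu>' \<and>
    (\<forall>V t i p. open V \<and> V \<subseteq> U \<and> t \<in> sec (twist A M x) V \<and> i < 1 \<and> p \<in> V \<longrightarrow>
      \<mu> V t i p = (if i \<in> UNIV then \<zeta> p else 1) * \<mu>' V t i p)"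
proof (rule subsheaf_coords[OF M.local_coords_axioms assms M.twist_inclusion _ parameter])
  fix V assume V: "open V" "V \<subseteq> U"
  have "sec (twist A M x) V = {s \<in> sec M V. x \<in> V \<longrightarrow> (\<forall>i<1. M.coords_at x V s i = 0)}"
    by (rule M.twist_sections) (use V in auto)
  then show "(\<lambda>s. s) ` sec (twist A M x) V = {s \<in> sec M V. x \<in> V \<longrightarrow> (\<forall>i<1. i \<in> UNIV \<longrightarrow> \<mu> V s i x = 0)}"
    using M.coords_at_eq[OF V] by auto
qed (simp add: inj_on_def)

text \<open>Everything rests on \<open>rel\<close>. Off \<open>x\<close> the factors in it are
  nonzero numbers, so a kernel vector of the new matrix rescales to one of the old. At
  \<open>x\<close> it yields, after cancellation of \<zeta>, the block shape of
  \<open>twisted_matrix_nondegenerate\<close>.\<close>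

lemma induced_form_nondegenerate:
  assumes twist: "sheaf_of_modules A (twist A M x)"
    and bil: "bilinear_form A E (twist A M x) (\<lambda>V s t. \<psi> V (\<iota> V s) (\<iota> V t))"
    and y: "y \<in> U"
  shows "nondegenerate (fibre A E y) (fibre A (twist A M x) y)
    (fibre_form A E (twist A M x) (\<lambda>V s t. \<psi> V (\<iota> V s) (\<iota> V t)) y)"
proof -
  let ?r = "2 * n + 1"
  define w where "w i p = (if n < i then \<zeta> p else 1)" for i p
  obtain \<kappa>' where \<kappa>': "local_coords A E ?r U \<kappa>'"
    and \<kappa>'_eq: "\<And>V t i p. open V \<Longrightarrow> V \<subseteq> U \<Longrightarrow> t \<in> sec E V \<Longrightarrow> i < ?r \<Longrightarrow> p \<in> V \<Longrightarrow>
      \<kappa> V (\<iota> V t) i p = w i p * \<kappa>' V t i p"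
    using induced_coords by (auto simp: w_def)
  obtain \<mu>' where \<mu>': "local_coords A (twist A M x) 1 U \<mu>'"
    and \<mu>'_eq: "\<And>V t p. open V \<Longrightarrow> V \<subseteq> U \<Longrightarrow> t \<in> sec (twist A M x) V \<Longrightarrow> p \<in> V \<Longrightarrow>
      \<mu> V t 0 p = \<zeta> p * \<mu>' V t 0 p"
    using twist_coords[OF twist] by auto
  interpret I: form_coords A E ?r U \<kappa>' "twist A M x" \<mu>' "\<lambda>V s t. \<psi> V (\<iota> V s) (\<iota> V t)"
    by (intro form_coords.intro coords_pair.intro sheaf_coords.intro form_coords_axioms.intro
        E.sheaf_of_modules_axioms twist \<kappa>' \<mu>' bil)
  have U: "open U" by (rule F.open_domain)
  \<comment> \<open>Each argument contributes the factor by which \<open>\<iota>\<close> rescales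
    its unit section; the factor \<zeta> on the left is the change of coordinate from M(-x) to
    \<open>M\<close>.\<close>
  have rel: "\<zeta> p * I.gram i j p = w i p * w j p * gram i j p" if i: "i < ?r" and j: "j < ?r" and p: "p \<in> U" for i j p
  proof -
    have u: "I.F.unit_section U i \<in> sec E U" for i by (rule I.F.unit_section_in[OF U order_refl])
    have k: "\<kappa> U (\<iota> U (I.F.unit_section U i)) a p = (if a = i then w i p else 0)" if "a < ?r" for a i
      using \<kappa>'_eq[OF U order_refl u that p, of i] I.F.coord_unit_section[OF U order_refl that p, of i] by simp
    have k1: "(\<Sum>a<?r. \<kappa> U (\<iota> U (I.F.unit_section U i)) a p * gram a b p) = w i p * gram i b p" for b
    proof -
      have "(\<Sum>a<?r. \<kappa> U (\<iota> U (I.F.unit_section U i)) a p * gram a b p) = (\<Sum>a<?r. if a = i then w i p * gram i b p else 0)"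
        by (intro sum.cong) (simp_all add: k)
      then show ?thesis using i by simp
    qed
    have "\<zeta> p * I.gram i j p = \<mu> U (\<psi> U (\<iota> U (I.F.unit_section U i)) (\<iota> U (I.F.unit_section U j))) 0 p"
      unfolding I.gram_def using \<mu>'_eq[OF U order_refl I.form_in[OF U u u] p] by simp
    also have "\<dots> = (\<Sum>b<?r. w i p * gram i b p * \<kappa> U (\<iota> U (I.F.unit_section U j)) b p)"
      unfolding form_expansion[OF U order_refl \<iota>_in[OF U u] \<iota>_in[OF U u] p] k1 ..
    also have "\<dots> = (\<Sum>b<?r. if b = j then w i p * w j p * gram i j p else 0)"
      by (intro sum.cong) (simp_all add: k)
    finally show ?thesis using j by simp
  qed
  have "c i = 0" if c: "\<forall>j<?r. (\<Sum>i<?r. c i * I.gram i j y) = 0" and i: "i < ?r" for c i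
  proof (cases "y = x")
    case False
    have \<zeta>y: "\<zeta> y \<noteq> 0"
      using local_parameter_zero_iff[OF parameter y] False by simp
    then have w: "w i y \<noteq> 0" for i by (simp add: w_def)
    have "\<forall>j<?r. (\<Sum>i<?r. (c i * w i y) * gram i j y) = 0"
    proof (intro allI impI)
      fix j assume j: "j < ?r"
      have "w j y * (\<Sum>i<?r. (c i * w i y) * gram i j y) = (\<Sum>i<?r. c i * (w i y * w j y * gram i j y))"
        unfolding sum_distrib_left by (intro sum.cong) simp_all
      also have "\<dots> = (\<Sum>i<?r. c i * (\<zeta> y * I.gram i j y))"
        using rel[OF _ j y] by (intro sum.cong) simp_all
      also have "\<dots> = \<zeta> y * (\<Sum>i<?r. c i * I.gram i j y)"
        unfolding sum_distrib_left by (intro sum.cong) simp_all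
      finally show "(\<Sum>i<?r. (c i * w i y) * gram i j y) = 0"
        using c j w[of j] by simp
    qed
    from gram_kernel_away[OF y False this i] show ?thesis
      using w[of i] by simp
  next
    case True
    then have xU: "x \<in> U" using y by simp
    have \<zeta>x: "\<zeta> x = 0"
      using local_parameter_zero_iff[OF parameter xU] by simp
    have cancel: "f x = g x" if fg: "holomorphic_fun A U f" "holomorphic_fun A U g"
      and eq: "\<And>p. p \<in> U \<Longrightarrow> \<zeta> p * f p = \<zeta> p * g p" for f g
    proof -
      have "f x - g x = 0"
        by (rule local_parameter_cancel[OF parameter U order_refl holomorphic_fun_diff[OF fg] _ xU])
          (simp add: right_diff_distrib eq)
      then show ?thesis by simp
    qed
    note holo = gram_holomorphic I.gram_holomorphic
    obtain l where l: "(\<exists>i<?r. l i \<noteq> 0) \<and>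
        (\<forall>c. (\<forall>j<?r. (\<Sum>i<?r. c i * gram i j x) = 0) \<longleftrightarrow> (\<exists>a. \<forall>i<?r. c i = a * l i)) \<and>
        (\<exists>u. holomorphic_fun A U u \<and> u x \<noteq> 0 \<and>
          (\<forall>p\<in>U. (\<Sum>j<?r. (\<Sum>i<?r. l i * gram i j p) * l j) = \<zeta> p * u p))"
      using gram_kernel_at[OF xU parameter] by (rule exE)
    have ker_l: "\<forall>c. (\<forall>j<?r. (\<Sum>i<?r. c i * gram i j x) = 0) \<longleftrightarrow> (\<exists>a. \<forall>i<?r. c i = a * l i)"
      using l by (elim conjE)
    obtain u where u: "holomorphic_fun A U u" "u x \<noteq> 0"
        "\<forall>p\<in>U. (\<Sum>j<?r. (\<Sum>i<?r. l i * gram i j p) * l j) = \<zeta> p * u p"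
      using l[THEN conjunct2, THEN conjunct2] by (elim exE conjE)
    \<comment> \<open>This vector lies in the kernel at \<open>x\<close>, hence is a multiple of
      \<open>l\<close>. So \<open>l\<close> is supported at index 0, and the statement on the
      first-order vanishing of l^T B l becomes one on the corner entry of the Gram matrix.\<close>
    define e0 where "e0 i = (if i = 0 then 1 else 0 :: complex)" for i :: nat
    have "(\<Sum>i<?r. e0 i * gram i j x) = 0" if "j < ?r" for j
    proof -
      have "(\<Sum>i<?r. e0 i * gram i j x) = (\<Sum>i<?r. if i = 0 then gram 0 j x else 0)"
        by (intro sum.cong) (simp_all add: e0_def)
      then show ?thesis using gram_row0[OF xU that] by simp
    qed
    then obtain a where a: "\<forall>i<?r. e0 i = a * l i"
      using ker_l by blast
    have a0: "a * l 0 = 1" using a[rule_format, of 0] by (simp add: e0_def)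
    then have nz: "a \<noteq> 0" "l 0 \<noteq> 0" by auto
    have l0: "l i = 0" if "0 < i" "i < ?r" for i
      using a[rule_format, of i] that nz by (simp add: e0_def)
    have uu: "\<zeta> p * (l 0 * l 0 * I.gram 0 0 p) = \<zeta> p * u p" if p: "p \<in> U" for p
    proof -
      have "(\<Sum>i<?r. l i * gram i j p) = l 0 * gram 0 j p" for j
      proof -
        have "(\<Sum>i<?r. l i * gram i j p) = (\<Sum>i<?r. if i = 0 then l 0 * gram 0 j p else 0)"
          by (intro sum.cong) (simp_all add: l0)
        then show ?thesis by simp
      qed
      note row = this
      have "\<zeta> p * u p = (\<Sum>j<?r. l 0 * gram 0 j p * l j)"
        using bspec[OF u(3) p] unfolding row by (rule sym)
      also have "\<dots> = (\<Sum>j<?r. if j = 0 then l 0 * gram 0 0 p * l 0 else 0)"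
        by (intro sum.cong) (simp_all add: l0)
      also have "\<dots> = l 0 * l 0 * gram 0 0 p" by simp
      finally show ?thesis using rel[of 0 0 p] p by (simp add: w_def)
    qed
    show ?thesis
    proof (rule twisted_matrix_nondegenerate[of "\<lambda>i j. gram i j x" n "\<lambda>i j. I.gram i j x"])
      show "gram i j x = gram j i x" for i j by (rule gram_symmetric)
      show "gram i j x = 0" if "i \<le> n" "j \<le> n" for i j by (rule gram_isotropic[OF xU that])
      show "gram 0 j x = 0" if "j < ?r" for j by (rule gram_row0[OF xU that])
      show "d i = 0" if d: "\<forall>j<?r. (\<Sum>i<?r. d i * gram i j x) = 0" and i: "0 < i" "i < ?r" for d i
      proof -
        obtain b where "\<forall>i<?r. d i = b * l i" using ker_l d by blast
        then show ?thesis using l0[OF i] i(2) by simp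
      qed
      \<comment> \<open>Exactly one index exceeds \<open>n\<close>, so the single factor \<zeta> on
        the right of \<open>rel\<close> cancels.\<close>
      show "I.gram i j x = gram i j x" if "i \<le> n" "n < j" "j < ?r" for i j
        by (rule cancel) (use that rel[of i j] in \<open>simp_all add: holo w_def\<close>)
      show "I.gram j i x = gram j i x" if "i \<le> n" "n < j" "j < ?r" for i j
        by (rule cancel) (use that rel[of j i] in \<open>simp_all add: holo w_def\<close>)
      \<comment> \<open>Two factors \<zeta> against one leave a factor \<zeta>, which is 0 at
        \<open>x\<close>.\<close>
      show "I.gram i j x = 0" if "n < i" "n < j" "i < ?r" "j < ?r" for i j
      proof -
        have "I.gram i j x = \<zeta> x * gram i j x"
          by (rule cancel)
            (use that rel[of i j] local_parameter_holomorphic[OF parameter] in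
              \<open>simp_all add: holo w_def holomorphic_fun_mult\<close>)
        with \<zeta>x show ?thesis by simp
      qed
      \<comment> \<open>No factor on the right: the new entry is the quotient of the old one by
        \<zeta>, and \<open>u\<close> controls its value.\<close>
      have "l 0 * l 0 * I.gram 0 0 x = u x"
        by (rule cancel) (use uu u(1) in \<open>auto intro!: holomorphic_fun_intros holo\<close>)
      with u(2) show "I.gram 0 0 x \<noteq> 0" by auto
    qed (use c True i in simp_all)
  qed
  then show ?thesis
    unfolding I.nondegenerate_fibre_iff[OF y] by blast
qed

end

section \<open>Adapted coordinates around every point and the final assembly\<close>

lemma vector_bundle_coords:
  assumes A: "riemann_surface A" and F: "vector_bundle A r F"
  shows "\<exists>U \<kappa>. y \<in> U \<and> sheaf_coords A F r U \<kappa>"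
proof -
  have sheaf: "sheaf_of_modules A F" using F by (simp add: vector_bundle_def)
  obtain U b where U: "open U" "y \<in> U" "local_frame A F r U b"
    using F unfolding vector_bundle_def by metis
  then obtain \<kappa> where "local_coords A F r U \<kappa>"
    using local_frame_coords[OF A sheaf] by blast
  with U(2) sheaf show ?thesis
    by (auto simp: sheaf_coords_def)
qed

lemma vector_bundle_if_coords:
  assumes F: "sheaf_of_modules A F" and coords: "\<And>y. \<exists>U \<kappa>. y \<in> U \<and> local_coords A F r U \<kappa>"
  shows "vector_bundle A r F"
  unfolding vector_bundle_def
proof (intro conjI allI F)
  fix y
  obtain U \<kappa> where U: "y \<in> U" "local_coords A F r U \<kappa>" using coords by blast
  obtain b where b: "local_frame A F r U b"
    using local_coords_frame[OF F U(2)] by (rule exE)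
  show "\<exists>U b. open U \<and> y \<in> U \<and> local_frame A F r U b"
    by (intro exI[of _ U] exI[of _ b] conjI local_coords.open_domain[OF U(2)] U(1) b)
qed

lemma sheaf_coords_subset:
  assumes "sheaf_coords A F r U \<kappa>" "open V" "V \<subseteq> U"
  shows "sheaf_coords A F r V \<kappa>"
  using assms local_coords_subset by (auto simp: sheaf_coords_def)

lemma short_exact_image_away:
  assumes E: "sheaf_of_modules A E" and F: "sheaf_of_modules A F"
    and exact: "short_exact A E F (skyscraper x (quotient_space (quotient_space (fibre A F x) l) S)) \<iota> (fibre_projection A F x l S)"
    and V: "open V" "x \<notin> V"
  shows "\<iota> V ` sec E V = sec F V"
  unfolding short_exact_image[OF E F exact V(1)] using V(2)
  by (auto simp: fibre_projection_def skyscraper_def)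

text \<open>Around a point other than \<open>x\<close>, the set \<open>U\<close> is shrunk to avoid
  \<open>x\<close> and the parameter is the constant 1; the conditions of the locale at
  \<open>x\<close> are then vacuous. Around \<open>x\<close>, given coordinates are changed by the
  constant matrix from \<open>isotropic_basis\<close>.\<close>

lemma lagrangian_coords_exist:
  fixes A :: "('a::t2_space) chart set"
  assumes A: "riemann_surface A"
    and F: "vector_bundle A (2 * n + 1) F" and M: "vector_bundle A 1 M"
    and bilinear: "bilinear_form A F M \<psi>" and symmetric: "symmetric_form F \<psi>"
    and exact: "short_exact A F (hom_sheaf A F M) (skyscraper x complex_line) (adjoint_map F \<psi>) q"
    and l: "l = form_radical (fibre A F x) (fibre A M x) (fibre_form A F M \<psi> x)"
    and S: "subspace class_ring S (quotient_space (fibre A F x) l)"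
    and dim: "vectorspace.dim class_ring ((quotient_space (fibre A F x) l)\<lparr>carrier := S\<rparr>) = n"
    and iso: "isotropic (fibre A M x) (quotient_form (fibre_form A F M \<psi> x)) S"
    and E: "sheaf_of_modules A E"
    and exact_E: "short_exact A E F (skyscraper x (quotient_space (quotient_space (fibre A F x) l) S))
      \<iota> (fibre_projection A F x l S)"
  shows "\<exists>U \<kappa> \<mu> \<zeta>. y \<in> U \<and> lagrangian_coords A F n U \<kappa> M \<mu> \<psi> x q E \<iota> \<zeta>"
proof -
  let ?r = "2 * n + 1"
  have sheaf_F: "sheaf_of_modules A F" using F by (simp add: vector_bundle_def)
  note hom = short_exact_hom(1)[OF exact_E]
  obtain U1 \<kappa>0 where U1: "y \<in> U1" "sheaf_coords A F ?r U1 \<kappa>0"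
    using vector_bundle_coords[OF A F] by blast
  obtain U2 \<mu> where U2: "y \<in> U2" "sheaf_coords A M 1 U2 \<mu>"
    using vector_bundle_coords[OF A M] by blast
  have o: "open U1" "open U2"
    using U1(2) U2(2) local_coords.open_domain by (auto simp: sheaf_coords_def)
  have form: "length_one_form A F ?r U \<kappa> M \<mu> \<psi> x q"
    if "sheaf_coords A F ?r U \<kappa>" "sheaf_coords A M 1 U \<mu>" for U \<kappa>
    by (intro length_one_form.intro form_coords.intro coords_pair.intro form_coords_axioms.intro
        length_one_form_axioms.intro that bilinear symmetric exact)
  show ?thesis
  proof (cases "y = x")
    case False
    define U where "U = U1 \<inter> U2 - {x}"
    have U: "open U" "U \<subseteq> U1" "U \<subseteq> U2" "y \<in> U" "x \<notin> U"
      using o U1(1) U2(1) False by (auto simp: U_def)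
    interpret L: length_one_form A F ?r U \<kappa>0 M \<mu> \<psi> x q
      by (intro form sheaf_coords_subset[OF U1(2)] sheaf_coords_subset[OF U2(2)] U)
    have "lagrangian_coords A F n U \<kappa>0 M \<mu> \<psi> x q E \<iota> (\<lambda>p. 1)"
    proof (intro lagrangian_coords.intro lagrangian_coords_axioms.intro L.length_one_form_axioms E hom)
      show "inj_on (\<iota> V) (sec E V)" if "open V" for V
        by (rule short_exact_inj[OF exact_E that])
      show "local_parameter A x U (\<lambda>p. 1)"
        by (rule local_parameter_one[OF U(1,5)])
      show "\<iota> V ` sec E V = {s \<in> sec F V. x \<in> V \<longrightarrow> (\<forall>i<?r. i \<in> {n<..} \<longrightarrow> \<kappa>0 V s i x = 0)}"
        if "open V" "V \<subseteq> U" for V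
      proof -
        have "x \<notin> V" using that U by blast
        then show ?thesis using short_exact_image_away[OF E sheaf_F exact_E that(1)] by simp
      qed
    qed (use U(5) in simp_all)
    with U(4) show ?thesis by blast
  next
    case True
    obtain U3 \<zeta> where U3: "x \<in> U3" "local_parameter A x U3 \<zeta>"
      using exists_local_parameter[OF A] by blast
    define U where "U = U1 \<inter> U2 \<inter> U3"
    have U: "open U" "U \<subseteq> U1" "U \<subseteq> U2" "U \<subseteq> U3" "x \<in> U"
      using o U1(1) U2(1) U3(1) True local_parameter_open[OF U3(2)] by (auto simp: U_def)
    have \<zeta>: "local_parameter A x U \<zeta>"
      by (rule local_parameter_subset[OF U3(2) U(1,4)])
    interpret L: length_one_form A F ?r U \<kappa>0 M \<mu> \<psi> x q
      by (intro form sheaf_coords_subset[OF U1(2)] sheaf_coords_subset[OF U2(2)] U)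
    obtain v where v: "(\<exists>i<?r. v i \<noteq> 0) \<and>
        (\<forall>c. (\<forall>j<?r. (\<Sum>i<?r. c i * L.gram i j x) = 0) \<longleftrightarrow> (\<exists>a. \<forall>i<?r. c i = a * v i)) \<and>
        (\<exists>u. holomorphic_fun A U u \<and> u x \<noteq> 0 \<and>
          (\<forall>p\<in>U. (\<Sum>j<?r. (\<Sum>i<?r. v i * L.gram i j p) * v j) = \<zeta> p * u p))"
      using L.gram_kernel_at[OF U(5) \<zeta>] by (rule exE)
    have ker: "c \<in> L.kernel_at x \<longleftrightarrow> (\<exists>a. \<forall>i<?r. c i = a * v i)" for c
      unfolding L.kernel_at_def using v by blast
    have "\<exists>P R. n < ?r \<and>
        (\<forall>i<?r. \<forall>j<?r. (\<Sum>m<?r. P i m * R m j) = (if i = j then 1 else 0)) \<and>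
        (\<forall>i<?r. \<forall>j<?r. (\<Sum>m<?r. R i m * P m j) = (if i = j then 1 else 0)) \<and>
        (\<forall>i<?r. P i 0 = v i) \<and>
        (\<forall>i\<le>n. \<forall>j\<le>n. (\<Sum>b<?r. (\<Sum>a<?r. P a i * L.gram a b x) * P b j) = 0) \<and>
        (\<forall>c. L.coset_at x c \<in> S \<longleftrightarrow> (\<forall>m. n < m \<and> m < ?r \<longrightarrow> (\<Sum>j<?r. R m j * c j) = 0))"
      by (rule L.isotropic_basis[OF U(5) L.gram_symmetric conjunct1[OF v] ker S[unfolded l] dim[unfolded l] iso])
    then obtain P R where PR: "\<forall>i<?r. \<forall>j<?r. (\<Sum>m<?r. P i m * R m j) = (if i = j then 1 else 0)"
      and RP: "\<forall>i<?r. \<forall>j<?r. (\<Sum>m<?r. R i m * P m j) = (if i = j then 1 else 0)"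
      and P0: "\<forall>i<?r. P i 0 = v i"
      and Piso: "\<forall>i\<le>n. \<forall>j\<le>n. (\<Sum>b<?r. (\<Sum>a<?r. P a i * L.gram a b x) * P b j) = 0"
      and RS: "\<forall>c. L.coset_at x c \<in> S \<longleftrightarrow> (\<forall>m. n < m \<and> m < ?r \<longrightarrow> (\<Sum>j<?r. R m j * c j) = 0)"
      by (elim exE conjE)
    define \<kappa> where "\<kappa> = (\<lambda>V s m p. \<Sum>j<?r. R m j * \<kappa>0 V s j p)"
    have coords: "local_coords A F ?r U \<kappa>"
      unfolding \<kappa>_def by (rule change_of_coords[OF L.F.local_coords_axioms PR RP])
    \<comment> \<open>Two coordinate systems are now in use: \<open>L\<close> holds the given
      coordinates, in which \<open>P\<close> and \<open>R\<close> were found, and \<open>G\<close>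
      the adapted ones. The radical and \<open>S\<close> live in the fibre and do not depend on
      either.\<close>
    interpret G: length_one_form A F ?r U \<kappa> M \<mu> \<psi> x q
      by (intro form sheaf_coords.intro sheaf_F coords L.M.sheaf_coords_axioms)
    \<comment> \<open>The new frame has the columns of \<open>P\<close> as values at
      \<open>x\<close>, so its Gram matrix there is P^T B P.\<close>
    have unit: "\<kappa>0 U (G.F.unit_section U i) a x = P a i" if i: "i < ?r" and a: "a < ?r" for i a
    proof -
      have "\<kappa>0 U (G.F.unit_section U i) a x = (\<Sum>m<?r. P a m * \<kappa> U (G.F.unit_section U i) m x)"
        unfolding \<kappa>_def by (rule inverse_matrix_sum[OF PR a, symmetric])
      also have "\<dots> = (\<Sum>m<?r. if m = i then P a i else 0)"
        by (intro sum.cong) (simp_all add: G.F.coord_unit_section[OF U(1) order_refl _ U(5)])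
      finally show ?thesis using i by simp
    qed
    have gram: "G.gram i j x = (\<Sum>b<?r. (\<Sum>a<?r. P a i * L.gram a b x) * P b j)"
      if i: "i < ?r" and j: "j < ?r" for i j
    proof -
      have "G.gram i j x = (\<Sum>b<?r. (\<Sum>a<?r. \<kappa>0 U (G.F.unit_section U i) a x * L.gram a b x) *
          \<kappa>0 U (G.F.unit_section U j) b x)"
        unfolding G.gram_def
        by (intro L.form_expansion U G.F.unit_section_in order_refl)
      also have "\<dots> = (\<Sum>b<?r. (\<Sum>a<?r. P a i * L.gram a b x) * P b j)"
        by (intro sum.cong refl arg_cong2[where f = "(*)"]) (simp_all add: unit[OF i] unit[OF j])
      finally show ?thesis .
    qed
    have "v \<in> L.kernel_at x"
      unfolding ker by (intro exI[of _ 1]) simp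
    then have v0: "(\<Sum>a<?r. P a 0 * L.gram a b x) = 0" if "b < ?r" for b
      using that P0 by (simp add: L.kernel_at_def)
    have "lagrangian_coords A F n U \<kappa> M \<mu> \<psi> x q E \<iota> \<zeta>"
    proof (intro lagrangian_coords.intro lagrangian_coords_axioms.intro G.length_one_form_axioms E hom \<zeta>)
      show "inj_on (\<iota> V) (sec E V)" if "open V" for V
        by (rule short_exact_inj[OF exact_E that])
      show "G.gram i j x = 0" if "i \<le> n" "j \<le> n" for i j
        using gram[of i j] Piso that by simp
      show "G.gram 0 j x = 0" if "j < ?r" for j
        using gram[of 0 j] that v0 by simp
      show "\<iota> V ` sec E V = {s \<in> sec F V. x \<in> V \<longrightarrow> (\<forall>i<?r. i \<in> {n<..} \<longrightarrow> \<kappa> V s i x = 0)}"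
        if V: "open V" "V \<subseteq> U" for V
      proof (cases "x \<in> V")
        case False
        then show ?thesis using short_exact_image_away[OF E sheaf_F exact_E V(1)] by simp
      next
        case True
        have "fibre_projection A F x l S V s = \<zero>\<^bsub>sections (skyscraper x (quotient_space (quotient_space (fibre A F x) l) S)) V\<^esub> \<longleftrightarrow>
            (\<forall>i<?r. i \<in> {n<..} \<longrightarrow> \<kappa> V s i x = 0)" if s: "s \<in> sec F V" for s
        proof -
          have "fibre_projection A F x l S V s = \<zero>\<^bsub>quotient_space (quotient_space (fibre A F x) l) S\<^esub> \<longleftrightarrow>
              L.coset_at x (L.F.coords_at x V s) \<in> S"
            unfolding l by (rule L.fibre_projection_zero_iff[OF U(5) S[unfolded l] V(1) True s])
          also have "\<dots> \<longleftrightarrow> (\<forall>m. n < m \<and> m < ?r \<longrightarrow> (\<Sum>j<?r. R m j * L.F.coords_at x V s j) = 0)"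
            using RS by blast
          also have "\<dots> \<longleftrightarrow> (\<forall>i<?r. i \<in> {n<..} \<longrightarrow> \<kappa> V s i x = 0)"
            unfolding \<kappa>_def L.F.coords_at_eq[OF V s] by auto
          finally show ?thesis by (simp add: skyscraper_def)
        qed
        then show ?thesis
          unfolding short_exact_image[OF E sheaf_F exact_E V(1)] using True by auto
      qed
    qed
    with U(5) True show ?thesis by blast
  qed
qed

theorem proposition3p3:
  fixes A :: "('a::t2_space) chart set" and x :: 'a and n :: nat
    and F :: "('a, 'f) module_sheaf" and M :: "('a, 'm) module_sheaf"
    and \<psi> :: "'a set \<Rightarrow> 'f \<Rightarrow> 'f \<Rightarrow> 'm"
    and q :: "'a set \<Rightarrow> ('a set \<Rightarrow> 'f \<Rightarrow> 'm) \<Rightarrow> complex"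
    and l :: "('a set \<times> 'f) set set"
    and S :: "('a set \<times> 'f) set set set"
    and Q :: "(complex, ('a set \<times> 'f) set set set) module"
    and E :: "('a, 'e) module_sheaf" and \<iota> :: "'a set \<Rightarrow> 'e \<Rightarrow> 'f"
  assumes "compact_connected_riemann_surface A" and "genus A \<ge> 2"
    and "vector_bundle A (2 * n + 1) F" and "vector_bundle A 1 M"
    and "bilinear_form A F M \<psi>" and "symmetric_form F \<psi>"
    and "short_exact A F (hom_sheaf A F M) (skyscraper x complex_line) (adjoint_map F \<psi>) q"
    and "l = form_radical (fibre A F x) (fibre A M x) (fibre_form A F M \<psi> x)"
    and "subspace class_ring S (quotient_space (fibre A F x) l)"
    and "vectorspace.dim class_ring ((quotient_space (fibre A F x) l)\<lparr>carrier := S\<rparr>) = n"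
    and "isotropic (fibre A M x) (quotient_form (fibre_form A F M \<psi> x)) S"
    and "Q = quotient_space (quotient_space (fibre A F x) l) S"
    and "sheaf_of_modules A E"
    and "short_exact A E F (skyscraper x Q) \<iota> (fibre_projection A F x l S)"
  shows "(\<forall>U. open U \<longrightarrow> (\<forall>s\<in>sec E U. \<forall>t\<in>sec E U.
            \<psi> U (\<iota> U s) (\<iota> U t) \<in> sec (twist A M x) U)) \<and>
         orthogonal_structure A (2 * n + 1) E (twist A M x) (\<lambda>U s t. \<psi> U (\<iota> U s) (\<iota> U t))"
proof -
  let ?L = "twist A M x" and ?\<phi> = "\<lambda>U s t. \<psi> U (\<iota> U s) (\<iota> U t)"
  have A: "riemann_surface A"
    using assms(1) by (simp add: compact_connected_riemann_surface_def)
  have coords: "\<exists>U \<kappa> \<mu> \<zeta>. y \<in> U \<and> lagrangian_coords A F n U \<kappa> M \<mu> \<psi> x q E \<iota> \<zeta>" for y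
    by (rule lagrangian_coords_exist[OF A assms(3-11) assms(13) assms(14)[unfolded assms(12)]])
  \<comment> \<open>A single neighbourhood of \<open>x\<close> settles the assertions over all open
    sets, because both the sheaf property of the twist and membership in it are decided by values at
    \<open>x\<close>.\<close>
  obtain U \<kappa> \<mu> \<zeta> where xU: "x \<in> U" and L: "lagrangian_coords A F n U \<kappa> M \<mu> \<psi> x q E \<iota> \<zeta>"
    using coords by blast
  interpret L: lagrangian_coords A F n U \<kappa> M \<mu> \<psi> x q E \<iota> \<zeta> by (rule L)
  have in_twist: "?\<phi> V s t \<in> sec ?L V" if "open V" "s \<in> sec E V" "t \<in> sec E V" for V s t
    by (rule L.induced_form_in_twist[OF that xU])
  have twist: "sheaf_of_modules A ?L"
    by (rule L.M.twist_sheaf[OF xU])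
  have ops: "(\<oplus>\<^bsub>sections ?L V\<^esub>) = (\<oplus>\<^bsub>sections M V\<^esub>)" "(\<odot>\<^bsub>sections ?L V\<^esub>) = (\<odot>\<^bsub>sections M V\<^esub>)"
    "restr ?L = restr M" for V
    by (simp_all add: twist_def)
  have bil: "bilinear_form A E ?L ?\<phi>"
    unfolding bilinear_form_def
  proof (intro conjI allI impI ballI; (elim conjE)?)
    fix V t assume V: "open V" and t: "t \<in> sec E V"
    note h = sheaf_hom_module_hom[OF L.hom V]
    show "(\<lambda>s. ?\<phi> V s t) \<in> module_hom (structure_sheaf A V) (sections E V) (sections ?L V)"
      unfolding module_hom_def using V t in_twist
      by (auto simp: ops module_hom_add[OF h] module_hom_smult[OF h] L.form_add_left L.form_smult_left L.\<iota>_in)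
    show "(\<lambda>s. ?\<phi> V t s) \<in> module_hom (structure_sheaf A V) (sections E V) (sections ?L V)"
      unfolding module_hom_def using V t in_twist
      by (auto simp: ops module_hom_add[OF h] module_hom_smult[OF h] L.form_add_right L.form_smult_right L.\<iota>_in)
  next
    fix V W s t assume V: "open V" "open W" "W \<subseteq> V" and s: "s \<in> sec E V" and t: "t \<in> sec E V"
    show "?\<phi> W (restr E V W s) (restr E V W t) = restr ?L V W (?\<phi> V s t)"
      unfolding ops sheaf_hom_restr[OF L.hom V s] sheaf_hom_restr[OF L.hom V t]
      by (rule L.form_restr[OF V L.\<iota>_in[OF V(1) s] L.\<iota>_in[OF V(1) t]])
  qed
  have sym: "symmetric_form E ?\<phi>"
    unfolding symmetric_form_def
  proof (intro allI impI ballI)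
    fix V s t assume "open V" "s \<in> sec E V" "t \<in> sec E V"
    then show "?\<phi> V s t = ?\<phi> V t s"
      using assms(6) L.\<iota>_in unfolding symmetric_form_def by blast
  qed
  \<comment> \<open>Local freeness and nondegeneracy are checked point by point, with a new adapted
    neighbourhood for each \<open>y\<close>.\<close>
  have local: "(\<exists>U \<kappa>'. y \<in> U \<and> local_coords A E (2 * n + 1) U \<kappa>') \<and>
      (\<exists>U \<mu>'. y \<in> U \<and> local_coords A ?L 1 U \<mu>') \<and>
      nondegenerate (fibre A E y) (fibre A ?L y) (fibre_form A E ?L ?\<phi> y)" for y
  proof -
    obtain U \<kappa> \<mu> \<zeta> where y: "y \<in> U" and Y: "lagrangian_coords A F n U \<kappa> M \<mu> \<psi> x q E \<iota> \<zeta>"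
      using coords by blast
    interpret Y: lagrangian_coords A F n U \<kappa> M \<mu> \<psi> x q E \<iota> \<zeta> by (rule Y)
    obtain \<kappa>' where "local_coords A E (2 * n + 1) U \<kappa>'"
      using Y.induced_coords by (elim exE conjE)
    moreover obtain \<mu>' where "local_coords A ?L 1 U \<mu>'"
      using Y.twist_coords[OF twist] by (elim exE conjE)
    ultimately show ?thesis
      by (intro conjI exI[of _ U] exI[of _ \<kappa>'] exI[of _ \<mu>'] y Y.induced_form_nondegenerate[OF twist bil y])
  qed
  have "vector_bundle A (2 * n + 1) E"
    by (rule vector_bundle_if_coords[OF assms(13) conjunct1[OF local]])
  moreover have "vector_bundle A 1 ?L"
    by (rule vector_bundle_if_coords[OF twist conjunct1[OF conjunct2[OF local]]])
  moreover have "nondegenerate (fibre A E y) (fibre A ?L y) (fibre_form A E ?L ?\<phi> y)" for y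
    by (rule conjunct2[OF conjunct2[OF local]])
  ultimately show ?thesis
    unfolding orthogonal_structure_def
    by (intro conjI allI impI ballI bil sym in_twist)
qed

end
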